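(* Let $x$ be a $T$-periodic brake orbit with linearization coefficients $P,Q,R$ and monodromy matrix $\gamma(T)$, let $\mathbf C^\perp=\{\lambda\in\mathbf C:\operatorname{Im}\lambda>0\}$, and assume $m^-(x,\Lambda_P)=k$, where $m^-(x,\Lambda_P)$ is the Morse index under the periodic boundary condition. Then $$\dim\bigoplus_{\lambda\in\sigma(\gamma(T))\cap\mathbf C^\perp}\ker(\gamma(T)-\lambda I_{2n})\le 2k.$$
   Context: **Brake orbit.** Let $L(t,x,\dot x)$ be a $C^2$ Lagrangian on $\mathbf R\times\mathbf R^n\times\mathbf R^n$, $T$-periodic in $t$, with $D^2_{vv}L$ everywhere positive definite. A brake periodic orbit is a solution $x$ of the Euler–Lagrange equation with $\dot x(0)=\dot x(T/2)=0$, $x(T/2+t)=x(T/2-t)$, $x(T+t)=x(t)$ for all $t\in\mathbf R$, whose linearization coefficients $P=\frac{\partial^2L}{\partial\dot x^2}$, $Q=\frac{\partial^2L}{\partial x\partial\dot x}$, $R=\frac{\partial^2L}{\partial x^2}$ along $x$ are (continuous) real $T$-periodic symmetric $n\times n$ matrices, $P(t)$ positive definite, satisfying $P(-t)=P(t)$, $Q(-t)=-Q(t)$, $R(-t)=R(t)$ for all $t\in\mathbf R$. **Monodromy.** $\gamma$ solves $\dot\gamma=J\mathcal B\gamma$, $\gamma(0)=I_{2n}$, with $J=\begin{bmatrix}0&-I_n\\ I_n&0\end{bmatrix}$, $\mathcal B=\begin{bmatrix}P^{-1}&-P^{-1}Q\\ -Q^TP^{-1}&Q^TP^{-1}Q-R\end{bmatrix}$.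 $\gamma(T)$ acts on $\mathbf C^{2n}$; $\sigma$ denotes its spectrum. **Morse index.** $\mathcal A\xi=-\frac{d}{dt}(P\dot \xi+Q\xi)+Q^T\dot \xi+R\xi$ is considered as a self-adjoint operator on $L^2([0,T],\mathbf C^n)$ with domain consisting of $\xi\in W^{1,2}([0,T],\mathbf C^n)$ with $y:=P\dot\xi+Q\xi\in W^{1,2}$ and satisfying the periodic boundary condition $\Lambda_P$: $\xi(0)=\xi(T)$, $y(0)=y(T)$. $m^-(x,\Lambda_P)$ is the number of its negative eigenvalues, counted with multiplicity. *)

theory Defs
  imports "HOL-Analysis.Analysis" "HOL-Library.Function_Algebras" "HOL-Library.Extended_Nat"
begin

section \<open>Brake orbits of a Lagrangian\<close>

text \<open>A Lagrangian is a function of the triple \<open>(t, q, v)\<close> in \<open>\<real> \<times> \<real>\<^sup>n \<times> \<real>\<^sup>n\<close>.\<close>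

type_synonym 'n lagr = "real \<times> (real^'n) \<times> (real^'n) \<Rightarrow> real"

definition C2 :: "('a::real_normed_vector \<Rightarrow> real) \<Rightarrow> bool" where
  "C2 f \<longleftrightarrow> (\<exists>(D :: 'a \<Rightarrow> 'a \<Rightarrow>\<^sub>L real) (D2 :: 'a \<Rightarrow> 'a \<Rightarrow>\<^sub>L ('a \<Rightarrow>\<^sub>L real)).
     (\<forall>z. (f has_derivative blinfun_apply (D z)) (at z)) \<and>
     (\<forall>z. (D has_derivative blinfun_apply (D2 z)) (at z)) \<and>
     continuous_on UNIV D2)"

definition dirderiv :: "('a::real_normed_vector \<Rightarrow> real) \<Rightarrow> 'a \<Rightarrow> 'a \<Rightarrow> real" where
  "dirderiv f u z = frechet_derivative f (at z) u"

definition dq :: "'n::finite \<Rightarrow> 'n lagr \<Rightarrow> 'n lagr" where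
  "dq i L = dirderiv L (0, axis i 1, 0)"

definition dv :: "'n::finite \<Rightarrow> 'n lagr \<Rightarrow> 'n lagr" where
  "dv i L = dirderiv L (0, 0, axis i 1)"

text \<open>In \<open>hess_qv\<close> the row index belongs to the velocity and the column index to the position,
  so that \<open>P \<xi>' + Q \<xi>\<close> is the linearization of the momentum \<open>\<partial>L/\<partial>v\<close>.\<close>

definition hess_vv :: "'n::finite lagr \<Rightarrow> real \<times> (real^'n) \<times> (real^'n) \<Rightarrow> real^'n^'n" where
  "hess_vv L z = (\<chi> i j. dv j (dv i L) z)"

definition hess_qv :: "'n::finite lagr \<Rightarrow> real \<times> (real^'n) \<times> (real^'n) \<Rightarrow> real^'n^'n" where
  "hess_qv L z = (\<chi> i j. dq j (dv i L) z)"

definition hess_qq :: "'n::finite lagr \<Rightarrow> real \<times> (real^'n) \<times> (real^'n) \<Rightarrow> real^'n^'n" where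
  "hess_qq L z = (\<chi> i j. dq j (dq i L) z)"

definition symmetric_mat :: "real^'n^'n \<Rightarrow> bool" where
  "symmetric_mat A \<longleftrightarrow> transpose A = A"

definition pos_def_mat :: "real^'n::finite^'n \<Rightarrow> bool" where
  "pos_def_mat A \<longleftrightarrow> symmetric_mat A \<and> (\<forall>w. w \<noteq> 0 \<longrightarrow> 0 < w \<bullet> (A *v w))"

definition periodic_convex_lagrangian :: "real \<Rightarrow> 'n::finite lagr \<Rightarrow> bool" where
  "periodic_convex_lagrangian T L \<longleftrightarrow>
     C2 L \<and> (\<forall>t q v. L (t + T, q, v) = L (t, q, v)) \<and> (\<forall>z. pos_def_mat (hess_vv L z))"

definition along :: "(real \<Rightarrow> real^'n) \<Rightarrow> real \<Rightarrow> real \<times> (real^'n) \<times> (real^'n)" where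
  "along x t = (t, x t, vector_derivative x (at t))"

definition euler_lagrange :: "'n::finite lagr \<Rightarrow> (real \<Rightarrow> real^'n) \<Rightarrow> bool" where
  "euler_lagrange L x \<longleftrightarrow>
     (\<forall>t. x differentiable at t) \<and> continuous_on UNIV (\<lambda>t. vector_derivative x (at t)) \<and>
     (\<forall>t i. ((\<lambda>s. dv i L (along x s)) has_real_derivative dq i L (along x t)) (at t))"

definition coeff_P :: "'n::finite lagr \<Rightarrow> (real \<Rightarrow> real^'n) \<Rightarrow> real \<Rightarrow> real^'n^'n" where
  "coeff_P L x t = hess_vv L (along x t)"

definition coeff_Q :: "'n::finite lagr \<Rightarrow> (real \<Rightarrow> real^'n) \<Rightarrow> real \<Rightarrow> real^'n^'n" where
  "coeff_Q L x t = hess_qv L (along x t)"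

definition coeff_R :: "'n::finite lagr \<Rightarrow> (real \<Rightarrow> real^'n) \<Rightarrow> real \<Rightarrow> real^'n^'n" where
  "coeff_R L x t = hess_qq L (along x t)"

definition brake_coefficients ::
  "real \<Rightarrow> (real \<Rightarrow> real^'n::finite^'n) \<Rightarrow> (real \<Rightarrow> real^'n^'n) \<Rightarrow> (real \<Rightarrow> real^'n^'n) \<Rightarrow> bool" where
  "brake_coefficients T P Q R \<longleftrightarrow>
     continuous_on UNIV P \<and> continuous_on UNIV Q \<and> continuous_on UNIV R \<and>
     (\<forall>t. P (t + T) = P t \<and> Q (t + T) = Q t \<and> R (t + T) = R t) \<and>
     (\<forall>t. pos_def_mat (P t) \<and> symmetric_mat (Q t) \<and> symmetric_mat (R t)) \<and>
     (\<forall>t. P (- t) = P t \<and> Q (- t) = - Q t \<and> R (- t) = R t)"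

definition brake_orbit :: "real \<Rightarrow> 'n::finite lagr \<Rightarrow> (real \<Rightarrow> real^'n) \<Rightarrow> bool" where
  "brake_orbit T L x \<longleftrightarrow>
     euler_lagrange L x \<and>
     vector_derivative x (at 0) = 0 \<and> vector_derivative x (at (T / 2)) = 0 \<and>
     (\<forall>t. x (T / 2 + t) = x (T / 2 - t)) \<and> (\<forall>t. x (T + t) = x t) \<and>
     brake_coefficients T (coeff_P L x) (coeff_Q L x) (coeff_R L x)"

section \<open>Monodromy\<close>

text \<open>\<open>2n \<times> 2n\<close> matrices are indexed by the sum type \<open>'n + 'n\<close>; \<open>Inl\<close> is the first block.\<close>

definition block_mat :: "'a^'n^'n \<Rightarrow> 'a^'n^'n \<Rightarrow> 'a^'n^'n \<Rightarrow> 'a^'n^'n \<Rightarrow> 'a^('n + 'n)^('n + 'n)" where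
  "block_mat A B C D = (\<chi> i j. case i of
       Inl a \<Rightarrow> (case j of Inl b \<Rightarrow> A $ a $ b | Inr b \<Rightarrow> B $ a $ b)
     | Inr a \<Rightarrow> (case j of Inl b \<Rightarrow> C $ a $ b | Inr b \<Rightarrow> D $ a $ b))"

definition J_mat :: "real^('n::finite + 'n)^('n + 'n)" where
  "J_mat = block_mat (mat 0) (- mat 1) (mat 1) (mat 0)"

definition hamiltonian_mat ::
  "real^'n::finite^'n \<Rightarrow> real^'n^'n \<Rightarrow> real^'n^'n \<Rightarrow> real^('n + 'n)^('n + 'n)" where
  "hamiltonian_mat P Q R =
     block_mat (matrix_inv P) (- (matrix_inv P ** Q))
       (- (transpose Q ** matrix_inv P)) (transpose Q ** matrix_inv P ** Q - R)"

definition fundamental_solution ::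
  "(real \<Rightarrow> real^'n::finite^'n) \<Rightarrow> (real \<Rightarrow> real^'n^'n) \<Rightarrow> (real \<Rightarrow> real^'n^'n) \<Rightarrow>
   (real \<Rightarrow> real^('n + 'n)^('n + 'n)) \<Rightarrow> bool" where
  "fundamental_solution P Q R \<gamma> \<longleftrightarrow>
     \<gamma> 0 = mat 1 \<and>
     (\<forall>t. (\<gamma> has_vector_derivative J_mat ** hamiltonian_mat (P t) (Q t) (R t) ** \<gamma> t) (at t))"

definition complexify :: "real^'m^'k \<Rightarrow> complex^'m^'k" where
  "complexify = map_matrix complex_of_real"

definition mat_spectrum :: "complex^'m::finite^'m \<Rightarrow> complex set" where
  "mat_spectrum A = {z. \<not> invertible (A - mat z)}"

definition mat_kernel :: "complex^'m::finite^'m \<Rightarrow> (complex^'m) set" where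
  "mat_kernel A = {w. A *v w = 0}"

section \<open>Morse index\<close>

text \<open>The complex vector space of all functions from \<open>\<real>\<close> to \<open>\<complex>\<^sup>n\<close>.\<close>

definition fun_scale :: "complex \<Rightarrow> (real \<Rightarrow> complex^'n) \<Rightarrow> real \<Rightarrow> complex^'n" where
  "fun_scale c f = (\<lambda>t. c *s f t)"

interpretation cfun: vector_space "fun_scale :: complex \<Rightarrow> (real \<Rightarrow> complex^'n) \<Rightarrow> _"
  by unfold_locales
    (simp_all add: fun_scale_def fun_eq_iff vec_eq_iff algebra_simps)

definition cfun_dim :: "(real \<Rightarrow> complex^'n) set \<Rightarrow> enat" where
  "cfun_dim V = (SUP B \<in> {B. finite B \<and> B \<subseteq> V \<and> cfun.independent B}. enat (card B))"

text \<open>\<open>W12 T u g\<close>: on \<open>[0,T]\<close>, \<open>u\<close> is the absolutely continuous representative of an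
  element of \<open>W\<^sup>1\<^sup>,\<^sup>2([0,T], \<complex>\<^sup>n)\<close> and \<open>g\<close> represents its weak derivative, which lies in
  \<open>L\<^sup>2\<close>. Hence \<open>u 0\<close> and \<open>u T\<close> are the boundary values of \<open>u\<close>.\<close>

definition L2_on :: "real \<Rightarrow> (real \<Rightarrow> complex^'n::finite) \<Rightarrow> bool" where
  "L2_on T g \<longleftrightarrow> set_borel_measurable lborel {0..T} g \<and>
     set_integrable lborel {0..T} (\<lambda>t. (norm (g t))\<^sup>2)"

definition W12 :: "real \<Rightarrow> (real \<Rightarrow> complex^'n::finite) \<Rightarrow> (real \<Rightarrow> complex^'n) \<Rightarrow> bool" where
  "W12 T u g \<longleftrightarrow> L2_on T g \<and>
     (\<forall>t\<in>{0..T}. u t = u 0 + set_lebesgue_integral lborel {0..t} g)"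

text \<open>The graph of the operator \<open>A\<close> with periodic boundary condition: \<open>\<xi>\<close> is in the domain and
  \<open>A \<xi> = \<eta>\<close> in \<open>L\<^sup>2\<close>. Every class in the domain is represented by its unique continuous
  representative on \<open>[0,T]\<close>, extended by \<open>0\<close> outside \<open>[0,T]\<close>; without a fixed
  extension, eigenspaces would be infinite-dimensional. Here \<open>\<xi>'\<close> and \<open>y'\<close> are the weak
  derivatives, and \<open>y\<close> is the continuous representative of \<open>P \<xi>' + Q \<xi>\<close>.\<close>

definition periodic_operator ::
  "real \<Rightarrow> (real \<Rightarrow> real^'n::finite^'n) \<Rightarrow> (real \<Rightarrow> real^'n^'n) \<Rightarrow> (real \<Rightarrow> real^'n^'n) \<Rightarrow>
   (real \<Rightarrow> complex^'n) \<Rightarrow> (real \<Rightarrow> complex^'n) \<Rightarrow> bool" where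
  "periodic_operator T P Q R \<xi> \<eta> \<longleftrightarrow>
     (\<forall>t. t \<notin> {0..T} \<longrightarrow> \<xi> t = 0) \<and>
     (\<exists>\<xi>' y y'. W12 T \<xi> \<xi>' \<and> W12 T y y' \<and>
        (AE t in lborel. t \<in> {0..T} \<longrightarrow>
           y t = complexify (P t) *v \<xi>' t + complexify (Q t) *v \<xi> t) \<and>
        \<xi> 0 = \<xi> T \<and> y 0 = y T \<and>
        (AE t in lborel. t \<in> {0..T} \<longrightarrow>
           \<eta> t = - y' t + complexify (transpose (Q t)) *v \<xi>' t + complexify (R t) *v \<xi> t))"

definition eigenspace ::
  "real \<Rightarrow> (real \<Rightarrow> real^'n::finite^'n) \<Rightarrow> (real \<Rightarrow> real^'n^'n) \<Rightarrow> (real \<Rightarrow> real^'n^'n) \<Rightarrow>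
   real \<Rightarrow> (real \<Rightarrow> complex^'n) set" where
  "eigenspace T P Q R \<mu> =
     {\<xi>. periodic_operator T P Q R \<xi> (fun_scale (complex_of_real \<mu>) \<xi>)}"

definition negative_eigenvalues ::
  "real \<Rightarrow> (real \<Rightarrow> real^'n::finite^'n) \<Rightarrow> (real \<Rightarrow> real^'n^'n) \<Rightarrow> (real \<Rightarrow> real^'n^'n) \<Rightarrow> real set" where
  "negative_eigenvalues T P Q R =
     {\<mu>. \<mu> < 0 \<and> (\<exists>\<xi>\<in>eigenspace T P Q R \<mu>. \<xi> \<noteq> (\<lambda>t. 0))}"

text \<open>The sum of the multiplicities of all negative eigenvalues, as an extended natural number so
  that no finiteness is built into the definition. As \<open>A\<close> is self-adjoint, its eigenvalues
  are real and the multiplicity of an eigenvalue is the dimension of its eigenspace.\<close>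

definition morse_index ::
  "real \<Rightarrow> (real \<Rightarrow> real^'n::finite^'n) \<Rightarrow> (real \<Rightarrow> real^'n^'n) \<Rightarrow> (real \<Rightarrow> real^'n^'n) \<Rightarrow> enat" where
  "morse_index T P Q R =
     (SUP F \<in> {F. finite F \<and> F \<subseteq> negative_eigenvalues T P Q R}.
        \<Sum>\<mu>\<in>F. cfun_dim (eigenspace T P Q R \<mu>))"

end

theory Submission
  imports Defs "HOL-Complex_Analysis.Great_Picard"
begin

text \<open>
  Let \<open>M = \<gamma>(T)\<close>, let \<open>N\<close> flip the sign of the momentum, and let \<open>E\<close> be the span of the eigenvectors of
  \<open>M\<close> with eigenvalue in the upper half plane. The brake symmetry \<open>N M N = M\<^sup>-\<^sup>1\<close> turns the symplectic form
  into a Hermitian pairing on which \<open>M\<close> acts in such a way that \<open>E\<close> is isotropic. For \<open>v\<close> in \<open>E\<close> consider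
  on \<open>[0, T/2]\<close> the solutions starting in \<open>v + N v\<close> (zero momentum) and in \<open>v - N v\<close> (zero position). Their
  actions are the boundary terms at \<open>T/2\<close>, and isotropy makes them opposite to each other. Hence \<open>dim E\<close> is
  at most the sum of the dimensions of two spaces of \<open>C\<^sup>1\<close> functions on \<open>[0, T/2]\<close> with nonpositive action.
  Neither contains a nonzero null vector of the action, since such a vector would continue evenly to a
  \<open>T\<close>-periodic solution and thus give an eigenvector of \<open>M\<close> with eigenvalue 1. So each of the two
  dimensions is at most the Neumann index on \<open>[0, T/2]\<close>, and Neumann eigenfunctions continue evenly to
  periodic ones.

  Negative Neumann eigenvalues are found by minimizing the action over the unit sphere of \<open>L\<^sup>2\<close>
  orthogonally to the eigenfunctions already known. Along a minimizing sequence both the positions and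
  the primitives of the forces are equicontinuous, and the momenta are asymptotically equal to the
  latter; so the limit is a classical solution.
\<close>

text \<open>The factor 2 comes from the two kinds of initial data. The boundary term at T/2 of the
  solution from \<open>v + N v\<close> is a Hermitian form on \<open>E\<close>. A subspace where it
  is nonpositive and one where it is nonnegative together have at least the dimension of
  \<open>E\<close>, and on the second it is the solutions from \<open>v - N v\<close> that have
  nonpositive action. Nonpositive action alone only gives an infimum m \<le> 0 of the Rayleigh
  quotient. Excluding null vectors is what makes m negative: for m = 0 the given curve would itself
  be a minimizer, hence a Neumann solution. No nonzero v in \<open>E\<close> produces one, because
  \<open>N\<close> sends an eigenvector for z to one for 1/z, from the upper to the lower half
  plane, so that the components of v and \<open>N v\<close> can neither cancel nor add up to an
  eigenvector for 1. Counting replaces the spectral theorem. In more than k dimensions, k complex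
  linear conditions leave a solution that is orthogonal in L2 to the even parts of all known
  negative eigenfunctions, and a single minimization then yields one eigenfunction too many.\<close>

section \<open>Integral inequalities and semidefinite forms\<close>

lemma integral_square_le:
  fixes g :: "real \<Rightarrow> real"
  assumes "s \<le> t" "continuous_on {s..t} g"
  shows "(integral {s..t} g)\<^sup>2 \<le> (t - s) * integral {s..t} (\<lambda>x. (g x)\<^sup>2)"
proof (cases "s = t")
  case False
  with assms have st: "t - s > 0" by simp
  \<comment> \<open>The mean of \<open>g\<close>: expanding the nonnegative integral of
    \<open>(g - c)\<close> squared gives the claim after multiplication by
    \<open>t - s\<close>.\<close>
  define c where "c = integral {s..t} g / (t - s)"
  have ig: "g integrable_on {s..t}" "(\<lambda>x. (g x)\<^sup>2) integrable_on {s..t}"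
    using assms by (auto intro!: integrable_continuous_interval continuous_intros)
  have "0 \<le> integral {s..t} (\<lambda>x. (g x - c)\<^sup>2)"
    using assms by (intro integral_nonneg integrable_continuous_interval continuous_intros) auto
  also have "(\<lambda>x. (g x - c)\<^sup>2) = (\<lambda>x. ((g x)\<^sup>2 - (2 * c) * g x) + c\<^sup>2)"
    by (auto simp: power2_eq_square algebra_simps)
  also have "integral {s..t} \<dots> = integral {s..t} (\<lambda>x. (g x)\<^sup>2) - 2 * c * integral {s..t} g + c\<^sup>2 * (t - s)"
  proof -
    have i2: "(\<lambda>x. 2 * c * g x) integrable_on {s..t}" using ig(1) by (rule integrable_on_mult_right)
    have "integral {s..t} (\<lambda>x. ((g x)\<^sup>2 - (2 * c) * g x) + c\<^sup>2)
        = (integral {s..t} (\<lambda>x. (g x)\<^sup>2) - integral {s..t} (\<lambda>x. (2 * c) * g x)) + integral {s..t} (\<lambda>x. c\<^sup>2)"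
      using integral_add[OF integrable_diff[OF ig(2) i2] integrable_const_ivl, of "c\<^sup>2"] integral_diff[OF ig(2) i2]
      by simp
    then show ?thesis using assms(1) by simp
  qed
  finally have "(t - s) * (2 * c * integral {s..t} g - c\<^sup>2 * (t - s)) \<le> (t - s) * integral {s..t} (\<lambda>x. (g x)\<^sup>2)"
    using st by (intro mult_left_mono) auto
  moreover have "(t - s) * (2 * c * integral {s..t} g - c\<^sup>2 * (t - s)) = (integral {s..t} g)\<^sup>2"
  proof -
    have c: "(t - s) * c = integral {s..t} g" using st by (simp add: c_def)
    have "(t - s) * (2 * c * integral {s..t} g - c\<^sup>2 * (t - s))
        = 2 * ((t - s) * c) * integral {s..t} g - ((t - s) * c)\<^sup>2"
      by (simp add: power2_eq_square algebra_simps)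
    then show ?thesis unfolding c by (simp add: power2_eq_square)
  qed
  ultimately show ?thesis by simp
qed simp

lemma integral_square_eq_0D:
  fixes g :: "real \<Rightarrow> 'v::euclidean_space"
  assumes "continuous_on {a..b} g" "integral {a..b} (\<lambda>t. (norm (g t))\<^sup>2) \<le> 0" "a < b" "t \<in> {a..b}"
  shows "g t = 0"
proof -
  have i: "(\<lambda>t. (norm (g t))\<^sup>2) integrable_on {a..b}"
    using assms by (intro integrable_continuous_interval continuous_intros)
  then have "integral {a..b} (\<lambda>t. (norm (g t))\<^sup>2) \<ge> 0" by (intro integral_nonneg) auto
  then have "((\<lambda>t. (norm (g t))\<^sup>2) has_integral 0) (cbox a b)"
    using i assms by (simp add: has_integral_iff)
  moreover have "continuous_on (cbox a b) (\<lambda>t. (norm (g t))\<^sup>2)"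
    using assms(1) by (simp add: continuous_on_norm continuous_on_power)
  ultimately have "(norm (g t))\<^sup>2 = 0"
    using assms(3,4) by (intro has_integral_0_cbox_imp_0[of a b "\<lambda>t. (norm (g t))\<^sup>2"]) auto
  then show ?thesis by simp
qed

text \<open>Nonnegativity is confined to a subspace because the action minus m times the L2 product
  is nonnegative only on the complement of the known eigenfunctions. Null vectors are allowed, which
  calls for the case distinction.\<close>

lemma psd_cauchy_schwarz:
  fixes h :: "'x::real_vector \<Rightarrow> 'x \<Rightarrow> real"
  assumes "bilinear h" "\<And>x y. h x y = h y x" "subspace V" "\<And>x. x \<in> V \<Longrightarrow> 0 \<le> h x x"
    and "x \<in> V" "y \<in> V"
  shows "(h x y)\<^sup>2 \<le> h x x * h y y"
proof -
  have q: "0 \<le> h x x + 2 * s * h x y + s\<^sup>2 * h y y" for s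
  proof -
    have "0 \<le> h (x + s *\<^sub>R y) (x + s *\<^sub>R y)"
      using assms by (simp add: subspace_add subspace_scale)
    also have "\<dots> = h x x + 2 * s * h x y + s\<^sup>2 * h y y"
      using assms(1,2) by (simp add: bilinear_ladd bilinear_radd bilinear_lmul bilinear_rmul
        power2_eq_square algebra_simps)
    finally show ?thesis .
  qed
  show ?thesis
  proof (cases "h y y = 0")
    case True
    have "h x y = 0"
    proof (rule ccontr)
      assume "h x y \<noteq> 0"
      \<comment> \<open>For a null vector y the polynomial in s is affine; at this s it equals
        -1.\<close>
      with q[of "- (h x x + 1) / (2 * h x y)"] True show False by (simp add: field_simps)
    qed
    with True show ?thesis by simp
  next
    case False
    with assms have "h y y > 0" by (metis less_eq_real_def)
    with q[of "- h x y / h y y"] show ?thesis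
      by (simp add: field_simps power2_eq_square)
  qed
qed

text \<open>Gram-Schmidt for a form with null vectors. A null \<open>b'\<close> cannot be
  normalized, but by Cauchy-Schwarz it is orthogonal to everything. The L2 product of curves is
  degenerate in this way, since it ignores what happens outside the interval.\<close>

lemma psd_projection_exists:
  fixes h :: "'x::real_vector \<Rightarrow> 'x \<Rightarrow> real"
  assumes bil: "bilinear h" and sym: "\<And>x y. h x y = h y x" and psd: "\<And>x. 0 \<le> h x x"
    and "finite Y"
  shows "\<exists>z \<in> span Y. \<forall>b\<in>Y. h (e - z) b = 0"
  using \<open>finite Y\<close>
proof (induction Y arbitrary: e)
  case empty
  then show ?case by (auto intro!: bexI[of _ 0])
next
  case (insert b Y)
  from insert.IH[of b] obtain zb where zb: "zb \<in> span Y" "\<forall>c\<in>Y. h (b - zb) c = 0" by blast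
  from insert.IH[of e] obtain ze where ze: "ze \<in> span Y" "\<forall>c\<in>Y. h (e - ze) c = 0" by blast
  define b' where "b' = b - zb"
  define l where "l = h (e - ze) b' / h b' b'"
  define z where "z = ze + l *\<^sub>R b'"
  have sub: "span Y \<subseteq> span (insert b Y)" by (intro span_mono) auto
  have Y0: "h (e - z) c = 0" if "c \<in> Y" for c
    using zb ze that unfolding z_def b'_def
    by (simp add: bilinear_ladd[OF bil] bilinear_lsub[OF bil] bilinear_lmul[OF bil])
  have "h (e - z) c = 0" if "c \<in> span Y" for c
    using that
  proof (induction rule: span_induct_alt)
    case base
    then show ?case by (simp add: bilinear_rzero[OF bil])
  next
    case (step c x y)
    then show ?case using Y0 by (simp add: bilinear_radd[OF bil] bilinear_rmul[OF bil])
  qed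
  then have "h (e - z) zb = 0" using zb by blast
  moreover have "h (e - z) b' = 0"
  proof (cases "h b' b' = 0")
    case True
    have "(h (e - z) b')\<^sup>2 \<le> h (e - z) (e - z) * h b' b'"
      by (rule psd_cauchy_schwarz[OF bil sym, of UNIV]) (auto simp: psd)
    with True show ?thesis by simp
  next
    case False
    have "h (e - z) b' = h (e - ze) b' - l * h b' b'"
      unfolding z_def by (simp add: bilinear_ladd[OF bil] bilinear_lsub[OF bil] bilinear_lmul[OF bil])
    with False show ?thesis by (simp add: l_def)
  qed
  ultimately have "h (e - z) b = 0"
    using bilinear_radd[OF bil, of "e - z" b' zb] by (simp add: b'_def)
  moreover have "z \<in> span (insert b Y)"
    unfolding z_def b'_def using zb ze sub
    by (intro span_add span_scale span_diff) (auto intro: span_base)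
  ultimately show ?case using Y0 by auto
qed

text \<open>The pair \<open>(x, u)\<close> stands for the \<open>C\<^sup>1\<close> curve with initial position \<open>x\<close> and velocity \<open>u\<close>. Thus
  \<open>C\<^sup>1\<close> functions form a real vector space and the forms below are bilinear on the whole type.\<close>

type_synonym 'v curve = "'v \<times> (real \<Rightarrow>\<^sub>C 'v)"

definition vel :: "'v::euclidean_space curve \<Rightarrow> real \<Rightarrow> 'v" where
  "vel e = apply_bcontfun (snd e)"

definition pos :: "'v::euclidean_space curve \<Rightarrow> real \<Rightarrow> 'v" where
  "pos e t = fst e + integral {0..t} (vel e)"

lemma continuous_vel [continuous_intros]: "continuous_on S (vel e)"
  by (simp add: vel_def)

lemma pos_0 [simp]: "pos e 0 = fst e"
  by (simp add: pos_def)

lemma integrable_vel [simp]: "vel e integrable_on {s..t}"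
  by (intro integrable_continuous_interval continuous_intros)

lemma continuous_pos [continuous_intros]: "continuous_on {0..t} (pos e)"
  unfolding pos_def[abs_def]
  by (intro continuous_intros indefinite_integral_continuous_1) simp

lemma has_vector_derivative_pos:
  "s \<in> {0..t} \<Longrightarrow> (pos e has_vector_derivative vel e s) (at s within {0..t})"
  unfolding pos_def[abs_def]
  by (auto intro!: derivative_eq_intros integral_has_vector_derivative continuous_intros)

lemma vel_add [simp]: "vel (e + f) t = vel e t + vel f t"
  and vel_diff [simp]: "vel (e - f) t = vel e t - vel f t"
  and vel_scale [simp]: "vel (r *\<^sub>R e) t = r *\<^sub>R vel e t"
  by (simp_all add: vel_def plus_bcontfun.rep_eq minus_bcontfun.rep_eq scaleR_bcontfun.rep_eq)

lemma vel_fun: "vel (e + f) = (\<lambda>t. vel e t + vel f t)" "vel (e - f) = (\<lambda>t. vel e t - vel f t)"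
  "vel (r *\<^sub>R e) = (\<lambda>t. r *\<^sub>R vel e t)"
  by (auto simp: fun_eq_iff)

lemma pos_add [simp]: "pos (e + f) t = pos e t + pos f t"
  and pos_diff [simp]: "pos (e - f) t = pos e t - pos f t"
  and pos_scale [simp]: "pos (r *\<^sub>R e) t = r *\<^sub>R pos e t"
  by (simp_all add: pos_def vel_fun integral_add integral_diff scaleR_add_right)

lemma pos_diff_eq_integral:
  assumes "0 \<le> s" "s \<le> t"
  shows "pos e t - pos e s = integral {s..t} (vel e)"
proof -
  have "integral {0..s} (vel e) + integral {s..t} (vel e) = integral {0..t} (vel e)"
    using assms by (intro Henstock_Kurzweil_Integration.integral_combine) auto
  then show ?thesis by (simp add: pos_def algebra_simps)
qed

text \<open>\<open>g\<close> is extended to a bounded continuous function on the line. The extension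
  is arbitrary, and harmless because the forms see only \<open>{0..a}\<close>.\<close>

lemma curve_exists:
  fixes g :: "real \<Rightarrow> 'v::euclidean_space"
  assumes "continuous_on {0..a} g"
  obtains e where "fst e = x0" "\<And>t. t \<in> {0..a} \<Longrightarrow> vel e t = g t"
proof -
  from continuous_on_cbox_bcontfunE[of 0 a g] assms
  obtain u :: "real \<Rightarrow>\<^sub>C 'v" where "\<And>x. x \<in> cbox 0 a \<Longrightarrow> u x = g x"
    by (metis cbox_interval)
  with that[of "(x0, u)"] show ?thesis by (auto simp: vel_def)
qed

lemma pos_eqI:
  assumes "\<And>t. t \<in> {0..a} \<Longrightarrow> (x has_vector_derivative u t) (at t within {0..a})"
    "\<And>t. t \<in> {0..a} \<Longrightarrow> vel e t = u t" "fst e = x 0" "t \<in> {0..a}"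
  shows "pos e t = x t"
proof -
  have "(vel e has_integral x t - x 0) {0..t}"
  proof (rule fundamental_theorem_of_calculus)
    show "(x has_vector_derivative vel e s) (at s within {0..t})" if "s \<in> {0..t}" for s
      using assms that by (auto intro: has_vector_derivative_within_subset[of _ _ _ "{0..a}"])
  qed (use assms in auto)
  then show ?thesis using assms by (simp add: pos_def integral_unique)
qed

text \<open>Expanding \<open>x t\<close> in a basis leaves a finite sum of products of continuous
  functions, so continuity of \<open>F\<close> on each fixed vector is enough.\<close>

lemma continuous_on_linear_family:
  fixes F :: "real \<Rightarrow> 'v::euclidean_space \<Rightarrow> 'w::real_normed_vector"
  assumes "\<And>t. linear (F t)" "\<And>w. continuous_on S (\<lambda>t. F t w)" "continuous_on S x"
  shows "continuous_on S (\<lambda>t. F t (x t))"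
proof -
  have "F t (x t) = (\<Sum>b\<in>Basis. (x t \<bullet> b) *\<^sub>R F t b)" for t
  proof -
    have "F t (x t) = F t (\<Sum>b\<in>Basis. (x t \<bullet> b) *\<^sub>R b)" by (simp add: euclidean_representation)
    also have "\<dots> = (\<Sum>b\<in>Basis. (x t \<bullet> b) *\<^sub>R F t b)"
      using assms(1)[of t] by (simp add: linear_sum linear_scale)
    finally show ?thesis .
  qed
  then show ?thesis using assms by (simp add: continuous_intros)
qed

lemma linear_family_bounded:
  fixes F :: "real \<Rightarrow> 'v::euclidean_space \<Rightarrow> 'w::real_normed_vector"
  assumes "\<And>t. linear (F t)" "\<And>w. continuous_on S (\<lambda>t. F t w)" "compact S"
  obtains K where "K > 0" "\<And>t w. t \<in> S \<Longrightarrow> norm (F t w) \<le> K * norm w"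
proof -
  have "\<forall>b. \<exists>k. \<forall>t\<in>S. norm (F t b) \<le> k"
    using compact_imp_bounded[OF compact_continuous_image[OF assms(2,3)]]
    by (simp add: bounded_iff)
  then obtain k where k: "\<And>b t. t \<in> S \<Longrightarrow> norm (F t b) \<le> k b" by metis
  define K where "K = (\<Sum>b\<in>(Basis::'v set). \<bar>k b\<bar>) + 1"
  have "norm (F t w) \<le> K * norm w" if "t \<in> S" for t w
  proof -
    have "F t w = F t (\<Sum>b\<in>Basis. (w \<bullet> b) *\<^sub>R b)" by (simp add: euclidean_representation)
    also have "\<dots> = (\<Sum>b\<in>Basis. (w \<bullet> b) *\<^sub>R F t b)"
      using assms(1)[of t] by (simp add: linear_sum linear_scale)
    also have "norm \<dots> \<le> (\<Sum>b\<in>Basis. norm w * \<bar>k b\<bar>)"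
    proof (intro sum_norm_le)
      fix b :: 'v assume "b \<in> Basis"
      then show "norm ((w \<bullet> b) *\<^sub>R F t b) \<le> norm w * \<bar>k b\<bar>"
        using mult_mono[OF Basis_le_norm[of b w] order_trans[OF k[OF that, of b] abs_ge_self]] by simp
    qed
    also have "\<dots> \<le> K * norm w"
      by (simp add: K_def sum_distrib_left[symmetric] algebra_simps)
    finally show ?thesis .
  qed
  moreover have "K > 0" unfolding K_def by (simp add: add_nonneg_pos sum_nonneg)
  ultimately show ?thesis using that by blast
qed

section \<open>The Neumann problem\<close>

text \<open>\<open>'v\<close> will be C^n regarded as a real inner product space, so everything here
  is real-linear. The interval is a half period in the main argument and a full period in
  \<open>eigenspace_regular\<close>.\<close>

locale neumann_problem =
  fixes a :: real and P Q R :: "real \<Rightarrow> 'v::euclidean_space \<Rightarrow> 'v"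
  assumes a_pos: "0 < a"
    and lin: "linear (P t)" "linear (Q t)" "linear (R t)"
    and cont: "continuous_on {0..a} (\<lambda>t. P t w)" "continuous_on {0..a} (\<lambda>t. Q t w)"
      "continuous_on {0..a} (\<lambda>t. R t w)"
    and sym: "P t v \<bullet> w = v \<bullet> P t w" "Q t v \<bullet> w = v \<bullet> Q t w" "R t v \<bullet> w = v \<bullet> R t w"
    and P_pos: "t \<in> {0..a} \<Longrightarrow> w \<noteq> 0 \<Longrightarrow> 0 < w \<bullet> P t w"
begin

definition mom :: "'v curve \<Rightarrow> real \<Rightarrow> 'v" where
  "mom e t = P t (vel e t) + Q t (pos e t)"

definition frc :: "'v curve \<Rightarrow> real \<Rightarrow> 'v" where
  "frc e t = Q t (vel e t) + R t (pos e t)"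

definition ip :: "'v curve \<Rightarrow> 'v curve \<Rightarrow> real" where
  "ip e f = integral {0..a} (\<lambda>t. pos e t \<bullet> pos f t)"

definition en :: "'v curve \<Rightarrow> real" where
  "en e = integral {0..a} (\<lambda>t. (norm (vel e t))\<^sup>2)"

definition form :: "'v curve \<Rightarrow> 'v curve \<Rightarrow> real" where
  "form e f = integral {0..a} (\<lambda>t. mom e t \<bullet> vel f t + frc e t \<bullet> pos f t)"

text \<open>The equation \<open>mom' = frc - m *\<^sub>R pos\<close>, integrated so that it passes
  to uniform limits. Both Neumann conditions are present: the first conjunct is the one at
  \<open>a\<close>, and t = 0 in the second gives zero initial momentum.\<close>

definition eigen :: "real \<Rightarrow> 'v curve \<Rightarrow> bool" where
  "eigen m e \<longleftrightarrow> mom e a = 0 \<and>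
     (\<forall>t\<in>{0..a}. mom e t = integral {0..t} (\<lambda>s. frc e s - m *\<^sub>R pos e s))"

lemma continuous_apply [continuous_intros]:
  assumes "continuous_on {0..a} x"
  shows "continuous_on {0..a} (\<lambda>t. P t (x t))" "continuous_on {0..a} (\<lambda>t. Q t (x t))"
    "continuous_on {0..a} (\<lambda>t. R t (x t))"
  using continuous_on_linear_family[OF lin(1) cont(1) assms]
    continuous_on_linear_family[OF lin(2) cont(2) assms]
    continuous_on_linear_family[OF lin(3) cont(3) assms] by blast+

lemma continuous_mom [continuous_intros]: "continuous_on {0..a} (mom e)"
  unfolding mom_def[abs_def] by (intro continuous_intros)

lemma continuous_frc [continuous_intros]: "continuous_on {0..a} (frc e)"
  unfolding frc_def[abs_def] by (intro continuous_intros)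

lemma mom_linear [simp]: "mom (e + f) t = mom e t + mom f t" "mom (e - f) t = mom e t - mom f t"
  "mom (r *\<^sub>R e) t = r *\<^sub>R mom e t"
  using lin[of t] by (simp_all add: mom_def linear_add linear_diff linear_scale algebra_simps)

lemma frc_linear [simp]: "frc (e + f) t = frc e t + frc f t" "frc (e - f) t = frc e t - frc f t"
  "frc (r *\<^sub>R e) t = r *\<^sub>R frc e t"
  using lin[of t] by (simp_all add: frc_def linear_add linear_diff linear_scale algebra_simps)

lemma integrable_ip [simp]: "(\<lambda>t. pos e t \<bullet> pos f t) integrable_on {0..a}"
  by (intro integrable_continuous_interval continuous_intros)

lemma integrable_form [simp]: "(\<lambda>t. mom e t \<bullet> vel f t + frc e t \<bullet> pos f t) integrable_on {0..a}"
  by (intro integrable_continuous_interval continuous_intros)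

lemma integrable_en [simp]: "(\<lambda>t. (norm (vel e t))\<^sup>2) integrable_on {0..a}"
  by (intro integrable_continuous_interval continuous_intros)

lemma ip_commute: "ip e f = ip f e"
  by (simp add: ip_def inner_commute)

lemma form_commute: "form e f = form f e"
proof -
  have s: "P t v \<bullet> w = P t w \<bullet> v" "Q t v \<bullet> w = Q t w \<bullet> v" "R t v \<bullet> w = R t w \<bullet> v" for t v w
    using sym[of t v w] by (simp_all add: inner_commute)
  have "mom e t \<bullet> vel f t + frc e t \<bullet> pos f t = mom f t \<bullet> vel e t + frc f t \<bullet> pos e t" for t
    unfolding mom_def frc_def inner_left_distrib
    using s(1)[of t "vel e t" "vel f t"] s(2)[of t "pos e t" "vel f t"]
      s(2)[of t "vel e t" "pos f t"] s(3)[of t "pos e t" "pos f t"] by linarith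
  then show ?thesis by (simp add: form_def)
qed

lemma bilinear_ip: "bilinear ip"
proof -
  have l: "linear (\<lambda>e. ip e f)" for f
  proof
    show "ip (e1 + e2) f = ip e1 f + ip e2 f" for e1 e2
      unfolding ip_def pos_add inner_left_distrib by (rule integral_add) simp_all
    show "ip (r *\<^sub>R e1) f = r *\<^sub>R ip e1 f" for r e1
      by (simp add: ip_def)
  qed
  then show ?thesis using ip_commute by (simp add: bilinear_def)
qed

lemma bilinear_form: "bilinear form"
proof -
  have l: "linear (\<lambda>e. form e f)" for f
  proof
    show "form (e1 + e2) f = form e1 f + form e2 f" for e1 e2
    proof -
      have "(\<lambda>t. mom (e1 + e2) t \<bullet> vel f t + frc (e1 + e2) t \<bullet> pos f t)
        = (\<lambda>t. (mom e1 t \<bullet> vel f t + frc e1 t \<bullet> pos f t) + (mom e2 t \<bullet> vel f t + frc e2 t \<bullet> pos f t))"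
        by (simp add: fun_eq_iff inner_left_distrib)
      then show ?thesis unfolding form_def by (simp only: integral_add[OF integrable_form integrable_form])
    qed
    show "form (r *\<^sub>R e1) f = r *\<^sub>R form e1 f" for r e1
    proof -
      have "(\<lambda>t. mom (r *\<^sub>R e1) t \<bullet> vel f t + frc (r *\<^sub>R e1) t \<bullet> pos f t)
        = (\<lambda>t. r * (mom e1 t \<bullet> vel f t + frc e1 t \<bullet> pos f t))"
        by (simp add: fun_eq_iff algebra_simps)
      then show ?thesis unfolding form_def by simp
    qed
  qed
  then show ?thesis using form_commute by (simp add: bilinear_def)
qed

lemma ip_nonneg: "0 \<le> ip e e"
  unfolding ip_def by (intro integral_nonneg) auto

lemma en_nonneg: "0 \<le> en e"
  unfolding en_def by (intro integral_nonneg) auto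

lemma ip_norm: "ip e e = integral {0..a} (\<lambda>t. (norm (pos e t))\<^sup>2)"
  by (simp add: ip_def power2_norm_eq_inner)

section \<open>Coercivity and energy estimates\<close>

lemma bounds_exist:
  obtains K where "K > 0" "\<And>t w. t \<in> {0..a} \<Longrightarrow> norm (P t w) \<le> K * norm w"
    "\<And>t w. t \<in> {0..a} \<Longrightarrow> norm (Q t w) \<le> K * norm w"
    "\<And>t w. t \<in> {0..a} \<Longrightarrow> norm (R t w) \<le> K * norm w"
proof -
  obtain K1 K2 K3 where K: "K1 > 0" "K2 > 0" "K3 > 0"
    "\<And>t w. t \<in> {0..a} \<Longrightarrow> norm (P t w) \<le> K1 * norm w"
    "\<And>t w. t \<in> {0..a} \<Longrightarrow> norm (Q t w) \<le> K2 * norm w"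
    "\<And>t w. t \<in> {0..a} \<Longrightarrow> norm (R t w) \<le> K3 * norm w"
    using linear_family_bounded[OF lin(1) cont(1) compact_Icc]
      linear_family_bounded[OF lin(2) cont(2) compact_Icc]
      linear_family_bounded[OF lin(3) cont(3) compact_Icc] by metis
  have "norm (P t w) \<le> (K1 + K2 + K3) * norm w \<and> norm (Q t w) \<le> (K1 + K2 + K3) * norm w \<and>
    norm (R t w) \<le> (K1 + K2 + K3) * norm w" if "t \<in> {0..a}" for t w
  proof -
    have "0 \<le> K1 * norm w" "0 \<le> K2 * norm w" "0 \<le> K3 * norm w" using K(1-3) by simp_all
    then show ?thesis using K(4-6)[OF that, of w] unfolding distrib_right by linarith
  qed
  with that[of "K1 + K2 + K3"] K(1-3) show ?thesis by (meson add_pos_pos)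
qed

lemma P_coercive:
  obtains p where "p > 0" "\<And>t w. t \<in> {0..a} \<Longrightarrow> p * (norm w)\<^sup>2 \<le> w \<bullet> P t w"
proof -
  let ?S = "{0..a} \<times> sphere (0::'v) 1"
  have c: "continuous_on ?S (\<lambda>(t, w). w \<bullet> P t w)"
  proof -
    have expand: "P t w = (\<Sum>b\<in>Basis. (w \<bullet> b) *\<^sub>R P t b)" for t w
    proof -
      have "P t w = P t (\<Sum>b\<in>Basis. (w \<bullet> b) *\<^sub>R b)" by (simp add: euclidean_representation)
      also have "\<dots> = (\<Sum>b\<in>Basis. (w \<bullet> b) *\<^sub>R P t b)"
        using lin(1)[of t] by (simp add: linear_sum linear_scale)
      finally show ?thesis .
    qed
    have "continuous_on ?S (\<lambda>z. snd z \<bullet> (\<Sum>b\<in>Basis. (snd z \<bullet> b) *\<^sub>R P (fst z) b))"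
      by (intro continuous_intros continuous_on_compose2[OF cont(1)]) auto
    then show ?thesis unfolding case_prod_unfold expand[symmetric] .
  qed
  obtain b :: 'v where "b \<in> Basis" using nonempty_Basis by blast
  then have "(0, b) \<in> ?S" using a_pos by simp
  then obtain z where z: "z \<in> ?S" "\<And>y. y \<in> ?S \<Longrightarrow> (\<lambda>(t, w). w \<bullet> P t w) z \<le> (\<lambda>(t, w). w \<bullet> P t w) y"
    using continuous_attains_inf[OF compact_Times[OF compact_Icc compact_sphere] _ c] by blast
  obtain t0 w0 where z0: "z = (t0, w0)" by fastforce
  define p where "p = w0 \<bullet> P t0 w0"
  have "p > 0" using z(1) P_pos[of t0 w0] unfolding p_def z0 by force
  moreover have "p * (norm w)\<^sup>2 \<le> w \<bullet> P t w" if "t \<in> {0..a}" for t w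
  proof (cases "w = 0")
    case True
    then show ?thesis using lin(1)[of t] by simp
  next
    case nz: False
    have "p \<le> (w /\<^sub>R norm w) \<bullet> P t (w /\<^sub>R norm w)"
      using z(2)[of "(t, w /\<^sub>R norm w)"] that nz by (simp add: z0 p_def)
    also have "\<dots> = (w \<bullet> P t w) / (norm w)\<^sup>2"
      using lin(1)[of t] by (simp add: linear_scale power2_eq_square divide_inverse)
    finally show ?thesis using nz by (simp add: field_simps)
  qed
  ultimately show ?thesis using that by blast
qed

text \<open>Garding's inequality: the mixed term in \<open>Q\<close> is absorbed by Young's
  inequality into half of the coercive \<open>P\<close> term and a multiple of the L2 norm.\<close>

lemma garding:
  obtains c d where "c \<ge> 0" "d > 0" "\<And>e. d * en e - c * ip e e \<le> form e e"
proof -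
  obtain p where p: "p > 0" "\<And>t w. t \<in> {0..a} \<Longrightarrow> p * (norm w)\<^sup>2 \<le> w \<bullet> P t w" using P_coercive by blast
  obtain K where K: "K > 0" "\<And>t w. t \<in> {0..a} \<Longrightarrow> norm (P t w) \<le> K * norm w"
    "\<And>t w. t \<in> {0..a} \<Longrightarrow> norm (Q t w) \<le> K * norm w"
    "\<And>t w. t \<in> {0..a} \<Longrightarrow> norm (R t w) \<le> K * norm w" using bounds_exist by blast
  \<comment> \<open>The first summand comes from completing the square in
    \<open>p * norm u - 2 * K * norm x\<close>, the second from the bound on
    \<open>R\<close>.\<close>
  define c where "c = 2 * K\<^sup>2 / p + K"
  have ptw: "p / 2 * (norm (vel e t))\<^sup>2 - c * (norm (pos e t))\<^sup>2
      \<le> mom e t \<bullet> vel e t + frc e t \<bullet> pos e t" if t: "t \<in> {0..a}" for e t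
  proof -
    let ?u = "vel e t" and ?x = "pos e t"
    have "\<bar>Q t ?x \<bullet> ?u\<bar> \<le> norm (Q t ?x) * norm ?u" by (rule Cauchy_Schwarz_ineq2)
    also have "\<dots> \<le> K * norm ?x * norm ?u" using K(3)[OF t] by (simp add: mult_right_mono)
    finally have 1: "\<bar>Q t ?x \<bullet> ?u\<bar> \<le> K * norm ?x * norm ?u" .
    have "\<bar>R t ?x \<bullet> ?x\<bar> \<le> norm (R t ?x) * norm ?x" by (rule Cauchy_Schwarz_ineq2)
    also have "\<dots> \<le> K * norm ?x * norm ?x" using K(4)[OF t] by (simp add: mult_right_mono)
    finally have 2: "\<bar>R t ?x \<bullet> ?x\<bar> \<le> K * (norm ?x)\<^sup>2" by (simp add: power2_eq_square)
    have "0 \<le> (p * norm ?u - 2 * K * norm ?x)\<^sup>2 / (2 * p)" using p by simp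
    also have "\<dots> = p / 2 * (norm ?u)\<^sup>2 + 2 * K\<^sup>2 / p * (norm ?x)\<^sup>2 - 2 * (K * norm ?x * norm ?u)"
      using p by (simp add: power2_eq_square field_simps)
    finally have 3: "2 * (K * norm ?x * norm ?u) \<le> p / 2 * (norm ?u)\<^sup>2 + 2 * K\<^sup>2 / p * (norm ?x)\<^sup>2"
      by simp
    have "Q t ?u \<bullet> ?x = Q t ?x \<bullet> ?u" using sym(2)[of t ?u ?x] by (simp only: inner_commute)
    then have "mom e t \<bullet> ?u + frc e t \<bullet> ?x = ?u \<bullet> P t ?u + 2 * (Q t ?x \<bullet> ?u) + R t ?x \<bullet> ?x"
      unfolding mom_def frc_def inner_left_distrib inner_commute[of ?u "P t ?u"] by linarith
    with 1 2 3 p(2)[OF t, of ?u] show ?thesis by (simp add: c_def algebra_simps)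
  qed
  have "p / 2 * en e - c * ip e e \<le> form e e" for e
  proof -
    have "p / 2 * en e - c * ip e e
      = integral {0..a} (\<lambda>t. p / 2 * (norm (vel e t))\<^sup>2 - c * (norm (pos e t))\<^sup>2)"
      unfolding en_def ip_norm
      by (subst integral_diff) (auto intro!: integrable_continuous_interval continuous_intros)
    also have "\<dots> \<le> form e e"
      unfolding form_def
      by (intro integral_le integrable_form integrable_continuous_interval continuous_intros ptw)
    finally show ?thesis .
  qed
  moreover have "c \<ge> 0" using p K by (simp add: c_def)
  ultimately show ?thesis using that[of c "p / 2"] p by simp
qed

lemma form_upper:
  obtains C where "C \<ge> 0" "\<And>e. form e e \<le> C * (ip e e + en e)"
proof -
  obtain K where K: "K > 0" "\<And>t w. t \<in> {0..a} \<Longrightarrow> norm (P t w) \<le> K * norm w"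
    "\<And>t w. t \<in> {0..a} \<Longrightarrow> norm (Q t w) \<le> K * norm w"
    "\<And>t w. t \<in> {0..a} \<Longrightarrow> norm (R t w) \<le> K * norm w" using bounds_exist by blast
  have ptw: "mom e t \<bullet> vel e t + frc e t \<bullet> pos e t
      \<le> 2 * K * ((norm (pos e t))\<^sup>2 + (norm (vel e t))\<^sup>2)" if t: "t \<in> {0..a}" for e t
  proof -
    let ?u = "vel e t" and ?x = "pos e t"
    have cs: "A v \<bullet> w \<le> K * norm v * norm w" if "norm (A v) \<le> K * norm v" for A v and w :: 'v
      using order_trans[OF norm_cauchy_schwarz mult_right_mono[OF that norm_ge_zero]] .
    have "mom e t \<bullet> ?u + frc e t \<bullet> ?x \<le> K * norm ?u * norm ?u + K * norm ?x * norm ?u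
       + K * norm ?u * norm ?x + K * norm ?x * norm ?x"
      unfolding mom_def frc_def inner_left_distrib
      using cs[of "P t" ?u ?u, OF K(2)[OF t]] cs[of "Q t" ?x ?u, OF K(3)[OF t]]
        cs[of "Q t" ?u ?x, OF K(3)[OF t]] cs[of "R t" ?x ?x, OF K(4)[OF t]] by linarith
    also have "\<dots> \<le> 2 * K * ((norm ?x)\<^sup>2 + (norm ?u)\<^sup>2)"
      using mult_left_mono[OF zero_le_power2[of "norm ?x - norm ?u"], of K] K(1)
      by (simp add: power2_eq_square algebra_simps)
    finally show ?thesis .
  qed
  have "form e e \<le> 2 * K * (ip e e + en e)" for e
  proof -
    have "form e e \<le> integral {0..a} (\<lambda>t. 2 * K * ((norm (pos e t))\<^sup>2 + (norm (vel e t))\<^sup>2))"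
      unfolding form_def
      by (intro integral_le integrable_form integrable_continuous_interval continuous_intros ptw)
    also have "\<dots> = 2 * K * (ip e e + en e)"
      unfolding en_def ip_norm
      by (subst integral_mult_right, subst integral_add)
        (auto intro!: integrable_continuous_interval continuous_intros)
    finally show ?thesis .
  qed
  then show ?thesis using that[of "2 * K"] K by simp
qed

text \<open>Cauchy-Schwarz for the velocity yields a Hoelder bound with exponent 1/2. It depends on
  the energy alone and is the source of equicontinuity.\<close>

lemma pos_holder:
  assumes "0 \<le> s" "s \<le> t" "t \<le> a"
  shows "(norm (pos e t - pos e s))\<^sup>2 \<le> (t - s) * en e"
proof -
  have "norm (pos e t - pos e s) \<le> integral {s..t} (\<lambda>r. norm (vel e r))"
    unfolding pos_diff_eq_integral[OF assms(1,2)]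
    by (intro integral_norm_bound_integral integrable_continuous_interval continuous_intros) auto
  then have "(norm (pos e t - pos e s))\<^sup>2 \<le> (integral {s..t} (\<lambda>r. norm (vel e r)))\<^sup>2"
    by (simp add: power_mono)
  also have "\<dots> \<le> (t - s) * integral {s..t} (\<lambda>r. (norm (vel e r))\<^sup>2)"
    using assms by (intro integral_square_le continuous_intros)
  also have "\<dots> \<le> (t - s) * en e"
    unfolding en_def using assms
    by (intro mult_left_mono integral_subset_le integrable_continuous_interval continuous_intros) auto
  finally show ?thesis .
qed

lemma pos_holder':
  assumes "s \<in> {0..a}" "t \<in> {0..a}"
  shows "(norm (pos e t - pos e s))\<^sup>2 \<le> \<bar>t - s\<bar> * en e"
  using pos_holder[of s t e] pos_holder[of t s e] assms
  by (cases "s \<le> t") (auto simp: norm_minus_commute)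

lemma pos_sq_bound:
  assumes "s \<in> {0..a}" "t \<in> {0..a}"
  shows "(norm (pos e t))\<^sup>2 \<le> 2 * (norm (pos e s))\<^sup>2 + 2 * a * en e"
proof -
  have "norm (pos e t) \<le> norm (pos e s) + norm (pos e t - pos e s)"
    by (metis norm_triangle_sub)
  then have "(norm (pos e t))\<^sup>2 \<le> (norm (pos e s) + norm (pos e t - pos e s))\<^sup>2"
    by (simp add: power_mono)
  also have "\<dots> \<le> 2 * (norm (pos e s))\<^sup>2 + 2 * (norm (pos e t - pos e s))\<^sup>2"
    using zero_le_power2[of "norm (pos e s) - norm (pos e t - pos e s)"]
    by (simp add: power2_eq_square algebra_simps)
  also have "(norm (pos e t - pos e s))\<^sup>2 \<le> a * en e"
    using order_trans[OF pos_holder'[OF assms] mult_right_mono[OF _ en_nonneg, of "\<bar>t - s\<bar>" a e]] assms by auto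
  finally show ?thesis by simp
qed

text \<open>Averages \<open>pos_sq_bound\<close> over s. Arzela-Ascoli needs a bound at one point
  besides equicontinuity, and this supplies it from the L2 norm and the energy.\<close>

lemma start_sq_bound: "a * (norm (pos e 0))\<^sup>2 \<le> 2 * ip e e + 2 * a\<^sup>2 * en e"
proof -
  have "a * (norm (pos e 0))\<^sup>2 = integral {0..a} (\<lambda>s. (norm (pos e 0))\<^sup>2)"
    using a_pos by simp
  also have "\<dots> \<le> integral {0..a} (\<lambda>s. 2 * (norm (pos e s))\<^sup>2 + 2 * a * en e)"
    using a_pos by (intro integral_le integrable_continuous_interval continuous_intros pos_sq_bound) auto
  also have "\<dots> = 2 * ip e e + 2 * a\<^sup>2 * en e"
    unfolding ip_norm using a_pos
    by (subst integral_add) (auto intro!: integrable_continuous_interval continuous_intros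
      simp: power2_eq_square)
  finally show ?thesis .
qed

lemma ip_bound:
  assumes "s \<in> {0..a}"
  shows "ip e e \<le> 2 * a * (norm (pos e s))\<^sup>2 + 2 * a\<^sup>2 * en e"
proof -
  have "ip e e \<le> integral {0..a} (\<lambda>t. 2 * (norm (pos e s))\<^sup>2 + 2 * a * en e)"
    unfolding ip_norm using assms
    by (intro integral_le integrable_continuous_interval continuous_intros pos_sq_bound) auto
  also have "\<dots> = 2 * a * (norm (pos e s))\<^sup>2 + 2 * a\<^sup>2 * en e"
    using a_pos by (simp add: power2_eq_square algebra_simps)
  finally show ?thesis .
qed

section \<open>Residuals of the eigenvalue equation\<close>

text \<open>The right-hand side of \<open>eigen\<close>, made into a curve so that the energy
  estimates and the compactness argument apply to it as well. The choice affects only the velocity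
  outside \<open>{0..a}\<close>.\<close>

definition prim :: "real \<Rightarrow> 'v curve \<Rightarrow> 'v curve" where
  "prim m e = (SOME w. fst w = 0 \<and> (\<forall>t\<in>{0..a}. vel w t = frc e t - m *\<^sub>R pos e t))"

lemma prim: "fst (prim m e) = 0" "t \<in> {0..a} \<Longrightarrow> vel (prim m e) t = frc e t - m *\<^sub>R pos e t"
proof -
  have c: "continuous_on {0..a} (\<lambda>t. frc e t - m *\<^sub>R pos e t)"
    by (intro continuous_intros)
  obtain w where "fst w = 0" "\<And>t. t \<in> {0..a} \<Longrightarrow> vel w t = frc e t - m *\<^sub>R pos e t"
    by (rule curve_exists[OF c, of 0]) blast
  then have "\<exists>w. fst w = 0 \<and> (\<forall>t\<in>{0..a}. vel w t = frc e t - m *\<^sub>R pos e t)"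
    by blast
  from someI_ex[OF this]
  show "fst (prim m e) = 0" "t \<in> {0..a} \<Longrightarrow> vel (prim m e) t = frc e t - m *\<^sub>R pos e t"
    by (auto simp: prim_def)
qed

lemma pos_prim:
  assumes "t \<in> {0..a}"
  shows "pos (prim m e) t = integral {0..t} (\<lambda>s. frc e s - m *\<^sub>R pos e s)"
  unfolding pos_def[of "prim m e"] using assms by (auto simp: prim intro!: integral_cong)

text \<open>Integration by parts in the manner of du Bois-Reymond: the force is moved from the
  position of \<open>e\<close> to its velocity. What remains are two residuals,
  \<open>mom - pos (prim m x)\<close> on the interval and \<open>pos (prim m x) a\<close> at its
  end; \<open>eigen m x\<close> says that both vanish.\<close>

lemma form_eq_boundary:
  "form x e - m * ip x e
    = integral {0..a} (\<lambda>t. (mom x t - pos (prim m x) t) \<bullet> vel e t) + pos (prim m x) a \<bullet> pos e a"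
proof -
  let ?w = "prim m x"
  have "((\<lambda>t. pos ?w t \<bullet> vel e t + vel ?w t \<bullet> pos e t) has_integral
      pos ?w a \<bullet> pos e a - pos ?w 0 \<bullet> pos e 0) {0..a}"
    using a_pos by (intro fundamental_theorem_of_calculus)
      (auto intro!: has_vector_derivative_pos bounded_bilinear.has_vector_derivative[OF bounded_bilinear_inner])
  then have 1: "integral {0..a} (\<lambda>t. pos ?w t \<bullet> vel e t + vel ?w t \<bullet> pos e t) = pos ?w a \<bullet> pos e a"
    by (simp add: integral_unique prim)
  have "form x e - m * ip x e
      = integral {0..a} (\<lambda>t. (mom x t \<bullet> vel e t + frc x t \<bullet> pos e t) - m * (pos x t \<bullet> pos e t))"
    unfolding form_def ip_def by (subst integral_diff) (simp_all add: integrable_on_mult_right)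
  also have "\<dots> = integral {0..a} (\<lambda>t. (mom x t - pos ?w t) \<bullet> vel e t
      + (pos ?w t \<bullet> vel e t + vel ?w t \<bullet> pos e t))"
    by (intro integral_cong) (simp add: prim inner_diff_left)
  also have "\<dots> = integral {0..a} (\<lambda>t. (mom x t - pos ?w t) \<bullet> vel e t)
      + integral {0..a} (\<lambda>t. pos ?w t \<bullet> vel e t + vel ?w t \<bullet> pos e t)"
    by (intro integral_add integrable_continuous_interval continuous_intros)
  finally show ?thesis using 1 by simp
qed

lemma eigen_weak:
  assumes "eigen m x"
  shows "form x e = m * ip x e"
proof -
  have "mom x t = pos (prim m x) t" if "t \<in> {0..a}" for t
    using assms that by (simp add: eigen_def pos_prim)
  then have "integral {0..a} (\<lambda>t. (mom x t - pos (prim m x) t) \<bullet> vel e t) = integral {0..a} (\<lambda>t. 0)"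
    by (intro integral_cong) simp
  moreover have "pos (prim m x) a = 0"
    using assms a_pos by (metis atLeastAtMost_iff eigen_def less_eq_real_def pos_prim)
  ultimately show ?thesis using form_eq_boundary[of x e m] by simp
qed

definition orth :: "'v curve set \<Rightarrow> 'v curve set" where
  "orth Y = {e. \<forall>b\<in>Y. ip e b = 0}"

lemma subspace_orth: "subspace (orth Y)"
  by (auto simp: orth_def subspace_def bilinear_ladd[OF bilinear_ip] bilinear_lmul[OF bilinear_ip]
      bilinear_lzero[OF bilinear_ip])

text \<open>Testing only against elements of \<^term>\<open>orth Y\<close> suffices, since arbitrary test elements can
  be projected along the span of the eigenfunctions.\<close>

lemma test_bound:
  assumes Y: "finite Y" "\<And>b e. b \<in> Y \<Longrightarrow> form b e = \<mu> b * ip b e"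
    and psd: "\<And>e. e \<in> orth Y \<Longrightarrow> m * ip e e \<le> form e e"
  obtains C where "C \<ge> 0" "\<And>x e. x \<in> orth Y \<Longrightarrow>
    (form x e - m * ip x e)\<^sup>2 \<le> (form x x - m * ip x x) * (C * (ip e e + en e))"
proof -
  define H where "H x e = form x e - m * ip x e" for x e
  have bilH: "bilinear H"
    using bilinear_form bilinear_ip unfolding H_def bilinear_def linear_iff
    by (auto simp: algebra_simps)
  have symH: "H x e = H e x" for x e by (simp add: H_def form_commute ip_commute)
  obtain c d where cd: "c \<ge> 0" "d > 0" "\<And>e. d * en e - c * ip e e \<le> form e e"
    using garding by blast
  obtain C0 where C0: "C0 \<ge> 0" "\<And>e. form e e \<le> C0 * (ip e e + en e)"
    using form_upper by blast
  \<comment> \<open>The sum of the constants in the bounds on \<open>H e e\<close> and on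
    \<open>- H z z\<close> below, as \<open>H w w\<close> is their total.\<close>
  define C where "C = C0 + 2 * \<bar>m\<bar> + c"
  have "(H x e)\<^sup>2 \<le> H x x * (C * (ip e e + en e))" if x: "x \<in> orth Y" for x e
  proof -
    obtain z where z: "z \<in> span Y" "\<forall>b\<in>Y. ip (e - z) b = 0"
      using psd_projection_exists[OF bilinear_ip ip_commute ip_nonneg Y(1)] by blast
    define w where "w = e - z"
    have w: "w \<in> orth Y" using z(2) by (simp add: w_def orth_def)
    \<comment> \<open>The elements of \<open>Y\<close> are eigenfunctions, so orthogonality to them
      in L2 implies orthogonality for \<open>form\<close>. Hence the splitting of \<open>e\<close>
      into \<open>w\<close> and \<open>z\<close> is orthogonal for both forms.\<close>
    have o: "H y z = 0 \<and> ip y z = 0" if "y \<in> orth Y" for y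
      using z(1)
    proof (induction rule: span_induct_alt)
      case base
      then show ?case by (simp add: bilinear_rzero[OF bilH] bilinear_rzero[OF bilinear_ip])
    next
      case (step r b z')
      have "ip y b = 0" using that step by (simp add: orth_def)
      moreover from this have "H y b = 0"
        using Y(2)[OF step(1), of y] by (simp add: H_def form_commute[of y] ip_commute[of y])
      ultimately show ?case using step by (simp add: bilinear_radd[OF bilH] bilinear_rmul[OF bilH]
        bilinear_radd[OF bilinear_ip] bilinear_rmul[OF bilinear_ip])
    qed
    have e: "e = w + z" by (simp add: w_def)
    have Hee: "H e e = H w w + H z z"
      using o[OF w] symH[of z w] unfolding e by (simp add: bilinear_ladd[OF bilH] bilinear_radd[OF bilH])
    have ipee: "ip e e = ip w w + ip z z"
      using o[OF w] ip_commute[of z w] unfolding e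
      by (simp add: bilinear_ladd[OF bilinear_ip] bilinear_radd[OF bilinear_ip])
    have "- H z z \<le> (\<bar>m\<bar> + c) * ip z z"
      using cd(3)[of z] mult_nonneg_nonneg[OF less_imp_le[OF cd(2)] en_nonneg[of z]]
        mult_right_mono[OF abs_ge_self[of m] ip_nonneg[of z]]
      by (simp add: H_def algebra_simps)
    also have "\<dots> \<le> (\<bar>m\<bar> + c) * ip e e"
      using ipee ip_nonneg[of w] cd(1) by (intro mult_left_mono) auto
    finally have 1: "- H z z \<le> (\<bar>m\<bar> + c) * ip e e" .
    have 2: "H e e \<le> C0 * (ip e e + en e) + \<bar>m\<bar> * ip e e"
      using C0(2)[of e] mult_right_mono[OF abs_ge_minus_self[of m] ip_nonneg[of e]] by (simp add: H_def)
    have "H w w \<le> C * (ip e e + en e)"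
    proof -
      have "0 \<le> (2 * \<bar>m\<bar> + c) * en e" using en_nonneg[of e] cd(1) by simp
      then show ?thesis using Hee 1 2 by (simp add: C_def algebra_simps)
    qed
    moreover have "H x x \<ge> 0" using psd[OF x] by (simp add: H_def)
    ultimately have 3: "H x x * H w w \<le> H x x * (C * (ip e e + en e))"
      by (rule mult_left_mono)
    have "H x e = H x w" using o[OF x] unfolding e by (simp add: bilinear_radd[OF bilH])
    moreover have "(H x w)\<^sup>2 \<le> H x x * H w w"
      by (rule psd_cauchy_schwarz[OF bilH symH subspace_orth[of Y]]) (use psd x w in \<open>auto simp: H_def\<close>)
    ultimately show ?thesis using 3 by simp
  qed
  moreover have "C \<ge> 0" using C0 cd by (simp add: C_def)
  ultimately show ?thesis using that unfolding H_def by blast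
qed

text \<open>Each residual is isolated by one test curve in \<open>form_eq_boundary\<close>. The test
  value is then the squared size u of the residual, while \<open>test_bound\<close> estimates its
  square by a multiple of u; dividing by u leaves a bound by the excess of the action over m times
  the L2 norm. That excess tends to 0 along a minimizing sequence.\<close>

lemma residual_bound:
  assumes Y: "finite Y" "\<And>b e. b \<in> Y \<Longrightarrow> form b e = \<mu> b * ip b e"
    and psd: "\<And>e. e \<in> orth Y \<Longrightarrow> m * ip e e \<le> form e e"
  obtains C where "C \<ge> 0"
    "\<And>x. x \<in> orth Y \<Longrightarrow> integral {0..a} (\<lambda>t. (norm (mom x t - pos (prim m x) t))\<^sup>2)
        \<le> C * (form x x - m * ip x x)"
    "\<And>x. x \<in> orth Y \<Longrightarrow> (norm (pos (prim m x) a))\<^sup>2 \<le> C * (form x x - m * ip x x)"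
proof -
  obtain C where C: "C \<ge> 0" "\<And>x e. x \<in> orth Y \<Longrightarrow>
    (form x e - m * ip x e)\<^sup>2 \<le> (form x x - m * ip x x) * (C * (ip e e + en e))"
    using test_bound[OF assms] by blast
  \<comment> \<open>The factor \<open>2 * a\<^sup>2 + 1\<close> serves the first test curve, which
    vanishes at \<open>a\<close> and so obeys \<open>ip_bound\<close> there; the factor
    \<open>a\<close> is the squared L2 norm of a constant curve of norm 1.\<close>
  define D where "D = C * (2 * a\<^sup>2 + 1 + a)"
  have cancel: "u \<le> h * D" if "u\<^sup>2 \<le> h * (C * (b * u))" "0 \<le> h" "0 \<le> u" "b \<le> 2 * a\<^sup>2 + 1 + a" for u h b
  proof (cases "u = 0")
    case False
    with that have u: "u > 0" by simp
    have "u * u \<le> (h * (C * b)) * u" using that(1) by (simp add: power2_eq_square mult_ac)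
    then have "u \<le> h * (C * b)" using u by (simp add: mult_le_cancel_right)
    also have "\<dots> \<le> h * D" unfolding D_def using that C(1) by (intro mult_left_mono) auto
    finally show ?thesis .
  qed (use that C(1) a_pos in \<open>simp add: D_def\<close>)
  show ?thesis
  proof (rule that)
    show "D \<ge> 0" using C(1) a_pos by (simp add: D_def)
    fix x assume x: "x \<in> orth Y"
    let ?h = "form x x - m * ip x x" and ?w = "prim m x"
    have h: "?h \<ge> 0" using psd[OF x] by simp
    define r where "r t = mom x t - pos ?w t" for t
    have c: "continuous_on {0..a} r" unfolding r_def[abs_def] by (intro continuous_intros)
    \<comment> \<open>The initial position is chosen so that the curve ends at 0 and the boundary
      term drops out.\<close>
    obtain \<eta> where \<eta>: "fst \<eta> = - integral {0..a} r" "\<And>t. t \<in> {0..a} \<Longrightarrow> vel \<eta> t = r t"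
      by (rule curve_exists[OF c, of "- integral {0..a} r"]) blast
    have \<eta>a: "pos \<eta> a = 0"
    proof -
      have "integral {0..a} (vel \<eta>) = integral {0..a} r" by (intro integral_cong) (simp add: \<eta>)
      then show ?thesis by (simp add: pos_def \<eta>)
    qed
    have en: "en \<eta> = integral {0..a} (\<lambda>t. (norm (r t))\<^sup>2)"
      unfolding en_def by (intro integral_cong) (simp add: \<eta>)
    have "form x \<eta> - m * ip x \<eta> = integral {0..a} (\<lambda>t. r t \<bullet> vel \<eta> t)"
      unfolding form_eq_boundary \<eta>a by (simp add: r_def)
    also have "\<dots> = en \<eta>"
      unfolding en by (intro integral_cong) (simp add: \<eta> power2_norm_eq_inner)
    finally have "(en \<eta>)\<^sup>2 \<le> ?h * (C * (ip \<eta> \<eta> + en \<eta>))" using C(2)[OF x, of \<eta>] by simp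
    also have "\<dots> \<le> ?h * (C * ((2 * a\<^sup>2 + 1) * en \<eta>))"
    proof -
      have "ip \<eta> \<eta> + en \<eta> \<le> (2 * a\<^sup>2 + 1) * en \<eta>"
        using ip_bound[of a \<eta>] \<eta>a a_pos by (simp add: algebra_simps)
      then show ?thesis using h C(1) by (intro mult_left_mono)
    qed
    finally have "en \<eta> \<le> ?h * D" using h en_nonneg a_pos by (intro cancel) auto
    then show "integral {0..a} (\<lambda>t. (norm (mom x t - pos (prim m x) t))\<^sup>2) \<le> D * ?h"
      unfolding en r_def by (simp add: mult.commute)
    \<comment> \<open>A constant curve has no velocity, so only the boundary term survives.\<close>
    define \<beta> where "\<beta> = (pos ?w a, 0 :: real \<Rightarrow>\<^sub>C 'v)"
    have \<beta>: "vel \<beta> t = 0" "pos \<beta> t = pos ?w a" for t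
      by (simp_all add: \<beta>_def vel_def pos_def zero_bcontfun.rep_eq)
    have "form x \<beta> - m * ip x \<beta> = (norm (pos ?w a))\<^sup>2"
      unfolding form_eq_boundary \<beta> by (simp add: power2_norm_eq_inner)
    then have "((norm (pos ?w a))\<^sup>2)\<^sup>2 \<le> ?h * (C * (ip \<beta> \<beta> + en \<beta>))"
      using C(2)[OF x, of \<beta>] by simp
    moreover have "ip \<beta> \<beta> + en \<beta> = a * (norm (pos ?w a))\<^sup>2"
      unfolding ip_norm en_def \<beta> using a_pos by simp
    ultimately have "(norm (pos ?w a))\<^sup>2 \<le> ?h * D"
      using h a_pos by (intro cancel[of _ _ a]) auto
    then show "(norm (pos (prim m x) a))\<^sup>2 \<le> D * ?h" by (simp add: mult.commute)
  qed
qed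

text \<open>For a minimizer the excess in \<open>residual_bound\<close> is 0. In
  \<open>negative_eigenfunction_exists\<close> this rules out that the infimum is 0.\<close>

lemma eigen_of_minimizer:
  assumes Y: "finite Y" "\<And>b e. b \<in> Y \<Longrightarrow> form b e = \<mu> b * ip b e"
    and psd: "\<And>e. e \<in> orth Y \<Longrightarrow> m * ip e e \<le> form e e"
    and x: "x \<in> orth Y" "form x x \<le> m * ip x x"
  shows "eigen m x"
proof -
  obtain C where C: "C \<ge> 0"
    "\<And>x. x \<in> orth Y \<Longrightarrow> integral {0..a} (\<lambda>t. (norm (mom x t - pos (prim m x) t))\<^sup>2)
        \<le> C * (form x x - m * ip x x)"
    "\<And>x. x \<in> orth Y \<Longrightarrow> (norm (pos (prim m x) a))\<^sup>2 \<le> C * (form x x - m * ip x x)"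
    using residual_bound[OF assms(1-3)] by blast
  have h: "form x x - m * ip x x = 0" using psd[OF x(1)] x(2) by simp
  have "mom x t - pos (prim m x) t = 0" if "t \<in> {0..a}" for t
    using C(2)[OF x(1)] h that a_pos
    by (intro integral_square_eq_0D[of 0 a "\<lambda>t. mom x t - pos (prim m x) t"] continuous_intros) auto
  moreover have "pos (prim m x) a = 0" using C(3)[OF x(1)] h by simp
  ultimately show ?thesis using a_pos by (simp add: eigen_def pos_prim[symmetric])
qed

section \<open>Compactness and convergence of curves\<close>

lemma curve_subsequence:
  assumes B: "\<And>n. en (e n) \<le> B" "\<And>n. norm (pos (e n) 0) \<le> B"
  obtains r g where "strict_mono (r :: nat \<Rightarrow> nat)" "continuous_on {0..a} g"
    "\<And>\<epsilon>. 0 < \<epsilon> \<Longrightarrow> \<exists>N. \<forall>n\<ge>N. \<forall>t\<in>{0..a}. norm (pos (e (r n)) t - g t) < \<epsilon>"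
proof -
  have B0: "0 \<le> B" using order_trans[OF en_nonneg B(1)] .
  have bound: "norm (pos (e n) t) \<le> B + sqrt (a * B)" if "t \<in> {0..a}" for n t
  proof -
    have "(norm (pos (e n) t - pos (e n) 0))\<^sup>2 \<le> \<bar>t - 0\<bar> * en (e n)"
      using that a_pos by (intro pos_holder') auto
    also have "\<dots> \<le> a * B" using that B(1)[of n] B0 en_nonneg by (intro mult_mono) auto
    finally have "norm (pos (e n) t - pos (e n) 0) \<le> sqrt (a * B)" by (rule real_le_rsqrt)
    then show ?thesis using B(2)[of n] norm_triangle_sub[of "pos (e n) t" "pos (e n) 0"] by linarith
  qed
  have equicont: "\<exists>d>0. \<forall>n s. s \<in> {0..a} \<and> norm (t - s) < d \<longrightarrow> norm (pos (e n) t - pos (e n) s) < \<epsilon>"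
    if t: "t \<in> {0..a}" and \<epsilon>: "0 < \<epsilon>" for t \<epsilon>
  proof (intro exI conjI allI impI)
    \<comment> \<open>The square inverts the Hoelder exponent 1/2; adding 1 keeps the denominator
      positive when \<open>B\<close> is 0.\<close>
    show "0 < \<epsilon>\<^sup>2 / (B + 1)" using \<epsilon> B0 by simp
    fix n s assume s: "s \<in> {0..a} \<and> norm (t - s) < \<epsilon>\<^sup>2 / (B + 1)"
    have "(norm (pos (e n) t - pos (e n) s))\<^sup>2 \<le> \<bar>t - s\<bar> * en (e n)"
      using s t by (intro pos_holder') auto
    also have "\<dots> \<le> \<bar>t - s\<bar> * (B + 1)" using B(1)[of n] by (intro mult_left_mono) auto
    also have "\<dots> < \<epsilon>\<^sup>2" using s B0 by (simp add: field_simps)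
    finally show "norm (pos (e n) t - pos (e n) s) < \<epsilon>"
      using \<epsilon> by (simp add: power_less_imp_less_base)
  qed
  obtain g and r :: "nat \<Rightarrow> nat" where "continuous_on {0..a} g" "strict_mono r"
    "\<And>\<epsilon>. 0 < \<epsilon> \<Longrightarrow> \<exists>N. \<forall>n t. n \<ge> N \<and> t \<in> {0..a} \<longrightarrow> norm (pos (e (r n)) t - g t) < \<epsilon>"
    by (rule Arzela_Ascoli[OF compact_Icc bound equicont]) blast+
  with that[of r g] show ?thesis by blast
qed

lemma uniform_imp_square_integral:
  fixes f :: "nat \<Rightarrow> real \<Rightarrow> 'v"
  assumes "\<And>n. continuous_on {0..a} (f n)"
    and "\<And>\<epsilon>. 0 < \<epsilon> \<Longrightarrow> \<exists>N. \<forall>n\<ge>N. \<forall>t\<in>{0..a}. norm (f n t) < \<epsilon>"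
  shows "(\<lambda>n. integral {0..a} (\<lambda>t. (norm (f n t))\<^sup>2)) \<longlonglongrightarrow> 0"
proof (rule LIMSEQ_I)
  fix \<epsilon> :: real assume \<epsilon>: "0 < \<epsilon>"
  define \<delta> where "\<delta> = sqrt (\<epsilon> / (2 * a))"
  have \<delta>: "\<delta> > 0" "a * \<delta>\<^sup>2 < \<epsilon>" using \<epsilon> a_pos by (simp_all add: \<delta>_def)
  obtain N where N: "\<And>n t. n \<ge> N \<Longrightarrow> t \<in> {0..a} \<Longrightarrow> norm (f n t) < \<delta>" using assms(2)[OF \<delta>(1)] by blast
  have "norm (integral {0..a} (\<lambda>t. (norm (f n t))\<^sup>2) - 0) < \<epsilon>" if n: "n \<ge> N" for n
  proof -
    have i: "(\<lambda>t. (norm (f n t))\<^sup>2) integrable_on {0..a}"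
      using assms(1)[of n] by (intro integrable_continuous_interval continuous_intros)
    have "integral {0..a} (\<lambda>t. (norm (f n t))\<^sup>2) \<le> integral {0..a} (\<lambda>t. \<delta>\<^sup>2)"
      using N[OF n] by (intro integral_le i integrable_const_ivl power_mono) (auto intro: less_imp_le)
    also have "\<dots> = a * \<delta>\<^sup>2" using a_pos by simp
    finally show ?thesis using \<delta>(2) integral_nonneg[OF i] by simp
  qed
  then show "\<exists>N. \<forall>n\<ge>N. norm (integral {0..a} (\<lambda>t. (norm (f n t))\<^sup>2) - 0) < \<epsilon>" by blast
qed

lemma P_lower:
  obtains p where "p > 0" "\<And>t w. t \<in> {0..a} \<Longrightarrow> p * norm w \<le> norm (P t w)"
proof -
  obtain p where p: "p > 0" "\<And>t w. t \<in> {0..a} \<Longrightarrow> p * (norm w)\<^sup>2 \<le> w \<bullet> P t w"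
    using P_coercive by blast
  have "p * norm w \<le> norm (P t w)" if "t \<in> {0..a}" for t w
  proof (cases "w = 0")
    case False
    have "(p * norm w) * norm w \<le> norm (P t w) * norm w"
      using order_trans[OF p(2)[OF that, of w] norm_cauchy_schwarz] by (simp add: power2_eq_square mult_ac)
    then show ?thesis using False by simp
  qed simp
  then show ?thesis using that p(1) by blast
qed

text \<open>Continuity of \<open>h\<close> comes from the lower bound on \<open>P\<close>: the
  difference \<open>h s - h t\<close> is at most \<open>norm (V s - P s (h t)) / p\<close>, which
  tends to 0 as s tends to t.\<close>

lemma P_solve:
  assumes V: "continuous_on {0..a} V"
  obtains h where "continuous_on {0..a} h" "\<And>t. t \<in> {0..a} \<Longrightarrow> P t (h t) = V t"
proof -
  obtain p where p: "p > 0" "\<And>t w. t \<in> {0..a} \<Longrightarrow> p * norm w \<le> norm (P t w)"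
    using P_lower by blast
  have "\<exists>v. P t v = V t" if t: "t \<in> {0..a}" for t
  proof -
    have "v = 0" if "P t v = 0" for v
      using p(2)[OF t, of v] p(1) that by (simp add: mult_le_0_iff)
    then have "inj (P t)" using lin(1) by (simp add: linear_injective_0)
    then have "surj (P t)" using lin(1) linear_injective_imp_surjective by blast
    then show ?thesis by (metis surjD)
  qed
  then obtain h where h: "\<And>t. t \<in> {0..a} \<Longrightarrow> P t (h t) = V t" by metis
  have "(h \<longlongrightarrow> h t) (at t within {0..a})" if t: "t \<in> {0..a}" for t
  proof -
    have "continuous_on {0..a} (\<lambda>s. V s - P s (h t))" using V cont(1) by (intro continuous_intros)
    then have "((\<lambda>s. V s - P s (h t)) \<longlongrightarrow> V t - P t (h t)) (at t within {0..a})"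
      using t by (simp add: continuous_on)
    then have "((\<lambda>s. norm (V s - P s (h t)) / p) \<longlongrightarrow> norm (V t - P t (h t)) / p) (at t within {0..a})"
      using p(1) by (intro tendsto_divide tendsto_norm tendsto_const) auto
    then have "((\<lambda>s. norm (V s - P s (h t)) / p) \<longlongrightarrow> 0) (at t within {0..a})"
      using h[OF t] by simp
    moreover have "norm (h s - h t) \<le> norm (V s - P s (h t)) / p" if s: "s \<in> {0..a}" for s
    proof -
      have "p * norm (h s - h t) \<le> norm (P s (h s - h t))" by (rule p(2)[OF s])
      then show ?thesis
        using p(1) h[OF s] lin(1)[of s] by (simp add: linear_diff field_simps)
    qed
    then have "\<forall>\<^sub>F s in at t within {0..a}. norm (h s - h t) \<le> norm (V s - P s (h t)) / p"
      unfolding eventually_at by (intro exI[of _ 1]) simp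
    ultimately have "((\<lambda>s. h s - h t) \<longlongrightarrow> 0) (at t within {0..a})"
      by (rule Lim_null_comparison[rotated])
    then show ?thesis using LIM_zero_iff by blast
  qed
  then have "continuous_on {0..a} h" by (simp add: continuous_on)
  then show ?thesis using that h by blast
qed

lemma pos_tendsto_0:
  assumes "(\<lambda>n. en (d n)) \<longlonglongrightarrow> 0" "(\<lambda>n. pos (d n) 0) \<longlonglongrightarrow> 0"
  shows "(\<lambda>n. ip (d n) (d n)) \<longlonglongrightarrow> 0" "t \<in> {0..a} \<Longrightarrow> (\<lambda>n. pos (d n) t) \<longlonglongrightarrow> 0"
proof -
  have "(\<lambda>n. 2 * a * (norm (pos (d n) 0))\<^sup>2 + 2 * a\<^sup>2 * en (d n)) \<longlonglongrightarrow> 2 * a * (norm (0::'v))\<^sup>2 + 2 * a\<^sup>2 * 0"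
    by (intro tendsto_intros assms)
  then have l: "(\<lambda>n. 2 * a * (norm (pos (d n) 0))\<^sup>2 + 2 * a\<^sup>2 * en (d n)) \<longlonglongrightarrow> 0" by simp
  show "(\<lambda>n. ip (d n) (d n)) \<longlonglongrightarrow> 0"
    by (rule tendsto_sandwich[OF _ _ tendsto_const l]) (use ip_nonneg ip_bound[of 0] a_pos in auto)
  assume t: "t \<in> {0..a}"
  have "(\<lambda>n. 2 * (norm (pos (d n) 0))\<^sup>2 + 2 * a * en (d n)) \<longlonglongrightarrow> 2 * (norm (0::'v))\<^sup>2 + 2 * a * 0"
    by (intro tendsto_intros assms)
  then have l: "(\<lambda>n. 2 * (norm (pos (d n) 0))\<^sup>2 + 2 * a * en (d n)) \<longlonglongrightarrow> 0" by simp
  have "(\<lambda>n. (norm (pos (d n) t))\<^sup>2) \<longlonglongrightarrow> 0"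
    by (rule tendsto_sandwich[OF _ _ tendsto_const l]) (use pos_sq_bound[of 0 t] a_pos t in auto)
  then show "(\<lambda>n. pos (d n) t) \<longlonglongrightarrow> 0"
    using tendsto_norm_zero_cancel tendsto_real_sqrt[of "\<lambda>n. (norm (pos (d n) t))\<^sup>2" 0] by auto
qed

text \<open>Used twice in the limit argument: it makes the primitives of a minimizing sequence
  accessible to Arzela-Ascoli, and it carries convergence of the curves over to their
  primitives.\<close>

lemma prim_en_bound:
  obtains C where "C \<ge> 0" "\<And>d. en (prim m d) \<le> C * (en d + ip d d)"
proof -
  obtain K where K: "K > 0" "\<And>t w. t \<in> {0..a} \<Longrightarrow> norm (P t w) \<le> K * norm w"
    "\<And>t w. t \<in> {0..a} \<Longrightarrow> norm (Q t w) \<le> K * norm w"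
    "\<And>t w. t \<in> {0..a} \<Longrightarrow> norm (R t w) \<le> K * norm w" using bounds_exist by blast
  define L where "L = K + \<bar>m\<bar>"
  have L: "L \<ge> K" "L > 0" using K(1) by (auto simp: L_def)
  have ptw: "(norm (vel (prim m d) t))\<^sup>2 \<le> 2 * L\<^sup>2 * ((norm (vel d t))\<^sup>2 + (norm (pos d t))\<^sup>2)"
    if t: "t \<in> {0..a}" for d t
  proof -
    let ?u = "vel d t" and ?x = "pos d t"
    have "norm (vel (prim m d) t) \<le> norm (Q t ?u) + norm (R t ?x) + norm (m *\<^sub>R ?x)"
      unfolding prim(2)[OF t] frc_def
      by (intro order_trans[OF norm_triangle_ineq4] add_right_mono norm_triangle_ineq)
    also have "\<dots> \<le> L * norm ?u + L * norm ?x"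
      using K(3)[OF t, of ?u] K(4)[OF t, of ?x] mult_nonneg_nonneg[OF abs_ge_zero[of m] norm_ge_zero[of ?u]]
      unfolding L_def distrib_right norm_scaleR by linarith
    finally have "(norm (vel (prim m d) t))\<^sup>2 \<le> (L * norm ?u + L * norm ?x)\<^sup>2"
      by (simp add: power_mono)
    also have "\<dots> \<le> 2 * L\<^sup>2 * ((norm ?u)\<^sup>2 + (norm ?x)\<^sup>2)"
      using zero_le_power2[of "L * norm ?u - L * norm ?x"] by (simp add: power2_eq_square algebra_simps)
    finally show ?thesis .
  qed
  have "en (prim m d) \<le> 2 * L\<^sup>2 * (en d + ip d d)" for d
  proof -
    have "en (prim m d) \<le> integral {0..a} (\<lambda>t. 2 * L\<^sup>2 * ((norm (vel d t))\<^sup>2 + (norm (pos d t))\<^sup>2))"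
      unfolding en_def
      by (intro integral_le integrable_continuous_interval continuous_intros ptw)
    also have "\<dots> = 2 * L\<^sup>2 * (en d + ip d d)"
      unfolding en_def ip_norm
      by (subst integral_mult_right, subst integral_add)
        (auto intro!: integrable_continuous_interval continuous_intros)
    finally show ?thesis .
  qed
  then show ?thesis using that[of "2 * L\<^sup>2"] by simp
qed

lemma pos_prim_diff:
  assumes "t \<in> {0..a}"
  shows "pos (prim m (e - f)) t = pos (prim m e) t - pos (prim m f) t"
proof -
  have i: "(\<lambda>s. frc e s - m *\<^sub>R pos e s) integrable_on {0..t}" for e
    using assms by (intro integrable_continuous_interval continuous_intros
        continuous_on_subset[OF continuous_frc]) auto
  show ?thesis
    unfolding pos_prim[OF assms] integral_diff[OF i i, symmetric]
    by (intro integral_cong) (simp add: algebra_simps)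
qed

text \<open>A minimizing sequence and the primitives of its forces converge uniformly along a
  subsequence by Arzela-Ascoli; as the momenta are asymptotically equal to these primitives, the
  velocities converge in mean square to a continuous function.\<close>

lemma minimizing_sequence_limit:
  assumes Y: "finite Y" "\<And>b e. b \<in> Y \<Longrightarrow> form b e = \<mu> b * ip b e"
    and psd: "\<And>e. e \<in> orth Y \<Longrightarrow> m * ip e e \<le> form e e"
    and e: "\<And>n. e n \<in> orth Y" "\<And>n. ip (e n) (e n) = 1" "(\<lambda>n. form (e n) (e n)) \<longlonglongrightarrow> m"
  shows "\<exists>g\<in>orth Y. ip g g = 1 \<and> eigen m g"
proof -
  obtain p where p: "p > 0" "\<And>t w. t \<in> {0..a} \<Longrightarrow> p * norm w \<le> norm (P t w)"
    using P_lower by blast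
  obtain K where K: "K > 0" "\<And>t w. t \<in> {0..a} \<Longrightarrow> norm (Q t w) \<le> K * norm w"
    by (rule bounds_exist) blast
  obtain C where C: "C \<ge> 0"
    "\<And>x. x \<in> orth Y \<Longrightarrow> integral {0..a} (\<lambda>t. (norm (mom x t - pos (prim m x) t))\<^sup>2)
        \<le> C * (form x x - m * ip x x)"
    "\<And>x. x \<in> orth Y \<Longrightarrow> (norm (pos (prim m x) a))\<^sup>2 \<le> C * (form x x - m * ip x x)"
    using residual_bound[OF assms(1-3)] by blast
  obtain C2 where C2: "C2 \<ge> 0" "\<And>d. en (prim m d) \<le> C2 * (en d + ip d d)"
    using prim_en_bound[of m] by blast
  obtain c d where cd: "c \<ge> 0" "d > 0" "\<And>e. d * en e - c * ip e e \<le> form e e"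
    using garding by blast
  have "bdd_above (range (\<lambda>n. form (e n) (e n)))"
    by (rule Bseq_bdd_above[OF convergent_imp_Bseq[OF convergentI[OF e(3)]]])
  then obtain F where F: "\<And>n. form (e n) (e n) \<le> F"
    unfolding bdd_above_def by blast
  have en_e: "en (e n) \<le> (F + c) / d" for n
    using cd(3)[of "e n"] e(2)[of n] F[of n] cd(2) by (simp add: field_simps)
  have start: "norm (pos (e n) 0) \<le> sqrt (2 / a + 2 * a * ((F + c) / d))" for n
  proof (rule real_le_rsqrt)
    have "a * (norm (pos (e n) 0))\<^sup>2 \<le> 2 + 2 * a\<^sup>2 * ((F + c) / d)"
      using start_sq_bound[of "e n"] e(2)[of n] mult_left_mono[OF en_e[of n], of "2 * a\<^sup>2"] by simp
    also have "\<dots> = a * (2 / a + 2 * a * ((F + c) / d))"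
      using a_pos by (simp add: power2_eq_square distrib_left)
    finally show "(norm (pos (e n) 0))\<^sup>2 \<le> 2 / a + 2 * a * ((F + c) / d)"
      using a_pos by (simp only: mult_le_cancel_left_pos)
  qed
  obtain r1 g where r1: "strict_mono (r1 :: nat \<Rightarrow> nat)" "continuous_on {0..a} g"
    "\<And>\<epsilon>. 0 < \<epsilon> \<Longrightarrow> \<exists>N. \<forall>n\<ge>N. \<forall>t\<in>{0..a}. norm (pos (e (r1 n)) t - g t) < \<epsilon>"
    by (rule curve_subsequence[of e "max ((F + c) / d) (sqrt (2 / a + 2 * a * ((F + c) / d)))"])
      (use en_e start in \<open>auto simp: le_max_iff_disj\<close>)
  obtain r2 W where r2: "strict_mono (r2 :: nat \<Rightarrow> nat)" "continuous_on {0..a} W"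
    "\<And>\<epsilon>. 0 < \<epsilon> \<Longrightarrow> \<exists>N. \<forall>n\<ge>N. \<forall>t\<in>{0..a}. norm (pos (prim m (e (r1 (r2 n)))) t - W t) < \<epsilon>"
  proof (rule curve_subsequence[of "\<lambda>n. prim m (e (r1 n))" "C2 * ((F + c) / d + 1)"])
    fix n
    show b: "en (prim m (e (r1 n))) \<le> C2 * ((F + c) / d + 1)"
      using order_trans[OF C2(2) mult_left_mono[OF add_right_mono[OF en_e] C2(1)]] e(2) by simp
    show "norm (pos (prim m (e (r1 n))) 0) \<le> C2 * ((F + c) / d + 1)"
      using order_trans[OF en_nonneg b] by (simp add: prim)
  qed blast
  define x where "x n = e (r1 (r2 n))" for n
  define w where "w n = prim m (x n)" for n
  have sm: "strict_mono (\<lambda>n. r1 (r2 n))" using r1(1) r2(1) by (simp add: strict_mono_def)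
  have x: "x n \<in> orth Y" "ip (x n) (x n) = 1" for n by (simp_all add: x_def e)
  have xg: "\<exists>N. \<forall>n\<ge>N. \<forall>t\<in>{0..a}. norm (pos (x n) t - g t) < \<epsilon>" if \<epsilon>: "0 < \<epsilon>" for \<epsilon>
  proof -
    obtain N where "\<forall>n\<ge>N. \<forall>t\<in>{0..a}. norm (pos (e (r1 n)) t - g t) < \<epsilon>" using r1(3)[OF \<epsilon>] by blast
    then show ?thesis unfolding x_def by (meson order_trans seq_suble r2(1))
  qed
  have wW: "\<exists>N. \<forall>n\<ge>N. \<forall>t\<in>{0..a}. norm (pos (w n) t - W t) < \<epsilon>" if "0 < \<epsilon>" for \<epsilon>
    using r2(3)[OF that] by (simp add: w_def x_def)
  have pt: "(\<lambda>n. f n t) \<longlonglongrightarrow> l t" if "\<And>\<epsilon>. 0 < \<epsilon> \<Longrightarrow> \<exists>N. \<forall>n\<ge>N. \<forall>t\<in>{0..a}. norm (f n t - l t) < \<epsilon>"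
    "t \<in> {0..a}" for f :: "nat \<Rightarrow> real \<Rightarrow> 'v" and l t
    using that by (intro LIMSEQ_I) blast
  have "(\<lambda>n. form (x n) (x n)) \<longlonglongrightarrow> m"
    using LIMSEQ_subseq_LIMSEQ[OF e(3) sm] by (simp add: x_def o_def)
  then have "(\<lambda>n. C * (form (x n) (x n) - m * ip (x n) (x n))) \<longlonglongrightarrow> C * (m - m * 1)"
    unfolding x(2) by (intro tendsto_intros)
  then have res: "(\<lambda>n. C * (form (x n) (x n) - m * ip (x n) (x n))) \<longlonglongrightarrow> 0" by simp
  have "0 \<le> integral {0..a} (\<lambda>t. (norm (mom (x n) t - pos (w n) t))\<^sup>2)" for n
    by (intro integral_nonneg integrable_continuous_interval continuous_intros) auto
  then have r0: "(\<lambda>n. integral {0..a} (\<lambda>t. (norm (mom (x n) t - pos (w n) t))\<^sup>2)) \<longlonglongrightarrow> 0"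
    by (intro tendsto_sandwich[OF _ _ tendsto_const res]) (use C(2)[OF x(1)] in \<open>auto simp: w_def\<close>)
  have wa: "(\<lambda>n. (norm (pos (w n) a))\<^sup>2) \<longlonglongrightarrow> 0"
    by (rule tendsto_sandwich[OF _ _ tendsto_const res]) (use C(3)[OF x(1)] in \<open>auto simp: w_def\<close>)
  have Wa: "W a = 0"
  proof -
    have "(\<lambda>n. (norm (pos (w n) a))\<^sup>2) \<longlonglongrightarrow> (norm (W a))\<^sup>2"
      using a_pos by (intro tendsto_intros pt[OF wW]) auto
    from LIMSEQ_unique[OF this wa] show ?thesis by simp
  qed
  \<comment> \<open>If the momenta tend to \<open>W\<close> and the positions to \<open>g\<close>,
    the limiting velocity h has to satisfy P h = W - Q g. Solving this gives a continuous candidate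
    before any convergence of velocities is known.\<close>
  have cV: "continuous_on {0..a} (\<lambda>t. W t - Q t (g t))"
    using r1(2) r2(2) by (intro continuous_intros)
  obtain h where h: "continuous_on {0..a} h" "\<And>t. t \<in> {0..a} \<Longrightarrow> P t (h t) = W t - Q t (g t)"
    by (rule P_solve[OF cV]) blast
  \<comment> \<open>Only the initial position is set to that of \<open>g\<close>. That
    \<open>G\<close> has position \<open>g\<close> and primitive \<open>W\<close> throughout follows
    later, once the energy of \<open>x n - G\<close> is known to tend to 0.\<close>
  obtain G where G: "fst G = g 0" "\<And>t. t \<in> {0..a} \<Longrightarrow> vel G t = h t"
    by (rule curve_exists[OF h(1), of "g 0"]) blast
  define D where "D n = x n - G" for n
  have Dptw: "p\<^sup>2 * (norm (vel (D n) t))\<^sup>2 \<le> 3 * (norm (mom (x n) t - pos (w n) t))\<^sup>2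
      + 3 * (norm (pos (w n) t - W t))\<^sup>2 + 3 * K\<^sup>2 * (norm (pos (x n) t - g t))\<^sup>2"
    if t: "t \<in> {0..a}" for n t
  proof -
    define A B E where "A = norm (mom (x n) t - pos (w n) t)" and "B = norm (pos (w n) t - W t)"
      and "E = K * norm (pos (x n) t - g t)"
    \<comment> \<open>Insert the momentum of \<open>x n\<close> and the equation for
      \<open>h\<close>. The three terms are the residual, the error of the primitives and the error
      of the positions; the factor 3 below bounds the square of a sum of three terms.\<close>
    have eq: "P t (vel (D n) t) = (mom (x n) t - pos (w n) t) + (pos (w n) t - W t) - Q t (pos (x n) t - g t)"
      using h(2)[OF t] lin[of t] by (simp add: D_def G(2)[OF t] mom_def linear_diff)
    have "norm (P t (vel (D n) t)) \<le> A + B + norm (Q t (pos (x n) t - g t))"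
      unfolding A_def B_def eq
      by (intro order_trans[OF norm_triangle_ineq4] add_right_mono norm_triangle_ineq)
    then have "p * norm (vel (D n) t) \<le> A + B + E"
      using p(2)[OF t, of "vel (D n) t"] K(2)[OF t, of "pos (x n) t - g t"] by (simp add: E_def)
    then have "(p * norm (vel (D n) t))\<^sup>2 \<le> (A + B + E)\<^sup>2" using p(1) by (intro power_mono) auto
    also have "\<dots> \<le> 3 * A\<^sup>2 + 3 * B\<^sup>2 + 3 * E\<^sup>2"
      using zero_le_power2[of "A - B"] zero_le_power2[of "A - E"] zero_le_power2[of "B - E"]
      by (simp add: power2_eq_square algebra_simps)
    finally show ?thesis by (simp add: A_def B_def E_def power_mult_distrib)
  qed
  have c1: "continuous_on {0..a} (\<lambda>t. pos (w n) t - W t)" "continuous_on {0..a} (\<lambda>t. pos (x n) t - g t)" for n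
    using r1(2) r2(2) by (auto intro!: continuous_intros)
  have int: "(\<lambda>t. (norm (mom (x n) t - pos (w n) t))\<^sup>2) integrable_on {0..a}"
    "(\<lambda>t. (norm (pos (w n) t - W t))\<^sup>2) integrable_on {0..a}"
    "(\<lambda>t. (norm (pos (x n) t - g t))\<^sup>2) integrable_on {0..a}" for n
    by (intro integrable_continuous_interval continuous_intros c1)+
  let ?I = "\<lambda>n. 3 * integral {0..a} (\<lambda>t. (norm (mom (x n) t - pos (w n) t))\<^sup>2)
      + 3 * integral {0..a} (\<lambda>t. (norm (pos (w n) t - W t))\<^sup>2)
      + 3 * K\<^sup>2 * integral {0..a} (\<lambda>t. (norm (pos (x n) t - g t))\<^sup>2)"
  have I: "en (D n) \<le> ?I n / p\<^sup>2" for n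
  proof -
    have "p\<^sup>2 * en (D n) = integral {0..a} (\<lambda>t. p\<^sup>2 * (norm (vel (D n) t))\<^sup>2)"
      by (simp add: en_def)
    also have "\<dots> \<le> integral {0..a} (\<lambda>t. 3 * (norm (mom (x n) t - pos (w n) t))\<^sup>2
      + 3 * (norm (pos (w n) t - W t))\<^sup>2 + 3 * K\<^sup>2 * (norm (pos (x n) t - g t))\<^sup>2)"
      by (intro integral_le Dptw integrable_add integrable_on_mult_right int integrable_en)
    also have "\<dots> = ?I n"
      by (simp add: integral_add integrable_add integrable_on_mult_right int)
    finally show ?thesis using p(1) by (simp add: field_simps)
  qed
  have "(\<lambda>n. ?I n / p\<^sup>2) \<longlonglongrightarrow> (3 * 0 + 3 * 0 + 3 * K\<^sup>2 * 0) / p\<^sup>2"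
    using p(1) by (intro tendsto_intros r0 uniform_imp_square_integral c1 wW xg) auto
  then have I0: "(\<lambda>n. ?I n / p\<^sup>2) \<longlonglongrightarrow> 0" by simp
  have enD: "(\<lambda>n. en (D n)) \<longlonglongrightarrow> 0"
    by (rule tendsto_sandwich[OF _ _ tendsto_const I0]) (use I en_nonneg in auto)
  have D0: "(\<lambda>n. pos (D n) 0) \<longlonglongrightarrow> 0"
    using LIM_zero[OF pt[OF xg, of 0]] a_pos by (simp add: D_def G)
  have ipD: "(\<lambda>n. ip (D n) (D n)) \<longlonglongrightarrow> 0" using pos_tendsto_0(1)[OF enD D0] .
  have G_pos: "pos G t = g t" if t: "t \<in> {0..a}" for t
  proof -
    have "(\<lambda>n. pos (x n) t - pos G t) \<longlonglongrightarrow> 0" using pos_tendsto_0(2)[OF enD D0 t] by (simp add: D_def)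
    then have "(\<lambda>n. pos (x n) t) \<longlonglongrightarrow> pos G t" by (rule LIM_zero_cancel)
    then show ?thesis using LIMSEQ_unique pt[OF xg t] by blast
  qed
  have G_W: "pos (prim m G) t = W t" if t: "t \<in> {0..a}" for t
  proof -
    have "(\<lambda>n. C2 * (en (D n) + ip (D n) (D n))) \<longlonglongrightarrow> C2 * (0 + 0)"
      by (intro tendsto_intros enD ipD)
    then have l: "(\<lambda>n. C2 * (en (D n) + ip (D n) (D n))) \<longlonglongrightarrow> 0" by simp
    have "(\<lambda>n. en (prim m (D n))) \<longlonglongrightarrow> 0"
      by (rule tendsto_sandwich[OF _ _ tendsto_const l]) (use C2(2) en_nonneg in auto)
    from pos_tendsto_0(2)[OF this _ t] have "(\<lambda>n. pos (prim m (D n)) t) \<longlonglongrightarrow> 0"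
      by (simp add: prim)
    then have "(\<lambda>n. pos (w n) t) \<longlonglongrightarrow> pos (prim m G) t"
      unfolding D_def pos_prim_diff[OF t] w_def by (rule LIM_zero_cancel)
    then show ?thesis using LIMSEQ_unique pt[OF wW t] by blast
  qed
  have "eigen m G"
  proof -
    have "mom G t = W t" if t: "t \<in> {0..a}" for t
      using h(2)[OF t] by (simp add: mom_def G(2)[OF t] G_pos[OF t])
    then show ?thesis using Wa G_W a_pos by (simp add: eigen_def pos_prim[symmetric])
  qed
  moreover have lim_ip: "(\<lambda>n. ip (x n) b) \<longlonglongrightarrow> ip G b" for b
  proof -
    have "(\<lambda>n. ip (D n) (D n) * ip b b) \<longlonglongrightarrow> 0 * ip b b" by (intro tendsto_intros ipD)
    then have l: "(\<lambda>n. ip (D n) (D n) * ip b b) \<longlonglongrightarrow> 0" by simp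
    have "(ip (D n) b)\<^sup>2 \<le> ip (D n) (D n) * ip b b" for n
      by (rule psd_cauchy_schwarz[OF bilinear_ip ip_commute, of UNIV]) (auto simp: ip_nonneg)
    then have "(\<lambda>n. (ip (D n) b)\<^sup>2) \<longlonglongrightarrow> 0"
      by (intro tendsto_sandwich[OF _ _ tendsto_const l]) auto
    then have "(\<lambda>n. ip (D n) b) \<longlonglongrightarrow> 0"
      using tendsto_rabs_zero_cancel tendsto_real_sqrt[of "\<lambda>n. (ip (D n) b)\<^sup>2" 0] by auto
    then show ?thesis
      unfolding D_def bilinear_lsub[OF bilinear_ip] by (rule LIM_zero_cancel)
  qed
  moreover have "G \<in> orth Y"
  proof -
    have "ip G b = 0" if b: "b \<in> Y" for b
    proof -
      have "ip (x n) b = 0" for n using x(1) b by (simp add: orth_def)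
      then show ?thesis using lim_ip[of b] by (simp add: LIMSEQ_const_iff)
    qed
    then show ?thesis by (simp add: orth_def)
  qed
  moreover have "ip G G = 1"
  proof -
    \<comment> \<open>The left side tends to 0 and the right side to \<open>1 - ip G G\<close>,
      because \<open>x n\<close> tends to \<open>G\<close> against every fixed curve.\<close>
    have "ip (D n) (D n) = 1 - 2 * ip (x n) G + ip G G" for n
      using x(2)[of n] ip_commute[of G "x n"]
      by (simp add: D_def bilinear_lsub[OF bilinear_ip] bilinear_rsub[OF bilinear_ip])
    then have "(\<lambda>n. 1 - 2 * ip (x n) G + ip G G) \<longlonglongrightarrow> 0" using ipD by simp
    moreover have "(\<lambda>n. 1 - 2 * ip (x n) G + ip G G) \<longlonglongrightarrow> 1 - 2 * ip G G + ip G G"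
      by (intro tendsto_intros lim_ip)
    ultimately have "1 - 2 * ip G G + ip G G = 0" by (metis LIMSEQ_unique)
    then show ?thesis by simp
  qed
  ultimately show ?thesis by blast
qed

text \<open>Let m be the infimum of the Rayleigh quotient on \<open>orth Y\<close>. The curve
  \<open>x\<close> shows m \<le> 0, and if m were 0 then \<open>x\<close> would be a minimizer,
  hence an eigenfunction for 0, which the last assumption excludes. So m is negative, and it is
  attained.\<close>

theorem negative_eigenfunction_exists:
  assumes Y: "finite Y" "\<And>b e. b \<in> Y \<Longrightarrow> form b e = \<mu> b * ip b e"
    and x: "x \<in> orth Y" "form x x \<le> 0" "\<not> eigen 0 x"
  shows "\<exists>m<0. \<exists>g\<in>orth Y. ip g g = 1 \<and> eigen m g"
proof -
  obtain c d where cd: "c \<ge> 0" "d > 0" "\<And>e. d * en e - c * ip e e \<le> form e e"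
    using garding by blast
  let ?S = "{form e e | e. e \<in> orth Y \<and> ip e e = 1}"
  define m where "m = Inf ?S"
  have lower: "- c \<le> form e e" if "ip e e = 1" for e
    using cd(3)[of e] that mult_nonneg_nonneg[OF less_imp_le[OF cd(2)] en_nonneg[of e]] by simp
  have bdd: "bdd_below ?S" using lower by (intro bdd_belowI[of _ "- c"]) auto
  have norm1: "\<exists>r>0. ip (r *\<^sub>R e) (r *\<^sub>R e) = 1 \<and> r\<^sup>2 * ip e e = 1" if "ip e e > 0" for e
    by (rule exI[of _ "1 / sqrt (ip e e)"])
      (use that in \<open>simp add: bilinear_lmul[OF bilinear_ip] bilinear_rmul[OF bilinear_ip] power_divide\<close>)
  have m_le: "m * ip e e \<le> form e e" if e: "e \<in> orth Y" and i: "ip e e > 0" for e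
  proof -
    obtain r where r: "r > 0" "ip (r *\<^sub>R e) (r *\<^sub>R e) = 1" "r\<^sup>2 * ip e e = 1" using norm1[OF i] by blast
    have "m \<le> form (r *\<^sub>R e) (r *\<^sub>R e)"
      unfolding m_def using e r(2) subspace_scale[OF subspace_orth e]
      by (intro cInf_lower bdd) blast
    also have "\<dots> = r\<^sup>2 * form e e"
      by (simp add: bilinear_lmul[OF bilinear_form] bilinear_rmul[OF bilinear_form] power2_eq_square)
    finally have "r\<^sup>2 * (m * ip e e) \<le> r\<^sup>2 * form e e"
      using r(3) by (simp add: mult.left_commute)
    then show ?thesis using r(1) by simp
  qed
  \<comment> \<open>Curves of L2 norm 0 cannot be normalized. They vanish on the interval together
    with their velocity, so they have no action and satisfy the equation for every
    eigenvalue.\<close>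
  have ip0: "form e e = 0 \<and> eigen k e" if "ip e e = 0" for e k
  proof -
    have p0: "pos e t = 0" if "t \<in> {0..a}" for t
      using \<open>ip e e = 0\<close> that a_pos unfolding ip_norm
      by (intro integral_square_eq_0D[of 0 a "pos e"] continuous_intros) auto
    have v0: "vel e t = 0" if t: "t \<in> {0..a}" for t
    proof (rule vector_derivative_unique_within_closed_interval[of 0 a t "pos e"])
      show "0 < a" "t \<in> cbox 0 a" using t a_pos by simp_all
      show "(pos e has_vector_derivative vel e t) (at t within cbox 0 a)"
        using t by (simp add: has_vector_derivative_pos)
      show "(pos e has_vector_derivative 0) (at t within cbox 0 a)"
        unfolding cbox_interval
        by (rule has_vector_derivative_transform[of t "{0..a}" "pos e" "\<lambda>_. 0"]) (use t p0 in auto)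
    qed
    have "mom e t = 0 \<and> frc e t = 0" if "t \<in> {0..a}" for t
      using lin[of t] by (simp add: mom_def frc_def p0[OF that] v0[OF that] linear_0)
    moreover from this have "integral {0..t} (\<lambda>s. frc e s - k *\<^sub>R pos e s) = integral {0..t} (\<lambda>s. 0)"
      if "t \<in> {0..a}" for t using that p0 by (intro integral_cong) auto
    moreover from calculation(1) have "form e e = integral {0..a} (\<lambda>t. 0)"
      unfolding form_def by (intro integral_cong) simp
    ultimately show ?thesis using a_pos by (simp add: eigen_def)
  qed
  have psd: "m * ip e e \<le> form e e" if "e \<in> orth Y" for e
    using m_le[OF that] ip0[of e] ip_nonneg[of e] by (cases "ip e e = 0") auto
  have xpos: "ip x x > 0" using ip0[of x 0] x(3) ip_nonneg[of x] by (cases "ip x x = 0") auto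
  have "m * ip x x \<le> 0" using psd[OF x(1)] x(2) by simp
  then have "m \<le> 0" using xpos by (simp add: mult_le_0_iff)
  moreover have "m \<noteq> 0"
    using eigen_of_minimizer[OF Y(1) _ psd x(1), of \<mu>] Y(2) x(2,3) by auto
  moreover have "\<exists>g\<in>orth Y. ip g g = 1 \<and> eigen m g"
  proof -
    obtain r where r: "ip (r *\<^sub>R x) (r *\<^sub>R x) = 1" using norm1[OF xpos] by blast
    then have ne: "?S \<noteq> {}" using subspace_scale[OF subspace_orth x(1)] by blast
    have "\<exists>e. e \<in> orth Y \<and> ip e e = 1 \<and> form e e < m + 1 / Suc n" for n
    proof -
      have "Inf ?S < m + 1 / Suc n" unfolding m_def by simp
      then show ?thesis using cInf_lessD[OF ne] by blast
    qed
    then obtain e where e: "\<And>n. e n \<in> orth Y" "\<And>n. ip (e n) (e n) = 1"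
      "\<And>n. form (e n) (e n) < m + 1 / Suc n" by metis
    have "(\<lambda>n. form (e n) (e n)) \<longlonglongrightarrow> m"
    proof (rule tendsto_sandwich[OF _ _ tendsto_const])
      show "(\<lambda>n. m + 1 / Suc n) \<longlonglongrightarrow> m"
        using tendsto_add[OF tendsto_const LIMSEQ_inverse_real_of_nat, of m] by (simp add: inverse_eq_divide)
      show "\<forall>\<^sub>F n in sequentially. m \<le> form (e n) (e n)" using psd[OF e(1)] e(2) by simp
      show "\<forall>\<^sub>F n in sequentially. form (e n) (e n) \<le> m + 1 / Suc n"
        using e(3) by (simp add: less_imp_le)
    qed
    from minimizing_sequence_limit[OF Y psd e(1,2) this] show ?thesis .
  qed
  ultimately show ?thesis by (intro exI[of _ m]) auto
qed

end

section \<open>Linear algebra\<close>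

lemma vec_subspace_kernel:
  fixes S :: "('k::field^'m::finite) set"
  assumes "vec.subspace S" "\<And>v w. \<phi> (v + w) = \<phi> v + \<phi> w" "\<And>c v. \<phi> (c *s v) = c * \<phi> v"
  shows "vec.subspace {v \<in> S. \<phi> v = (0::'k)}"
proof -
  have "\<phi> 0 = 0" using assms(3)[of 0 0] by simp
  then show ?thesis
    using assms by (auto simp: vec.subspace_def)
qed

lemma vec_dim_kernel:
  fixes S :: "('k::field^'m::finite) set"
  assumes S: "vec.subspace S" and \<phi>: "\<And>v w. \<phi> (v + w) = \<phi> v + \<phi> w" "\<And>c v. \<phi> (c *s v) = c * \<phi> v"
  shows "vec.dim S \<le> vec.dim {v \<in> S. \<phi> v = (0::'k)} + 1"
proof (cases "\<exists>u\<in>S. \<phi> u \<noteq> 0")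
  case True
  then obtain u where u: "u \<in> S" "\<phi> u \<noteq> 0" by blast
  let ?K = "{v \<in> S. \<phi> v = 0}"
  have "S \<subseteq> vec.span (insert u ?K)"
  proof
    fix v assume v: "v \<in> S"
    define w where "w = v + (- (\<phi> v / \<phi> u)) *s u"
    have "w \<in> S" unfolding w_def using S u v
      by (intro vec.subspace_add vec.subspace_scale)
    moreover have "\<phi> w = 0" unfolding w_def \<phi> using u by simp
    ultimately have "w \<in> vec.span (insert u ?K)" by (intro vec.span_base) simp
    moreover have "u \<in> vec.span (insert u ?K)" by (intro vec.span_base) simp
    ultimately have "w + (\<phi> v / \<phi> u) *s u \<in> vec.span (insert u ?K)"
      by (intro vec.span_add vec.span_scale)
    moreover have "w + (\<phi> v / \<phi> u) *s u = v" by (simp add: w_def vec_eq_iff)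
    ultimately show "v \<in> vec.span (insert u ?K)" by simp
  qed
  then have "vec.dim S \<le> vec.dim (insert u ?K)"
    by (metis vec.dim_mono vec.dim_span)
  also have "\<dots> \<le> vec.dim ?K + 1" by (simp add: vec.dim_insert)
  finally show ?thesis .
next
  case False
  then have "{v \<in> S. \<phi> v = 0} = S" by auto
  then show ?thesis by simp
qed

text \<open>Each functional lowers the dimension by at most one. This will produce a solution
  satisfying all orthogonality conditions at once.\<close>

lemma vec_common_kernel:
  fixes S :: "('k::field^'m::finite) set" and \<phi> :: "'b \<Rightarrow> _"
  assumes "finite B" "vec.subspace S" "card B < vec.dim S"
    and \<phi>: "\<And>b v w. b \<in> B \<Longrightarrow> \<phi> b (v + w) = \<phi> b v + \<phi> b w" "\<And>b c v. b \<in> B \<Longrightarrow> \<phi> b (c *s v) = c * \<phi> b v"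
  shows "\<exists>v\<in>S. v \<noteq> 0 \<and> (\<forall>b\<in>B. \<phi> b v = (0::'k))"
  using assms
proof (induction B arbitrary: S)
  case empty
  then have "0 < vec.dim S" by simp
  then have "vec.dim S \<noteq> 0" by (rule gr_implies_not0)
  then have "\<not> S \<subseteq> {0}" unfolding vec.dim_eq_0 .
  then obtain v where "v \<in> S" "v \<noteq> 0" by auto
  then show ?case by auto
next
  case (insert b B)
  let ?K = "{v \<in> S. \<phi> b v = 0}"
  have K: "vec.subspace ?K"
    by (rule vec_subspace_kernel) (use insert.prems in auto)
  have "vec.dim S \<le> vec.dim ?K + 1"
    by (rule vec_dim_kernel) (use insert.prems in auto)
  then have "card B < vec.dim ?K" using insert by simp
  then have "\<exists>v\<in>?K. v \<noteq> 0 \<and> (\<forall>c\<in>B. \<phi> c v = 0)"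
    by (intro insert.IH K) (use insert.prems in auto)
  then show ?case by auto
qed

text \<open>Induction on the dimension: a vector on which the form is negative goes into
  \<open>X1\<close>, and the induction continues in its orthogonal complement with respect to
  \<open>h\<close>, so that no cross terms arise. Once no such vector is left, the whole remaining
  space serves as \<open>X2\<close>.\<close>

lemma hermitian_splitting:
  fixes S :: "(complex^'m::finite) set" and h :: "complex^'m \<Rightarrow> complex^'m \<Rightarrow> complex"
  assumes "vec.subspace S" "\<And>u v w. h (u + v) w = h u w + h v w" "\<And>c u w. h (c *s u) w = c * h u w"
    and "\<And>u v. h v u = cnj (h u v)"
  shows "\<exists>X1 X2. vec.subspace X1 \<and> vec.subspace X2 \<and> X1 \<subseteq> S \<and> X2 \<subseteq> S \<and>
    vec.dim S \<le> vec.dim X1 + vec.dim X2 \<and>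
    (\<forall>v\<in>X1. Re (h v v) \<le> 0) \<and> (\<forall>v\<in>X2. 0 \<le> Re (h v v))"
  using assms
proof (induction "vec.dim S" arbitrary: S rule: less_induct)
  case less
  note h_add = less.prems(2) and h_scale = less.prems(3) and h_cnj = less.prems(4)
  have h_add2: "h w (u + v) = h w u + h w v" for u v w
    by (subst (1 2 3) h_cnj) (simp add: h_add)
  have h_scale2: "h w (c *s u) = cnj c * h w u" for c u w
    by (subst (1 2) h_cnj) (simp add: h_scale)
  show ?case
  proof (cases "\<forall>v\<in>S. 0 \<le> Re (h v v)")
    case True
    have "h 0 0 = 0" using h_scale[of 0 0 0] by simp
    then show ?thesis using True less.prems(1)
      by (intro exI[of _ "{0}"] exI[of _ S]) (auto simp: vec.subspace_0)
  next
    case False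
    then obtain v where v: "v \<in> S" "Re (h v v) < 0" by force
    let ?K = "{u \<in> S. h u v = 0}"
    have K: "vec.subspace ?K"
      by (rule vec_subspace_kernel) (simp_all only: less.prems(1) h_add h_scale)
    have dK: "vec.dim S \<le> vec.dim ?K + 1"
      by (rule vec_dim_kernel) (simp_all only: less.prems(1) h_add h_scale)
    have vK: "v \<notin> ?K" using v by auto
    have "vec.dim ?K < vec.dim S"
    proof -
      have "v \<notin> vec.span ?K" using vK K by (simp add: vec.span_eq_iff[THEN iffD2])
      then have "vec.dim (insert v ?K) = vec.dim ?K + 1" by (simp add: vec.dim_insert)
      moreover have "vec.dim (insert v ?K) \<le> vec.dim S"
        using v(1) by (intro vec.dim_subset) auto
      ultimately show ?thesis by simp
    qed
    from less.hyps[OF this K h_add h_scale h_cnj] obtain X1 X2 where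
      X: "vec.subspace X1" "vec.subspace X2" "X1 \<subseteq> ?K" "X2 \<subseteq> ?K"
        "vec.dim ?K \<le> vec.dim X1 + vec.dim X2"
        "\<forall>v\<in>X1. Re (h v v) \<le> 0" "\<forall>v\<in>X2. 0 \<le> Re (h v v)" by blast
    have "v \<notin> vec.span X1"
      using X(1,3) vK by (auto simp: vec.span_eq_iff[THEN iffD2])
    then have d: "vec.dim (vec.span (insert v X1)) = vec.dim X1 + 1" by (simp add: vec.dim_insert)
    have "vec.span (insert v X1) \<subseteq> S"
      using v(1) X(3) less.prems(1) by (intro vec.span_minimal) auto
    moreover have "Re (h u u) \<le> 0" if u: "u \<in> vec.span (insert v X1)" for u
    proof -
      have "vec.span X1 = X1" using X(1) by (simp only: vec.span_eq_iff)
      moreover obtain c where "u - c *s v \<in> vec.span X1"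
        using u unfolding vec.span_insert by blast
      ultimately have c: "u - c *s v \<in> X1" by (simp only:)
      define y where "y = u - c *s v"
      have y: "y \<in> X1" "h y v = 0" "u = y + c *s v" using c X(3) by (auto simp: y_def)
      have "h v y = 0" using h_cnj[of y v] y(2) by simp
      then have "h u u = h y y + (c * cnj c) * h v v"
        using y(2) unfolding y(3) by (simp add: h_add h_add2 h_scale h_scale2)
      then have "Re (h u u) = Re (h y y) + (cmod c)\<^sup>2 * Re (h v v)"
        unfolding complex_norm_square[symmetric] by (simp flip: of_real_power)
      also have "\<dots> \<le> 0"
        using X(6) y(1) v(2) by (intro add_nonpos_nonpos mult_nonneg_nonpos) auto
      finally show ?thesis .
    qed
    ultimately show ?thesis
      using X dK d by (intro exI[of _ "vec.span (insert v X1)"] exI[of _ X2]) auto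
  qed
qed

lemma eigenvectors_sum_zero:
  fixes A :: "complex^'m::finite^'m"
  assumes "finite \<Lambda>" "\<And>l. l \<in> \<Lambda> \<Longrightarrow> A *v e l = l *s e l" "(\<Sum>l\<in>\<Lambda>. e l) = 0" "l \<in> \<Lambda>"
  shows "e l = 0"
  using assms
proof (induction \<Lambda> arbitrary: e l rule: finite_induct)
  case empty
  then show ?case by simp
next
  case (insert k \<Lambda>)
  \<comment> \<open>The components after applying \<open>A - k\<close>, which kills the component
    for \<open>k\<close> and rescales the others by nonzero factors.\<close>
  define f where "f l = (l - k) *s e l" for l
  have sum0: "e k + (\<Sum>l\<in>\<Lambda>. e l) = 0" using insert by simp
  have "A *v (\<Sum>l\<in>\<Lambda>. e l) = (\<Sum>l\<in>\<Lambda>. A *v e l)"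
    by (induction \<Lambda> rule: infinite_finite_induct) (simp_all add: matrix_vector_right_distrib)
  then have "A *v (e k + (\<Sum>l\<in>\<Lambda>. e l)) = k *s e k + (\<Sum>l\<in>\<Lambda>. l *s e l)"
    using insert.prems(1) by (simp add: matrix_vector_right_distrib)
  then have 1: "k *s e k + (\<Sum>l\<in>\<Lambda>. l *s e l) = 0" by (simp add: sum0)
  have "(\<Sum>l\<in>\<Lambda>. f l) = (k *s e k + (\<Sum>l\<in>\<Lambda>. l *s e l)) - k *s (e k + (\<Sum>l\<in>\<Lambda>. e l))"
    by (simp add: f_def vec.scale_left_diff_distrib sum_subtractf vec.scale_right_distrib vec.scale_sum_right)
  then have f0: "(\<Sum>l\<in>\<Lambda>. f l) = 0" by (simp add: 1 sum0)
  have ef: "A *v f l = l *s f l" if "l \<in> \<Lambda>" for l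
  proof -
    have "A *v e l = l *s e l" using insert.prems(1) that by simp
    then show ?thesis unfolding f_def vector_scalar_commute by (simp only: vec.scale_scale mult.commute)
  qed
  have e0: "e l = 0" if "l \<in> \<Lambda>" for l
  proof -
    have "f l = 0" using insert.IH[of f l] ef f0 that by blast
    then show ?thesis using that insert.hyps(2) by (auto simp: f_def)
  qed
  then have "(\<Sum>l\<in>\<Lambda>. e l) = 0" by (intro sum.neutral) blast
  then have "e k = 0" using sum0 by simp
  then show ?case using e0 insert.prems(3) by blast
qed

section \<open>The brake flow\<close>

lemma sum_UNIV_sum_type:
  fixes f :: "'a::finite + 'b::finite \<Rightarrow> 'c::comm_monoid_add"
  shows "(\<Sum>i\<in>UNIV. f i) = (\<Sum>i\<in>UNIV. f (Inl i)) + (\<Sum>i\<in>UNIV. f (Inr i))"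
  using sum.Plus[of "UNIV :: 'a set" "UNIV :: 'b set" f] by (simp add: o_def)

lemma block_mat_mult:
  "block_mat A B C D ** block_mat A' B' C' D'
    = block_mat (A ** A' + B ** C') (A ** B' + B ** D') (C ** A' + D ** C') (C ** B' + D ** D')"
  by (simp add: vec_eq_iff matrix_matrix_mult_def block_mat_def sum_UNIV_sum_type split: sum.split)

lemma transpose_block_mat:
  "transpose (block_mat A B C D) = block_mat (transpose A) (transpose C) (transpose B) (transpose D)"
  by (simp add: vec_eq_iff transpose_def block_mat_def split: sum.split)

lemma mat_eq_block_mat: "mat c = block_mat (mat c) 0 0 (mat c)"
  by (simp add: vec_eq_iff mat_def block_mat_def split: sum.split)

lemma uminus_block_mat: "- block_mat A B C D = block_mat (- A) (- B) (- C) (- D :: 'a::group_add^'n^'n)"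
  by (simp add: vec_eq_iff block_mat_def split: sum.split)

lemma matrix_mult_uminus [simp]:
  "(- A) ** B = - (A ** (B :: real^'n^'m))" "A ** (- B) = - (A ** B)"
  by (simp_all add: vec_eq_iff matrix_matrix_mult_def sum_negf)

lemma transpose_uminus: "transpose (- A) = - transpose (A :: real^'n^'m)"
  by (simp add: vec_eq_iff transpose_def)

lemma transpose_diff: "transpose (A - B) = transpose A - transpose (B :: real^'n^'m)"
  by (simp add: vec_eq_iff transpose_def)

lemma matrix_mult_0 [simp]: "0 ** B = (0 :: real^'n^'k)" "A ** 0 = (0 :: real^'n^'k)"
  for A :: "real^'m^'k" and B :: "real^'n^'m"
  by (simp_all add: vec_eq_iff matrix_matrix_mult_def)

lemma mat_0 [simp]: "mat 0 = (0 :: real^'n^'n)"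
  by (simp add: vec_eq_iff mat_def)

lemma bounded_bilinear_matrix_mult:
  "bounded_bilinear ((**) :: real^'n^'m \<Rightarrow> real^'k^'n \<Rightarrow> real^'k^'m)"
proof -
  have "bilinear ((**) :: real^'n^'m \<Rightarrow> real^'k^'n \<Rightarrow> real^'k^'m)"
    unfolding bilinear_def linear_iff
    by (auto simp: vec_eq_iff matrix_matrix_mult_def sum.distrib sum_distrib_left algebra_simps)
  then show ?thesis using bilinear_conv_bounded_bilinear by blast
qed

lemma pos_def_invertible:
  assumes "pos_def_mat A"
  shows "invertible A"
proof -
  have "w = 0" if "A *v w = 0" for w
    using assms that by (metis inner_zero_right less_irrefl pos_def_mat_def)
  then show ?thesis by (simp add: invertible_left_inverse matrix_left_invertible_ker)
qed

lemma matrix_inv_mult: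
  assumes "invertible (A :: real^'n^'n)"
  shows "A ** matrix_inv A = mat 1" "matrix_inv A ** A = mat 1"
  using someI_ex[OF assms[unfolded invertible_def]] by (simp_all add: matrix_inv_def)

lemma transpose_matrix_inv:
  assumes "invertible (A :: real^'n^'n)" "transpose A = A"
  shows "transpose (matrix_inv A) = matrix_inv A"
proof -
  have "transpose (matrix_inv A) ** A = mat 1"
    using arg_cong[OF matrix_inv_mult(1)[OF assms(1)], of transpose] assms(2)
    by (simp add: matrix_transpose_mul transpose_mat)
  then have "(transpose (matrix_inv A) ** A) ** matrix_inv A = matrix_inv A"
    by simp
  then show ?thesis
    by (simp add: matrix_mul_assoc[symmetric] matrix_inv_mult[OF assms(1)])
qed

section \<open>Symmetries of the linear Hamiltonian system\<close>

text \<open>Equal to \<open>N_mat ** J_mat\<close>, the symplectic matrix combined with the flip of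
  the momentum; unlike \<open>J_mat\<close> it is symmetric.\<close>

definition S_mat :: "real^('n::finite + 'n)^('n + 'n)" where
  "S_mat = block_mat 0 (mat 1) (mat 1) 0"

definition N_mat :: "real^('n::finite + 'n)^('n + 'n)" where
  "N_mat = block_mat (- mat 1) 0 0 (mat 1)"

locale brake_flow =
  fixes T :: real and P Q R :: "real \<Rightarrow> real^'n::finite^'n"
    and \<gamma> :: "real \<Rightarrow> real^('n + 'n)^('n + 'n)"
  assumes T_pos: "0 < T" and coeffs: "brake_coefficients T P Q R"
    and fundamental: "fundamental_solution P Q R \<gamma>"
begin

lemma P_sym: "transpose (P t) = P t" and Q_sym: "transpose (Q t) = Q t" and R_sym: "transpose (R t) = R t"
  and P_posdef: "pos_def_mat (P t)"
  and periodic: "P (t + T) = P t" "Q (t + T) = Q t" "R (t + T) = R t"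
  and parity: "P (- t) = P t" "Q (- t) = - Q t" "R (- t) = R t"
  and continuous_coeffs: "continuous_on UNIV P" "continuous_on UNIV Q" "continuous_on UNIV R"
  using coeffs by (auto simp: brake_coefficients_def pos_def_mat_def symmetric_mat_def)

lemma P_inv: "P t ** matrix_inv (P t) = mat 1" "matrix_inv (P t) ** P t = mat 1"
  "transpose (matrix_inv (P t)) = matrix_inv (P t)"
  using matrix_inv_mult transpose_matrix_inv pos_def_invertible[OF P_posdef] P_sym by blast+

definition A :: "real \<Rightarrow> real^('n + 'n)^('n + 'n)" where
  "A t = J_mat ** hamiltonian_mat (P t) (Q t) (R t)"

lemma A_eq: "A t = block_mat (Q t ** matrix_inv (P t)) (R t - Q t ** matrix_inv (P t) ** Q t)
    (matrix_inv (P t)) (- (matrix_inv (P t) ** Q t))"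
  by (simp add: A_def J_mat_def hamiltonian_mat_def block_mat_mult Q_sym)

lemma A_periodic: "A (t + T) = A t"
  by (simp add: A_def periodic)

lemma N_N: "N_mat ** N_mat = mat 1"
  by (simp add: N_mat_def block_mat_mult mat_eq_block_mat[of 1])

lemma S_S: "S_mat ** S_mat = mat 1"
  by (simp add: S_mat_def block_mat_mult mat_eq_block_mat[of 1])

lemma N_A_N: "N_mat ** A (- t) ** N_mat = - A t"
  by (simp add: N_mat_def A_eq block_mat_mult parity uminus_block_mat)

text \<open>Two relations in one: the Hamiltonian identity
  \<open>transpose (A t) ** J_mat = - (J_mat ** A t)\<close> and the reversal \<open>N_A_N\<close>,
  combined through S = N J.\<close>

lemma A_S: "transpose (A t) ** S_mat = S_mat ** A (- t)"
  by (simp add: S_mat_def A_eq transpose_block_mat block_mat_mult parity matrix_transpose_mul P_inv(3)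
      Q_sym R_sym transpose_uminus transpose_diff matrix_mul_assoc)

definition sol :: "(real \<Rightarrow> real^('n + 'n)^('n + 'n)) \<Rightarrow> bool" where
  "sol Z \<longleftrightarrow> (\<forall>t. (Z has_vector_derivative A t ** Z t) (at t))"

lemma sol_\<gamma>: "sol \<gamma>" and \<gamma>_0: "\<gamma> 0 = mat 1"
  using fundamental by (auto simp: fundamental_solution_def sol_def A_def)

lemma sol_reflect:
  assumes "sol Z"
  shows "((\<lambda>t. Z (- t)) has_vector_derivative - (A (- t) ** Z (- t))) (at t)"
proof -
  have "((Z \<circ> uminus) has_vector_derivative (- 1) *\<^sub>R (A (- t) ** Z (- t))) (at t)"
    using assms by (intro vector_diff_chain_at)
      (auto simp: sol_def has_real_derivative_iff_has_vector_derivative[symmetric] intro!: derivative_eq_intros)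
  then show ?thesis by (simp add: o_def)
qed

text \<open>A conserved quantity between one solution run backward and another run forward: by
  \<open>A_S\<close> the two contributions to its derivative cancel.\<close>

lemma sol_pairing:
  assumes "sol Y" "sol Z"
  shows "transpose (Y (- t)) ** S_mat ** Z t = transpose (Y 0) ** S_mat ** Z 0"
proof -
  have tr: "bounded_linear (transpose :: real^('n + 'n)^('n + 'n) \<Rightarrow> _)"
    by (simp add: linear_conv_bounded_linear[symmetric] linear_iff vec_eq_iff transpose_def)
  have d: "((\<lambda>t. transpose (Y (- t)) ** S_mat ** Z t) has_vector_derivative 0) (at t within UNIV)" for t
  proof -
    have 1: "((\<lambda>t. transpose (Y (- t))) has_vector_derivative transpose (- (A (- t) ** Y (- t)))) (at t)"
      using bounded_linear.has_vector_derivative[OF tr sol_reflect[OF assms(1)]] .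
    have 2: "((\<lambda>t. transpose (Y (- t)) ** S_mat) has_vector_derivative
        transpose (- (A (- t) ** Y (- t))) ** S_mat) (at t)"
      using bounded_bilinear.has_vector_derivative[OF bounded_bilinear_matrix_mult 1
        has_vector_derivative_const[of S_mat]] by simp
    have 3: "(Z has_vector_derivative A t ** Z t) (at t)" using assms(2) by (simp add: sol_def)
    have "((\<lambda>t. transpose (Y (- t)) ** S_mat ** Z t) has_vector_derivative
        transpose (Y (- t)) ** S_mat ** (A t ** Z t)
          + transpose (- (A (- t) ** Y (- t))) ** S_mat ** Z t) (at t)"
      using bounded_bilinear.has_vector_derivative[OF bounded_bilinear_matrix_mult 2 3] .
    moreover have "transpose (- (A (- t) ** Y (- t))) ** S_mat ** Z t
        = - (transpose (Y (- t)) ** (transpose (A (- t)) ** S_mat) ** Z t)"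
      by (simp add: transpose_uminus matrix_transpose_mul matrix_mul_assoc)
    ultimately show ?thesis by (simp add: A_S matrix_mul_assoc)
  qed
  obtain c where "\<And>t. t \<in> UNIV \<Longrightarrow> transpose (Y (- t)) ** S_mat ** Z t = c"
    by (rule has_vector_derivative_zero_constant[OF convex_UNIV d]) blast
  from this[of t] this[of 0] show ?thesis by simp
qed

lemma \<gamma>_pairing: "transpose (\<gamma> (- t)) ** S_mat ** \<gamma> t = S_mat"
  using sol_pairing[OF sol_\<gamma> sol_\<gamma>, of t] by (simp add: \<gamma>_0 transpose_mat)

text \<open>Uniqueness follows from the conserved pairing: \<open>?B\<close> is inverse to
  \<open>\<gamma> t ** S_mat\<close>, hence can be cancelled, and it takes the same value on both
  sides.\<close>

lemma sol_unique:
  assumes "sol Z"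
  shows "Z t = \<gamma> t ** Z 0"
proof -
  let ?B = "transpose (\<gamma> (- t)) ** S_mat"
  have "?B ** (\<gamma> t ** S_mat) = mat 1"
    using \<gamma>_pairing[of t] by (metis S_S matrix_mul_assoc)
  then have inv: "(\<gamma> t ** S_mat) ** ?B = mat 1" using matrix_left_right_inverse by blast
  have "?B ** Z t = ?B ** (\<gamma> t ** Z 0)"
    using sol_pairing[OF sol_\<gamma> assms, of t] \<gamma>_pairing[of t]
    by (simp add: \<gamma>_0 transpose_mat matrix_mul_assoc)
  then have "(\<gamma> t ** S_mat) ** (?B ** Z t) = (\<gamma> t ** S_mat) ** (?B ** (\<gamma> t ** Z 0))"
    by (rule arg_cong)
  moreover have "(\<gamma> t ** S_mat) ** (?B ** X) = X" for X :: "real^('n + 'n)^('n + 'n)"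
    by (simp only: matrix_mul_assoc[of "\<gamma> t ** S_mat" ?B X] inv matrix_mul_lid)
  ultimately show ?thesis by simp
qed

lemma \<gamma>_shift: "\<gamma> (t + T) = \<gamma> t ** \<gamma> T"
proof -
  have "sol (\<lambda>t. \<gamma> (t + T))"
    unfolding sol_def
  proof
    fix t
    have "((\<gamma> \<circ> (\<lambda>t. t + T)) has_vector_derivative 1 *\<^sub>R (A (t + T) ** \<gamma> (t + T))) (at t)"
      using sol_\<gamma> by (intro vector_diff_chain_at)
        (auto simp: sol_def has_real_derivative_iff_has_vector_derivative[symmetric] intro!: derivative_eq_intros)
    then show "((\<lambda>t. \<gamma> (t + T)) has_vector_derivative A t ** \<gamma> (t + T)) (at t)"
      by (simp add: o_def A_periodic)
  qed
  from sol_unique[OF this, of t] show ?thesis by simp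
qed

text \<open>By \<open>N_A_N\<close>, reversing time and conjugating by \<open>N_mat\<close> maps
  solutions to solutions. As \<open>\<gamma> (- T)\<close> is inverse to \<open>\<gamma> T\<close>,
  the case t = T is the brake symmetry of the monodromy.\<close>

lemma \<gamma>_reflect: "N_mat ** \<gamma> (- t) ** N_mat = \<gamma> t"
proof -
  have "sol (\<lambda>t. N_mat ** \<gamma> (- t) ** N_mat)"
    unfolding sol_def
  proof
    fix t
    have 1: "((\<lambda>t. N_mat ** \<gamma> (- t)) has_vector_derivative N_mat ** (- (A (- t) ** \<gamma> (- t)))) (at t)"
      using bounded_bilinear.has_vector_derivative[OF bounded_bilinear_matrix_mult
        has_vector_derivative_const[of N_mat] sol_reflect[OF sol_\<gamma>]] by simp
    have "((\<lambda>t. N_mat ** \<gamma> (- t) ** N_mat) has_vector_derivative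
        (N_mat ** (- (A (- t) ** \<gamma> (- t)))) ** N_mat) (at t)"
      using bounded_bilinear.has_vector_derivative[OF bounded_bilinear_matrix_mult 1
        has_vector_derivative_const[of N_mat]] by simp
    moreover have "(N_mat ** (- (A (- t) ** \<gamma> (- t)))) ** N_mat = A t ** (N_mat ** \<gamma> (- t) ** N_mat)"
    proof -
      have "A t ** (N_mat ** \<gamma> (- t) ** N_mat) = - ((N_mat ** A (- t) ** N_mat) ** (N_mat ** \<gamma> (- t) ** N_mat))"
        by (simp add: N_A_N)
      also have "\<dots> = - (N_mat ** A (- t) ** (N_mat ** N_mat) ** \<gamma> (- t) ** N_mat)"
        by (simp only: matrix_mul_assoc)
      finally show ?thesis by (simp add: N_N matrix_mul_assoc)
    qed
    ultimately show "((\<lambda>t. N_mat ** \<gamma> (- t) ** N_mat) has_vector_derivative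
        A t ** (N_mat ** \<gamma> (- t) ** N_mat)) (at t)" by simp
  qed
  from sol_unique[OF this, of t] show ?thesis by (simp add: \<gamma>_0 N_N)
qed

end

section \<open>The Hermitian pairing on positions and momenta\<close>

definition cdot :: "complex^'m::finite \<Rightarrow> complex^'m \<Rightarrow> complex" where
  "cdot u w = (\<Sum>i\<in>UNIV. u $ i * cnj (w $ i))"

lemma cdot_add: "cdot (u + v) w = cdot u w + cdot v w" "cdot w (u + v) = cdot w u + cdot w v"
  by (simp_all add: cdot_def algebra_simps sum.distrib)

lemma cdot_scale: "cdot (c *s u) w = c * cdot u w" "cdot u (c *s w) = cnj c * cdot u w"
  by (simp_all add: cdot_def sum_distrib_left algebra_simps)

lemma cdot_uminus: "cdot (- u) w = - cdot u w" "cdot u (- w) = - cdot u w"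
  by (simp_all add: cdot_def sum_negf)

lemma cdot_cnj: "cdot w u = cnj (cdot u w)"
  by (simp add: cdot_def mult.commute)

lemma cdot_eq_0_iff: "cdot u u = 0 \<longleftrightarrow> u = 0"
proof
  assume "cdot u u = 0"
  then have "complex_of_real (\<Sum>i\<in>UNIV. (cmod (u $ i))\<^sup>2) = 0"
    by (simp only: cdot_def complex_norm_square of_real_sum)
  then have "(\<Sum>i\<in>UNIV. (cmod (u $ i))\<^sup>2) = 0" by (simp only: of_real_eq_0_iff)
  then show "u = 0" by (simp add: sum_nonneg_eq_0_iff vec_eq_iff)
qed (simp add: cdot_def)

text \<open>Links the complex orthogonality used for counting dimensions to the real inner product
  of the Neumann problem.\<close>

lemma Re_cdot: "Re (cdot u w) = u \<bullet> w"
  by (simp add: cdot_def inner_vec_def inner_complex_def)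

lemma cdot_complexify: "cdot (complexify A *v u) w = cdot u (complexify (transpose A) *v w)"
  unfolding cdot_def complexify_def matrix_vector_mult_def transpose_def
  by (simp add: sum_distrib_left sum_distrib_right) (subst sum.swap, simp add: mult_ac)

lemma complexify_mult: "complexify (A ** B) = complexify A ** complexify B"
  by (simp add: complexify_def vec_eq_iff matrix_matrix_mult_def)

lemma complexify_mult_vec: "complexify (A ** B) *v w = complexify A *v (complexify B *v w)"
  by (simp add: complexify_mult matrix_vector_mul_assoc)

lemma complexify_mat_1: "complexify (mat 1) = mat 1"
  by (simp add: complexify_def vec_eq_iff mat_def)

lemma complexify_uminus: "complexify (- A) = - complexify A"
  and complexify_diff: "complexify (A - B) = complexify A - complexify B"
  by (simp_all add: complexify_def vec_eq_iff)

lemma uminus_mult_vec: "(- A) *v w = - ((A :: complex^'n^'m) *v w)"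
  by (simp add: vec_eq_iff matrix_vector_mult_def sum_negf)

definition top_part :: "complex^('n::finite + 'n) \<Rightarrow> complex^'n" where
  "top_part w = (\<chi> i. w $ Inl i)"

definition bot_part :: "complex^('n::finite + 'n) \<Rightarrow> complex^'n" where
  "bot_part w = (\<chi> i. w $ Inr i)"

lemma parts_eqI: "top_part v = top_part w \<Longrightarrow> bot_part v = bot_part w \<Longrightarrow> v = w"
  by (simp add: top_part_def bot_part_def vec_eq_iff) (metis sum.exhaust)

lemma parts_linear: "top_part (v + w) = top_part v + top_part w" "bot_part (v + w) = bot_part v + bot_part w"
  "top_part (c *s v) = c *s top_part v" "bot_part (c *s v) = c *s bot_part v"
  by (simp_all add: top_part_def bot_part_def vec_eq_iff)

lemma parts_0 [simp]: "top_part 0 = 0" "bot_part 0 = 0"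
  by (simp_all add: top_part_def bot_part_def vec_eq_iff)

lemma parts_block_mat:
  "top_part (complexify (block_mat A B C D) *v w)
    = complexify A *v top_part w + complexify B *v bot_part w"
  "bot_part (complexify (block_mat A B C D) *v w)
    = complexify C *v top_part w + complexify D *v bot_part w"
  by (simp_all add: top_part_def bot_part_def complexify_def block_mat_def vec_eq_iff
      matrix_vector_mult_def sum_UNIV_sum_type)

text \<open>The symplectic form of \<open>u\<close> and the conjugate of \<open>N w\<close>.\<close>

definition pairing :: "complex^('n::finite + 'n) \<Rightarrow> complex^('n + 'n) \<Rightarrow> complex" where
  "pairing u w = cdot u (complexify S_mat *v w)"

abbreviation flip :: "complex^('n::finite + 'n) \<Rightarrow> complex^('n + 'n)" where
  "flip w \<equiv> complexify N_mat *v w"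

lemma complexify_0 [simp]: "complexify 0 = 0"
  by (simp add: complexify_def vec_eq_iff)

lemma parts_flip: "top_part (flip w) = - top_part w" "bot_part (flip w) = bot_part w"
  by (simp_all add: N_mat_def parts_block_mat complexify_uminus complexify_mat_1 uminus_mult_vec)

lemma flip_flip: "flip (flip w) = w"
  by (intro parts_eqI) (simp_all add: parts_flip)

lemma pairing_eq: "pairing u w = cdot (top_part u) (bot_part w) + cdot (bot_part u) (top_part w)"
proof -
  let ?v = "complexify S_mat *v w"
  have "pairing u w = cdot (top_part u) (top_part ?v) + cdot (bot_part u) (bot_part ?v)"
    by (simp add: pairing_def cdot_def sum_UNIV_sum_type top_part_def bot_part_def)
  then show ?thesis by (simp add: S_mat_def parts_block_mat complexify_mat_1)
qed

lemma pairing_add: "pairing (u + v) w = pairing u w + pairing v w"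
  "pairing w (u + v) = pairing w u + pairing w v"
  by (simp_all add: pairing_eq parts_linear cdot_add)

lemma pairing_scale: "pairing (c *s u) w = c * pairing u w" "pairing u (c *s w) = cnj c * pairing u w"
  by (simp_all add: pairing_eq parts_linear cdot_scale algebra_simps)

lemma pairing_0 [simp]: "pairing 0 w = 0" "pairing u 0 = 0"
  by (simp_all add: pairing_eq cdot_def)

lemma pairing_cnj: "pairing w u = cnj (pairing u w)"
  unfolding pairing_eq cdot_cnj[of _ "top_part w"] cdot_cnj[of _ "bot_part w"] by simp

lemma pairing_flip: "pairing (flip u) (flip w) = - pairing u w"
  by (simp add: pairing_eq parts_flip cdot_uminus)

text \<open>The product of momentum and position is the boundary term left by integrating the action
  of a solution by parts, so the pairing at T/2 measures that action.\<close>

lemma Re_pairing_self: "Re (pairing w w) = 2 * (top_part w \<bullet> bot_part w)"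
  by (simp add: pairing_eq Re_cdot inner_commute)

lemma parts_S: "top_part (complexify S_mat *v w) = bot_part w" "bot_part (complexify S_mat *v w) = top_part w"
  by (simp_all add: S_mat_def parts_block_mat complexify_mat_1)

lemma pairing_nondegenerate:
  assumes "\<And>u. pairing u w = 0"
  shows "w = 0"
proof -
  let ?u = "complexify S_mat *v w"
  have "?u = 0" using assms[of ?u] by (simp only: pairing_def cdot_eq_0_iff)
  then have "bot_part w = 0" "top_part w = 0" using parts_S[of w] by simp_all
  then show ?thesis by (intro parts_eqI) simp_all
qed

section \<open>Eigenvectors of the monodromy in the upper half plane\<close>

context brake_flow
begin

abbreviation G :: "real \<Rightarrow> complex^('n + 'n)^('n + 'n)" where
  "G t \<equiv> complexify (\<gamma> t)"

lemma G_0: "G 0 *v w = w"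
  by (simp add: \<gamma>_0 complexify_mat_1)

lemma G_shift: "G (t + T) *v w = G t *v (G T *v w)"
  by (simp add: \<gamma>_shift complexify_mult_vec)

lemma G_flip: "flip (G (- t) *v w) = G t *v flip w"
proof -
  have "G t *v flip w = flip (G (- t) *v flip (flip w))"
    unfolding \<gamma>_reflect[of t, symmetric] complexify_mult_vec ..
  then show ?thesis by (simp only: flip_flip)
qed

lemma G_pairing: "pairing (G t *v u) (G (- t) *v w) = pairing u w"
proof -
  have "pairing (G t *v u) (G (- t) *v w)
      = cdot u (complexify (transpose (\<gamma> t) ** S_mat ** \<gamma> (- t)) *v w)"
    unfolding pairing_def cdot_complexify complexify_mult_vec ..
  then show ?thesis using \<gamma>_pairing[of "- t"] by (simp add: pairing_def)
qed

lemma G_inverse: "G (- T) *v (G T *v w) = w" "G T *v (G (- T) *v w) = w"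
proof -
  show 1: "G (- T) *v (G T *v w) = w" for w using G_shift[of "- T" w] by (simp add: G_0)
  have "G T *v (G (- T) *v w) = flip (flip (G T *v (G (- T) *v w)))" by (simp only: flip_flip)
  also have "\<dots> = flip (G (- T) *v (G T *v flip w))"
    using G_flip[of "- T" "G (- T) *v w"] G_flip[of T w] by simp
  also have "\<dots> = w" by (simp only: 1 flip_flip)
  finally show "G T *v (G (- T) *v w) = w" .
qed

definition E :: "(complex^('n + 'n)) set" where
  "E = vec.span (\<Union>z \<in> mat_spectrum (G T) \<inter> {z. Im z > 0}. mat_kernel (G T - mat z))"

lemma mat_kernel_iff: "w \<in> mat_kernel (A - mat z) \<longleftrightarrow> A *v w = z *s w" for A :: "complex^'m::finite^'m"
proof -
  have "mat z *v w = z *s w"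
    by (simp add: vec_eq_iff matrix_vector_mult_def mat_def if_distrib[of "\<lambda>x. x * _"] cong: if_cong)
  then show ?thesis by (simp add: mat_kernel_def matrix_vector_mult_diff_rdistrib)
qed

lemma E_induct:
  assumes "v \<in> E" "vec.subspace U" "\<And>z w. Im z > 0 \<Longrightarrow> G T *v w = z *s w \<Longrightarrow> w \<in> E \<Longrightarrow> w \<in> U"
  shows "v \<in> U"
proof -
  have "E \<subseteq> U"
    unfolding E_def
  proof (rule vec.span_minimal[OF _ assms(2)], rule subsetI)
    fix w assume w: "w \<in> (\<Union>z \<in> mat_spectrum (G T) \<inter> {z. Im z > 0}. mat_kernel (G T - mat z))"
    then have "w \<in> E" unfolding E_def by (rule vec.span_base)
    then show "w \<in> U" using w assms(3) by (auto simp: mat_kernel_iff)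
  qed
  then show ?thesis using assms(1) by blast
qed

lemma subspace_E: "vec.subspace E"
  by (simp add: E_def)

lemma eigenvector_inverse:
  assumes "G T *v w = z *s w" "z \<noteq> 0"
  shows "G (- T) *v w = (1 / z) *s w"
proof -
  have "w = G (- T) *v (z *s w)" using G_inverse(1)[of w] assms by simp
  then have "w = z *s (G (- T) *v w)" by (simp add: vector_scalar_commute)
  then have "(1 / z) *s w = (1 / z) *s (z *s (G (- T) *v w))" by simp
  then show ?thesis using assms(2) by simp
qed

lemma E_invariant:
  assumes "v \<in> E"
  shows "G T *v v \<in> E" "G (- T) *v v \<in> E"
proof -
  have sub: "vec.subspace {v. X *v v \<in> E}" for X :: "complex^('n + 'n)^('n + 'n)"
    using subspace_E unfolding vec.subspace_def
    by (simp add: matrix_vector_right_distrib vector_scalar_commute)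
  have "v \<in> {v. G T *v v \<in> E}"
    by (rule E_induct[OF assms sub]) (simp add: vec.subspace_scale[OF subspace_E])
  then show "G T *v v \<in> E" by simp
  have "v \<in> {v. G (- T) *v v \<in> E}"
  proof (rule E_induct[OF assms sub])
    fix z w assume "0 < Im z" "G T *v w = z *s w" "w \<in> E"
    moreover from this have "z \<noteq> 0" by auto
    ultimately show "w \<in> {v. G (- T) *v v \<in> E}"
      using eigenvector_inverse[of w z] by (simp add: vec.subspace_scale[OF subspace_E])
  qed
  then show "G (- T) *v v \<in> E" by simp
qed

text \<open>The pairing is preserved when \<open>G T\<close> acts on one side and its inverse on the
  other. On eigenvectors for z and y this multiplies it by \<open>z / cnj y\<close>, which is 1 only
  if \<open>z = cnj y\<close>; having both eigenvalues in the upper half plane excludes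
  that.\<close>

lemma E_isotropic:
  assumes "v \<in> E" "w \<in> E"
  shows "pairing v w = 0"
proof -
  have gen: "pairing v w = 0" if v: "0 < Im z" "G T *v v = z *s v" and w: "0 < Im y" "G T *v w = y *s w"
    for v w z y
  proof -
    have nz: "y \<noteq> 0" using w(1) by auto
    have "pairing v w = pairing (z *s v) ((1 / y) *s w)"
      using G_pairing[of T v w] v(2) eigenvector_inverse[OF w(2) nz] by simp
    also have "\<dots> = z / cnj y * pairing v w" by (simp add: pairing_scale)
    finally have "cnj y * pairing v w = z * pairing v w" using nz by (simp add: field_simps)
    then have "z = cnj y \<or> pairing v w = 0" by auto
    moreover have "z \<noteq> cnj y" using v(1) w(1) by (metis cnj.simps(2) less_asym neg_0_less_iff_less)
    ultimately show ?thesis by simp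
  qed
  have sub1: "vec.subspace {v. pairing v w = 0}" for w
    by (simp add: vec.subspace_def pairing_add pairing_scale)
  have sub2: "vec.subspace {w. pairing v w = 0}" for v
    by (simp add: vec.subspace_def pairing_add pairing_scale)
  have 1: "pairing v w = 0" if "0 < Im z" "G T *v v = z *s v" for v z
  proof -
    have "w \<in> {w. pairing v w = 0}"
      by (rule E_induct[OF assms(2) sub2]) (use gen that in blast)
    then show ?thesis by simp
  qed
  have "v \<in> {v. pairing v w = 0}"
    by (rule E_induct[OF assms(1) sub1]) (use 1 in blast)
  then show ?thesis by simp
qed

text \<open>Expanding the sum leaves \<open>pairing p p\<close> and \<open>pairing q q\<close>, which are pairings of \<open>v\<close> with
  \<open>G T *v v\<close> and with \<open>G (- T) *v v\<close>.\<close>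

lemma boundary_form_opposite:
  assumes "v \<in> E"
  defines "p \<equiv> G (T / 2) *v v" and "q \<equiv> G (T / 2) *v flip v"
  shows "pairing (p + q) (p + q) + pairing (p - q) (p - q) = 0"
proof -
  \<comment> \<open>\<open>G_pairing\<close> wants opposite times on the two sides; periodicity
    trades half a period forward for half a period backward and one monodromy.\<close>
  have h: "G (T / 2) *v w = G (- (T / 2)) *v (G T *v w)" for w
    using G_shift[of "- (T / 2)" w] by simp
  have "pairing p p = pairing v (G T *v v)"
    unfolding p_def using G_pairing[of "T / 2" v "G T *v v"] h[of v] by simp
  then have pp: "pairing p p = 0" using E_isotropic[OF assms(1) E_invariant(1)[OF assms(1)]] by simp
  have h': "G (- (T / 2)) *v v = G (T / 2) *v (G (- T) *v v)"
    using h[of "G (- T) *v v"] by (simp add: G_inverse)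
  have "pairing q q = - pairing (G (- (T / 2)) *v v) (G (- (T / 2)) *v v)"
    unfolding q_def G_flip[of "T / 2" v, symmetric] pairing_flip ..
  also have "\<dots> = - pairing (G (- (T / 2)) *v v) (G (T / 2) *v (G (- T) *v v))"
    by (simp only: h'[symmetric])
  also have "\<dots> = - pairing v (G (- T) *v v)"
    using G_pairing[of "- (T / 2)" v "G (- T) *v v"] by simp
  finally have qq: "pairing q q = 0"
    using E_isotropic[OF assms(1) E_invariant(2)[OF assms(1)]] by simp
  have d: "p - q = p + (- 1) *s q" by (simp add: vec_eq_iff)
  show ?thesis unfolding d pairing_add pairing_scale by (simp add: pp qq)
qed

text \<open>The components are defined for every complex number and vanish off
  \<open>\<Lambda>\<close>, so sums can be extended to larger index sets at will.\<close>

lemma E_decomposition: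
  assumes "v \<in> E"
  obtains \<Lambda> e where "finite \<Lambda>" "\<And>l. l \<in> \<Lambda> \<Longrightarrow> 0 < Im l" "\<And>l. G T *v e l = l *s e l"
    "\<And>l. l \<notin> \<Lambda> \<Longrightarrow> e l = 0" "v = (\<Sum>l\<in>\<Lambda>. e l)"
proof -
  define dec where "dec v \<Lambda> e \<longleftrightarrow> finite \<Lambda> \<and> (\<forall>l\<in>\<Lambda>. 0 < Im l) \<and> (\<forall>l. G T *v e l = l *s e l) \<and>
    (\<forall>l. l \<notin> \<Lambda> \<longrightarrow> e l = 0) \<and> v = (\<Sum>l\<in>\<Lambda>. e l)" for v \<Lambda> and e :: "complex \<Rightarrow> complex^('n + 'n)"
  have "vec.subspace {v. \<exists>\<Lambda> e. dec v \<Lambda> e}"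
    unfolding vec.subspace_def
  proof (intro conjI ballI allI)
    have "dec 0 {} (\<lambda>_. 0)" by (simp add: dec_def)
    then show "0 \<in> {v. \<exists>\<Lambda> e. dec v \<Lambda> e}" by blast
  next
    fix x y assume "x \<in> {v. \<exists>\<Lambda> e. dec v \<Lambda> e}" "y \<in> {v. \<exists>\<Lambda> e. dec v \<Lambda> e}"
    then obtain L e K f where e: "dec x L e" and f: "dec y K f" by blast
    have "x = (\<Sum>l\<in>L \<union> K. e l)" "y = (\<Sum>l\<in>L \<union> K. f l)"
      using e f by (auto simp: dec_def intro!: sum.mono_neutral_left)
    then have "dec (x + y) (L \<union> K) (\<lambda>l. e l + f l)"
      using e f by (auto simp: dec_def matrix_vector_right_distrib vec.scale_right_distrib sum.distrib)
    then show "x + y \<in> {v. \<exists>\<Lambda> e. dec v \<Lambda> e}" by blast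
  next
    fix c x assume "x \<in> {v. \<exists>\<Lambda> e. dec v \<Lambda> e}"
    then obtain L e where "dec x L e" by blast
    then have "dec (c *s x) L (\<lambda>l. c *s e l)"
      by (simp add: dec_def vector_scalar_commute mult.commute vec.scale_sum_right)
    then show "c *s x \<in> {v. \<exists>\<Lambda> e. dec v \<Lambda> e}" by blast
  qed
  then have "v \<in> {v. \<exists>\<Lambda> e. dec v \<Lambda> e}"
  proof (rule E_induct[OF assms])
    fix z w assume "0 < Im z" "G T *v w = z *s w"
    then have "dec w {z} (\<lambda>l. if l = z then w else 0)" by (simp add: dec_def)
    then show "w \<in> {v. \<exists>\<Lambda> e. dec v \<Lambda> e}" by blast
  qed
  then show ?thesis using that unfolding dec_def by blast
qed

text \<open>The flip turns an eigenvector for z into one for 1/z, which lies in the lower half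
  plane. So the components of \<open>v\<close>, those of \<open>flip v\<close> and the fixed vector
  belong to different eigenvalues, and independence makes each of them vanish.\<close>

lemma E_no_fixed_point:
  assumes v: "v \<in> E" and fixed: "G T *v (v + s *s flip v) = v + s *s flip v"
  shows "v = 0"
proof -
  obtain \<Lambda> e where e: "finite \<Lambda>" "\<And>l. l \<in> \<Lambda> \<Longrightarrow> 0 < Im l" "\<And>l. G T *v e l = l *s e l"
    "\<And>l. l \<notin> \<Lambda> \<Longrightarrow> e l = 0" "v = (\<Sum>l\<in>\<Lambda>. e l)"
    by (rule E_decomposition[OF v]) blast
  define w where "w = v + s *s flip v"
  \<comment> \<open>The component for \<open>l\<close> of \<open>v + s *s flip v - w\<close>, which
    is 0; the fixed vector \<open>w\<close> enters at the eigenvalue 1.\<close>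
  define f where "f l = e l + s *s flip (e (inverse l)) - (if l = 1 then w else 0)" for l
  let ?L = "insert 1 (\<Lambda> \<union> inverse ` \<Lambda>)"
  have fin: "finite ?L" using e(1) by simp
  have eig: "G T *v f l = l *s f l" for l
  proof -
    have "G T *v flip (e (inverse l)) = flip (G (- T) *v e (inverse l))"
      by (simp only: G_flip)
    also have "\<dots> = l *s flip (e (inverse l))"
    proof (cases "inverse l \<in> \<Lambda>")
      case True
      then have "inverse l \<noteq> 0" using e(2) by force
      then show ?thesis
        using eigenvector_inverse[OF e(3), of "inverse l"] by (simp add: vector_scalar_commute divide_inverse)
    qed (simp add: e(4))
    finally have 1: "G T *v flip (e (inverse l)) = l *s flip (e (inverse l))" .
    show ?thesis
      unfolding f_def using e(3)[of l] 1 fixed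
      by (auto simp: w_def matrix_vector_right_distrib matrix_vector_mult_diff_distrib vector_scalar_commute
          vec.scale_right_distrib vec.scale_right_diff_distrib mult.commute)
  qed
  have s1: "(\<Sum>l\<in>?L. e l) = v"
    unfolding e(5) using fin e(4) by (intro sum.mono_neutral_right) auto
  have s2: "(\<Sum>l\<in>?L. flip (e (inverse l))) = flip v"
  proof -
    have "(\<Sum>l\<in>?L. flip (e (inverse l))) = (\<Sum>l\<in>inverse ` \<Lambda>. flip (e (inverse l)))"
    proof (intro sum.mono_neutral_right[OF fin] ballI)
      fix l assume l: "l \<in> ?L - inverse ` \<Lambda>"
      have "inverse l \<notin> \<Lambda>"
      proof
        assume "inverse l \<in> \<Lambda>"
        then have "inverse (inverse l) \<in> inverse ` \<Lambda>" by (rule imageI)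
        then show False using l by simp
      qed
      then show "flip (e (inverse l)) = 0" using e(4) by simp
    qed auto
    also have "\<dots> = (\<Sum>l\<in>\<Lambda>. flip (e l))"
    proof -
      have inj: "inj_on inverse \<Lambda>" by (rule inj_onI) simp
      show ?thesis unfolding sum.reindex[OF inj] o_def inverse_inverse_eq ..
    qed
    also have "\<dots> = flip (\<Sum>l\<in>\<Lambda>. e l)"
      by (induction \<Lambda> rule: infinite_finite_induct) (simp_all add: matrix_vector_right_distrib)
    finally show ?thesis by (simp add: e(5))
  qed
  have s3: "(\<Sum>l\<in>?L. if l = 1 then w else 0) = w"
    using fin by (simp add: sum.delta)
  have "(\<Sum>l\<in>?L. f l) = (\<Sum>l\<in>?L. e l) + s *s (\<Sum>l\<in>?L. flip (e (inverse l))) - (\<Sum>l\<in>?L. if l = 1 then w else 0)"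
    unfolding f_def by (simp only: sum_subtractf sum.distrib vec.scale_sum_right)
  then have "(\<Sum>l\<in>?L. f l) = 0" unfolding s1 s2 s3 by (simp add: w_def)
  then have f0: "f l = 0" if "l \<in> ?L" for l
    using eigenvectors_sum_zero[OF fin eig _ that] by blast
  have "e l = 0" if l: "l \<in> \<Lambda>" for l
  proof -
    have "Im (inverse l) < 0" using e(2)[OF l] by (simp add: Im_divide sum_power2_gt_zero_iff divide_neg_pos)
    then have "e (inverse l) = 0" using e(2,4) by force
    moreover have "l \<noteq> 1" using e(2)[OF l] by auto
    ultimately show ?thesis using f0[of l] l by (simp add: f_def)
  qed
  then show ?thesis by (simp add: e(5))
qed

text \<open>Such a solution is symmetric about \<open>0\<close> and about \<open>T / 2\<close>.\<close>

lemma neumann_solution_periodic: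
  assumes "top_part w = 0" "top_part (G (T / 2) *v w) = 0"
  shows "G T *v w = w"
proof -
  have "flip w = w" using assms(1) by (intro parts_eqI) (simp_all add: parts_flip)
  moreover have "flip (G (T / 2) *v w) = G (T / 2) *v w"
    using assms(2) by (intro parts_eqI) (simp_all add: parts_flip)
  ultimately have "G (- (T / 2)) *v w = G (T / 2) *v w"
    using G_flip[of "- (T / 2)" w] by simp
  then have eq: "G (- (T / 2)) *v (w - G T *v w) = 0"
    using G_shift[of "- (T / 2)" w] by (simp add: matrix_vector_mult_diff_distrib)
  \<comment> \<open>Cancels \<open>G (- (T / 2))\<close>: its kernel pairs to 0 with everything, and
    the pairing is nondegenerate.\<close>
  have "pairing u (w - G T *v w) = 0" for u
    using G_pairing[of "T / 2" u "w - G T *v w"] eq by simp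
  then have "w - G T *v w = 0" by (rule pairing_nondegenerate)
  then show ?thesis by simp
qed

end

section \<open>Solutions as curves on the half period\<close>

lemma bounded_linear_complexify_apply: "bounded_linear (\<lambda>A. complexify A *v w)"
proof -
  have "linear (\<lambda>A. complexify A *v w)"
    by (simp add: linear_iff complexify_def vec_eq_iff matrix_vector_mult_def sum.distrib
        algebra_simps scaleR_conv_of_real[where 'a = complex] sum_distrib_left)
  then show ?thesis by (simp add: linear_conv_bounded_linear)
qed

lemma bounded_linear_parts: "bounded_linear top_part" "bounded_linear bot_part"
proof -
  have "linear (top_part :: complex^('n::finite + 'n) \<Rightarrow> _)" "linear (bot_part :: complex^('n::finite + 'n) \<Rightarrow> _)"
    by (simp_all add: linear_iff top_part_def bot_part_def vec_eq_iff)
  then show "bounded_linear (top_part :: complex^('n::finite + 'n) \<Rightarrow> _)"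
    "bounded_linear (bot_part :: complex^('n::finite + 'n) \<Rightarrow> _)"
    by (simp_all add: linear_conv_bounded_linear)
qed

lemma continuous_complexify_apply:
  assumes "continuous_on S A"
  shows "continuous_on S (\<lambda>t. complexify (A t) *v w)"
  using continuous_on_compose2[OF linear_continuous_on[OF bounded_linear_complexify_apply, of UNIV w] assms]
  by simp

lemma complexify_symmetric:
  assumes "transpose A = A"
  shows "(complexify A *v v) \<bullet> w = v \<bullet> (complexify A *v w)"
  using cdot_complexify[of A v w] assms by (simp flip: Re_cdot)

text \<open>As the matrix is real, the quadratic form is the sum of its values at the real and
  imaginary parts.\<close>

lemma complexify_positive:
  assumes "pos_def_mat A" "w \<noteq> 0"
  shows "0 < w \<bullet> (complexify A *v w)"
proof -
  define x y where "x = (\<chi> i. Re (w $ i))" and "y = (\<chi> i. Im (w $ i))"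
  have "w \<bullet> (complexify A *v w) = x \<bullet> (A *v x) + y \<bullet> (A *v y)"
    by (simp add: inner_vec_def inner_complex_def x_def y_def complexify_def matrix_vector_mult_def
        sum.distrib)
  moreover have "x \<noteq> 0 \<or> y \<noteq> 0"
    using assms(2) by (auto simp: x_def y_def vec_eq_iff complex_eq_iff)
  moreover have "0 \<le> v \<bullet> (A *v v)" "v \<noteq> 0 \<Longrightarrow> 0 < v \<bullet> (A *v v)" for v
    using assms(1) by (cases "v = 0"; simp add: pos_def_mat_def less_imp_le)+
  ultimately show ?thesis by (metis add_nonneg_pos add_pos_nonneg)
qed

context brake_flow
begin

lemma neumann_problem_on:
  assumes "0 < a"
  shows "neumann_problem a (\<lambda>t. (*v) (complexify (P t))) (\<lambda>t. (*v) (complexify (Q t)))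
    (\<lambda>t. (*v) (complexify (R t)))"
proof (unfold neumann_problem_def, intro conjI allI impI)
  show "0 < a" by (rule assms)
  show "linear ((*v) (complexify (P t)))" "linear ((*v) (complexify (Q t)))"
    "linear ((*v) (complexify (R t)))" for t
    by (simp_all add: bounded_linear.linear)
  show "continuous_on {0..a} (\<lambda>t. complexify (P t) *v w)" "continuous_on {0..a} (\<lambda>t. complexify (Q t) *v w)"
    "continuous_on {0..a} (\<lambda>t. complexify (R t) *v w)" for w
    by (intro continuous_complexify_apply continuous_on_subset[OF continuous_coeffs(1)]
      continuous_on_subset[OF continuous_coeffs(2)] continuous_on_subset[OF continuous_coeffs(3)], simp)+
  show "(complexify (P t) *v v) \<bullet> w = v \<bullet> (complexify (P t) *v w)"
    "(complexify (Q t) *v v) \<bullet> w = v \<bullet> (complexify (Q t) *v w)"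
    "(complexify (R t) *v v) \<bullet> w = v \<bullet> (complexify (R t) *v w)" for t v w
    by (simp_all add: complexify_symmetric P_sym Q_sym R_sym)
  show "0 < w \<bullet> (complexify (P t) *v w)" if "w \<noteq> 0" for t w
    using P_posdef that by (rule complexify_positive)
qed

sublocale neu: neumann_problem "T / 2" "\<lambda>t. (*v) (complexify (P t))" "\<lambda>t. (*v) (complexify (Q t))"
    "\<lambda>t. (*v) (complexify (R t))"
  by (rule neumann_problem_on) (use T_pos in simp)

lemma P_inj: "complexify (P t) *v v = complexify (P t) *v w \<Longrightarrow> v = w"
  by (metis P_inv(2) complexify_mat_1 complexify_mult_vec matrix_vector_mul_lid)

abbreviation \<xi> :: "complex^('n + 'n) \<Rightarrow> real \<Rightarrow> complex^'n" where
  "\<xi> w t \<equiv> bot_part (G t *v w)"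

abbreviation \<eta> :: "complex^('n + 'n) \<Rightarrow> real \<Rightarrow> complex^'n" where
  "\<eta> w t \<equiv> top_part (G t *v w)"

text \<open>Hamilton's equations: \<open>h\<close> is the velocity, recovered from the momentum by
  inverting \<eta> = P h + Q \<xi>.\<close>

lemma flow_derivative:
  defines "h \<equiv> \<lambda>w t. complexify (matrix_inv (P t)) *v (\<eta> w t - complexify (Q t) *v \<xi> w t)"
  shows "(\<xi> w has_vector_derivative h w t) (at t)"
    "(\<eta> w has_vector_derivative complexify (Q t) *v h w t + complexify (R t) *v \<xi> w t) (at t)"
proof -
  have "((\<lambda>t. G t *v w) has_vector_derivative complexify (A t ** \<gamma> t) *v w) (at t)"
    by (rule bounded_linear.has_vector_derivative[OF bounded_linear_complexify_apply])
      (use sol_\<gamma> in \<open>simp add: sol_def\<close>)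
  then have d: "((\<lambda>t. G t *v w) has_vector_derivative complexify (A t) *v (G t *v w)) (at t)"
    by (simp add: complexify_mult_vec)
  have "bot_part (complexify (A t) *v (G t *v w)) = h w t"
    by (simp add: A_eq parts_block_mat h_def complexify_uminus uminus_mult_vec complexify_mult_vec
        matrix_vector_mult_diff_distrib)
  then show "(\<xi> w has_vector_derivative h w t) (at t)"
    using bounded_linear.has_vector_derivative[OF bounded_linear_parts(2) d] by simp
  have "top_part (complexify (A t) *v (G t *v w))
      = complexify (Q t) *v h w t + complexify (R t) *v \<xi> w t"
    by (simp add: A_eq parts_block_mat h_def complexify_diff matrix_vector_mult_diff_rdistrib
        complexify_mult_vec matrix_vector_mult_diff_distrib algebra_simps)
  then show "(\<eta> w has_vector_derivative complexify (Q t) *v h w t + complexify (R t) *v \<xi> w t) (at t)"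
    using bounded_linear.has_vector_derivative[OF bounded_linear_parts(1) d] by simp
qed

lemma flow_curve:
  obtains e where "\<And>t. t \<in> {0..T / 2} \<Longrightarrow> pos e t = \<xi> w t" "\<And>t. t \<in> {0..T / 2} \<Longrightarrow> neu.mom e t = \<eta> w t"
    "\<And>t. t \<in> {0..T / 2} \<Longrightarrow> (\<xi> w has_vector_derivative vel e t) (at t)"
    "\<And>t. t \<in> {0..T / 2} \<Longrightarrow> (\<eta> w has_vector_derivative neu.frc e t) (at t)"
proof -
  let ?h = "\<lambda>t. complexify (matrix_inv (P t)) *v (\<eta> w t - complexify (Q t) *v \<xi> w t)"
  have Ph: "complexify (P t) *v ?h t = \<eta> w t - complexify (Q t) *v \<xi> w t" for t
    by (simp add: P_inv complexify_mat_1 flip: complexify_mult_vec)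
  have c: "continuous_on {0..T / 2} (\<xi> w)" "continuous_on {0..T / 2} (\<eta> w)"
    by (intro continuous_at_imp_continuous_on ballI has_vector_derivative_continuous[OF flow_derivative(1)]
      has_vector_derivative_continuous[OF flow_derivative(2)])+
  have cV: "continuous_on {0..T / 2} (\<lambda>t. \<eta> w t - complexify (Q t) *v \<xi> w t)"
    by (intro continuous_intros neu.continuous_apply c)
  \<comment> \<open>The velocity \<open>?h\<close> is explicit, and its continuity is obtained by
    identifying it, through injectivity of \<open>P\<close>, with the continuous function from
    \<open>P_solve\<close>.\<close>
  obtain h where h: "continuous_on {0..T / 2} h"
    "\<And>t. t \<in> {0..T / 2} \<Longrightarrow> complexify (P t) *v h t = \<eta> w t - complexify (Q t) *v \<xi> w t"
    by (rule neu.P_solve[OF cV]) blast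
  have hh: "h t = ?h t" if "t \<in> {0..T / 2}" for t
    by (rule P_inj[of t]) (simp only: h(2)[OF that] Ph)
  obtain e where e: "fst e = \<xi> w 0" "\<And>t. t \<in> {0..T / 2} \<Longrightarrow> vel e t = h t"
    by (rule curve_exists[OF h(1), of "\<xi> w 0"]) blast
  have pe: "pos e t = \<xi> w t" if "t \<in> {0..T / 2}" for t
  proof (rule pos_eqI[of "T / 2" "\<xi> w" h])
    show "(\<xi> w has_vector_derivative h t) (at t within {0..T / 2})" if t: "t \<in> {0..T / 2}" for t
      unfolding hh[OF t] by (rule has_vector_derivative_at_within[OF flow_derivative(1)])
  qed (use e that in auto)
  show ?thesis
  proof (rule that[OF pe])
    fix t assume t: "t \<in> {0..T / 2}"
    show "neu.mom e t = \<eta> w t"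
      using h(2)[OF t] by (simp add: neu.mom_def e(2)[OF t] pe[OF t])
    show "(\<xi> w has_vector_derivative vel e t) (at t)"
      using flow_derivative(1)[of w t] by (simp add: e(2)[OF t] hh[OF t])
    show "(\<eta> w has_vector_derivative neu.frc e t) (at t)"
      using flow_derivative(2)[of w t] by (simp add: neu.frc_def e(2)[OF t] hh[OF t] pe[OF t])
  qed
qed

text \<open>Integrating the action by parts leaves momentum times position at both ends. At 0 one
  factor vanishes, the momentum for s = 1 and the position for s = -1, so only T/2
  contributes.\<close>

lemma flow_curve_form:
  assumes "v \<in> E" "v \<noteq> 0" "s = 1 \<or> s = - 1"
  defines "w \<equiv> v + s *s flip v"
  obtains e where "\<And>t. t \<in> {0..T / 2} \<Longrightarrow> pos e t = \<xi> w t" "\<not> neu.eigen 0 e"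
    "2 * neu.form e e = Re (pairing (G (T / 2) *v w) (G (T / 2) *v w))"
proof -
  obtain e where e: "\<And>t. t \<in> {0..T / 2} \<Longrightarrow> pos e t = \<xi> w t" "\<And>t. t \<in> {0..T / 2} \<Longrightarrow> neu.mom e t = \<eta> w t"
    "\<And>t. t \<in> {0..T / 2} \<Longrightarrow> (\<xi> w has_vector_derivative vel e t) (at t)"
    "\<And>t. t \<in> {0..T / 2} \<Longrightarrow> (\<eta> w has_vector_derivative neu.frc e t) (at t)"
    by (rule flow_curve) blast
  have a: "0 < T / 2" using T_pos by simp
  have "((\<lambda>t. \<eta> w t \<bullet> \<xi> w t) has_vector_derivative \<eta> w t \<bullet> vel e t + neu.frc e t \<bullet> \<xi> w t)
      (at t within {0..T / 2})" if t: "t \<in> {0..T / 2}" for t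
    using bounded_bilinear.has_vector_derivative[OF bounded_bilinear_inner e(4)[OF t] e(3)[OF t]]
    by (rule has_vector_derivative_at_within)
  then have "((\<lambda>t. \<eta> w t \<bullet> vel e t + neu.frc e t \<bullet> \<xi> w t) has_integral
      \<eta> w (T / 2) \<bullet> \<xi> w (T / 2) - \<eta> w 0 \<bullet> \<xi> w 0) {0..T / 2}"
    using a by (intro fundamental_theorem_of_calculus) auto
  moreover have "neu.form e e = integral {0..T / 2} (\<lambda>t. \<eta> w t \<bullet> vel e t + neu.frc e t \<bullet> \<xi> w t)"
    unfolding neu.form_def by (intro integral_cong) (simp add: e(1,2))
  moreover have "\<eta> w 0 \<bullet> \<xi> w 0 = 0"
    using assms(3) by (auto simp: G_0 w_def parts_linear parts_flip)
  ultimately have "2 * neu.form e e = Re (pairing (G (T / 2) *v w) (G (T / 2) *v w))"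
    by (simp add: integral_unique Re_pairing_self)
  moreover have "\<not> neu.eigen 0 e"
  proof
    assume eig: "neu.eigen 0 e"
    \<comment> \<open>At t = 0 the integral in \<open>eigen\<close> is over a single point, so the
      initial momentum vanishes for either sign.\<close>
    then have "neu.mom e 0 = 0" "neu.mom e (T / 2) = 0"
      using a by (auto simp: neu.eigen_def)
    then have "top_part w = 0" "\<eta> w (T / 2) = 0" using a e(2)[of 0] e(2)[of "T / 2"] by (auto simp: G_0)
    then have "G T *v w = w" by (rule neumann_solution_periodic)
    then have "v = 0" unfolding w_def by (rule E_no_fixed_point[OF assms(1)])
    then show False using assms(2) by simp
  qed
  ultimately show ?thesis using that e(1) by blast
qed

end

section \<open>Periodic eigenfunctions\<close>

lemma AE_lborel_negligible:
  assumes "AE t in lborel. p t"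
  obtains S where "negligible S" "\<And>t :: real. t \<notin> S \<Longrightarrow> p t"
proof -
  obtain S where S: "{x \<in> space lborel. \<not> p x} \<subseteq> S" "S \<in> null_sets lborel"
    using assms unfolding eventually_ae_filter by blast
  have "negligible S"
    unfolding negligible_iff_null_sets using S(2) by (rule null_sets_completionI)
  then show ?thesis using that S(1) by auto
qed

text \<open>On a bounded interval x \<le> 1 + x^2 provides an integrable bound.\<close>

lemma L2_on_integrable:
  assumes "L2_on T g"
  shows "set_integrable lborel {0..T} g"
  unfolding set_integrable_def
proof (rule Bochner_Integration.integrable_bound)
  let ?b = "\<lambda>t. indicator {0..T} t *\<^sub>R (1::real) + indicator {0..T} t *\<^sub>R (norm (g t))\<^sup>2"
  have "integrable lborel (indicator {0..T} :: real \<Rightarrow> real)"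
    by (rule integrable_real_indicator) (auto simp: emeasure_lborel_Icc_eq)
  then show "integrable lborel ?b"
    using assms by (intro Bochner_Integration.integrable_add) (simp_all add: L2_on_def set_integrable_def)
  show "(\<lambda>t. indicator {0..T} t *\<^sub>R g t) \<in> borel_measurable lborel"
    using assms by (simp add: L2_on_def set_borel_measurable_def)
  have "x \<le> 1 + x\<^sup>2" for x :: real
    using zero_le_power2[of "x - 1/2"] by (simp add: power2_eq_square algebra_simps)
  then show "AE t in lborel. norm (indicator {0..T} t *\<^sub>R g t) \<le> norm (?b t)"
    by (intro AE_I2) (auto simp: indicator_def)
qed

lemma W12_integral:
  assumes "W12 T u g" "t \<in> {0..T}"
  shows "g integrable_on {0..t}" "u t = u 0 + integral {0..t} g"
proof -
  have int: "set_integrable lborel {0..t} g"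
    using assms by (intro set_integrable_subset[OF L2_on_integrable, of T]) (auto simp: W12_def)
  show "g integrable_on {0..t}" by (rule set_borel_integral_eq_integral(1)[OF int])
  show "u t = u 0 + integral {0..t} g"
    unfolding set_borel_integral_eq_integral(2)[OF int, symmetric]
    using assms unfolding W12_def by blast
qed

lemma W12_continuous:
  assumes "W12 T u g"
  shows "continuous_on {0..T} u"
proof (cases "0 \<le> T")
  case True
  have "continuous_on {0..T} (\<lambda>t. u 0 + integral {0..t} g)"
    using W12_integral(1)[OF assms] True
    by (intro continuous_intros indefinite_integral_continuous_1) auto
  then show ?thesis by (rule continuous_on_eq) (rule W12_integral(2)[OF assms, symmetric])
qed simp

text \<open>Changing the weak derivative on a null set does not affect its integral, so
  \<open>u\<close> is an indefinite integral of the continuous function \<open>h\<close>.\<close>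

lemma W12_has_vector_derivative:
  assumes W: "W12 T u g" and h: "continuous_on {0..T} h"
    and S: "negligible S" "\<And>t. t \<in> {0..T} \<Longrightarrow> t \<notin> S \<Longrightarrow> g t = h t" and t: "t \<in> {0..T}"
  shows "(u has_vector_derivative h t) (at t within {0..T})"
proof (rule has_vector_derivative_transform[OF t])
  show "u s = u 0 + integral {0..s} h" if "s \<in> {0..T}" for s
    unfolding W12_integral(2)[OF W that]
    using S that by (intro arg_cong[where f = "(+) _"] integral_spike[OF S(1)]) auto
  show "((\<lambda>s. u 0 + integral {0..s} h) has_vector_derivative h t) (at t within {0..T})"
    using integral_has_vector_derivative[OF h t] by (auto intro!: derivative_eq_intros)
qed

lemma mult_uminus_vec: "A *v (- w) = - ((A :: complex^'n^'m) *v w)"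
  by (simp add: vec_eq_iff matrix_vector_mult_def sum_negf)

lemma scale_of_real: "complex_of_real m *s v = m *\<^sub>R v"
  by (simp add: vec_eq_iff scaleR_conv_of_real[where 'a = complex])

lemma has_vector_derivative_reflect:
  assumes "(u has_vector_derivative d) (at (T - t) within S)" "(\<lambda>t. T - t) ` S' \<subseteq> S"
  shows "((\<lambda>t. u (T - t)) has_vector_derivative - d) (at t within S')"
proof -
  have "((\<lambda>t. T - t) has_vector_derivative - 1) (at t within S')"
    by (auto intro!: derivative_eq_intros simp flip: has_real_derivative_iff_has_vector_derivative)
  from vector_diff_chain_within[OF this has_vector_derivative_within_subset[OF assms]]
  show ?thesis by (simp add: o_def)
qed

lemma pos_has_vector_derivative_at:
  assumes "0 < t"
  shows "(pos e has_vector_derivative vel e t) (at t)"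
proof -
  have "(pos e has_vector_derivative vel e t) (at t within {0..t + 1})"
    using assms by (intro has_vector_derivative_pos) simp
  then show ?thesis using assms by (simp add: at_within_interior[of t "{0..t + 1}"])
qed

text \<open>Applied with \<sigma> = 1 to positions and \<sigma> = -1 to momenta. The gluing
  hypothesis is continuity at T/2: automatic in the even case, a zero value in the odd one.\<close>

lemma W12_reflect:
  fixes e :: "(complex^'n::finite) curve"
  assumes T: "0 < T" and glue: "pos e (T / 2) = \<sigma> *\<^sub>R pos e (T / 2)"
  shows "W12 T (\<lambda>t. if t \<le> T / 2 then pos e t else \<sigma> *\<^sub>R pos e (T - t))
    (\<lambda>t. if t \<le> T / 2 then vel e t else - (\<sigma> *\<^sub>R vel e (T - t)))"
proof -
  let ?u = "\<lambda>t. if t \<le> T / 2 then pos e t else \<sigma> *\<^sub>R pos e (T - t)"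
  let ?d = "\<lambda>t. if t \<le> T / 2 then vel e t else - (\<sigma> *\<^sub>R vel e (T - t))"
  have c: "continuous_on UNIV (vel e)" "continuous_on UNIV (\<lambda>t. vel e (T - t))"
    by (intro continuous_intros continuous_on_compose2[OF continuous_vel[of UNIV]], auto)+
  have meas: "?d \<in> borel_measurable borel"
    using borel_measurable_continuous_onI[OF c(1)] borel_measurable_continuous_onI[OF c(2)]
    by measurable
  obtain B where B: "\<And>t. norm (vel e t) \<le> B"
    using bounded_apply_bcontfun[of "snd e"] by (auto simp: bounded_iff vel_def)
  have "norm (?d t) \<le> (1 + \<bar>\<sigma>\<bar>) * B" for t
  proof -
    have "0 \<le> B" using order_trans[OF norm_ge_zero B] .
    moreover from this have "0 \<le> \<bar>\<sigma>\<bar> * B" by simp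
    moreover have "\<bar>\<sigma>\<bar> * norm (vel e (T - t)) \<le> \<bar>\<sigma>\<bar> * B" by (intro mult_left_mono B) simp
    moreover have "norm (?d t) \<le> max (norm (vel e t)) (\<bar>\<sigma>\<bar> * norm (vel e (T - t)))" by auto
    ultimately show ?thesis using B[of t] unfolding distrib_right by linarith
  qed
  then have bound: "norm (?d t) \<le> (1 + \<bar>\<sigma>\<bar>) * B" for t .
  have int: "set_integrable lborel {0..t} ?d" for t
    unfolding set_integrable_def using meas bound
    by (intro integrableI_bounded_set_indicator[where B = "(1 + \<bar>\<sigma>\<bar>) * B"]) (auto simp: emeasure_lborel_Icc_eq)
  have L2: "L2_on T ?d"
    unfolding L2_on_def
  proof
    show "set_borel_measurable lborel {0..T} ?d"
      using meas unfolding set_borel_measurable_def by measurable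
    have "norm ((norm (?d t))\<^sup>2) \<le> ((1 + \<bar>\<sigma>\<bar>) * B)\<^sup>2" for t
      using power_mono[OF bound[of t] norm_ge_zero, of 2] by simp
    moreover have "(\<lambda>t. (norm (?d t))\<^sup>2) \<in> borel_measurable lborel" using meas by measurable
    ultimately show "set_integrable lborel {0..T} (\<lambda>t. (norm (?d t))\<^sup>2)"
      unfolding set_integrable_def
      by (intro integrableI_bounded_set_indicator[where B = "((1 + \<bar>\<sigma>\<bar>) * B)\<^sup>2"]) (auto simp: emeasure_lborel_Icc_eq)
  qed
  have cont: "continuous_on {0..t} ?u" if "t \<le> T" for t
  proof (rule continuous_on_cases_le)
    show "continuous_on {x \<in> {0..t}. x \<le> T / 2} (pos e)"
      by (rule continuous_on_subset[OF continuous_pos[of t]]) auto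
    show "continuous_on {x \<in> {0..t}. T / 2 \<le> x} (\<lambda>x. \<sigma> *\<^sub>R pos e (T - x))"
      using that by (intro continuous_intros continuous_on_compose2[OF continuous_pos[of T e]]) auto
    have mid: "T - T / 2 = T / 2" by simp
    show "pos e s = \<sigma> *\<^sub>R pos e (T - s)" if "s = T / 2" for s
      unfolding that mid by (rule glue)
  qed (auto intro: continuous_intros)
  have deriv: "(?u has_vector_derivative ?d s) (at s)" if s: "0 < s" "s < T" "s \<noteq> T / 2" for s
  proof (cases "s < T / 2")
    case True
    have "(pos e has_vector_derivative ?d s) (at s)"
      using pos_has_vector_derivative_at[OF s(1), of e] True by simp
    then show ?thesis
      by (rule has_vector_derivative_transform_within_open[of _ _ _ "{..<T / 2}"]) (use True in auto)
  next
    case False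
    then have gt: "s > T / 2" using s(3) by simp
    have "((\<lambda>t. pos e (T - t)) has_vector_derivative - vel e (T - s)) (at s within UNIV)"
      using s(2) pos_has_vector_derivative_at[of "T - s" e] by (intro has_vector_derivative_reflect) auto
    from bounded_linear.has_vector_derivative[OF bounded_linear_scaleR_right this, of \<sigma>]
    have "((\<lambda>t. \<sigma> *\<^sub>R pos e (T - t)) has_vector_derivative ?d s) (at s)"
      using gt by simp
    then show ?thesis
      by (rule has_vector_derivative_transform_within_open[of _ _ _ "{T / 2<..}"]) (use gt in auto)
  qed
  have "?u t = ?u 0 + set_lebesgue_integral lborel {0..t} ?d" if t: "t \<in> {0..T}" for t
  proof -
    have "(?d has_integral ?u t - ?u 0) {0..t}"
      \<comment> \<open>T/2 is an exceptional point, since the one-sided derivatives may differ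
        there.\<close>
      using t by (intro fundamental_theorem_of_calculus_interior_strong[of "{T / 2}"] cont deriv) auto
    then show ?thesis
      using set_borel_integral_eq_integral(2)[OF int] by (simp add: integral_unique)
  qed
  then show ?thesis using L2 unfolding W12_def by blast
qed

section \<open>Passage between periodic and Neumann eigenfunctions\<close>

context brake_flow
begin

lemma coeffs_reflect: "P (T - t) = P t" "Q (T - t) = - Q t" "R (T - t) = R t"
  using periodic[of "- t"] parity[of t] by simp_all

text \<open>Bootstrapping: \<open>b\<close> and \<open>y\<close> are continuous, so solving the
  momentum relation for the velocity gives a continuous \<open>h\<close>. It equals the weak
  derivative almost everywhere, hence \<open>b\<close> is C^1, and the equation then makes
  \<open>y\<close> C^1 as well.\<close>

lemma eigenspace_regular:
  assumes "b \<in> eigenspace T P Q R \<mu>"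
  obtains h y where "\<And>t. t \<in> {0..T} \<Longrightarrow> (b has_vector_derivative h t) (at t within {0..T})"
    "\<And>t. t \<in> {0..T} \<Longrightarrow> (y has_vector_derivative
      complexify (Q t) *v h t + complexify (R t) *v b t - \<mu> *\<^sub>R b t) (at t within {0..T})"
    "\<And>t. t \<in> {0..T} \<Longrightarrow> y t = complexify (P t) *v h t + complexify (Q t) *v b t"
    "continuous_on {0..T} h" "b 0 = b T" "y 0 = y T"
proof -
  interpret full: neumann_problem T "\<lambda>t. (*v) (complexify (P t))" "\<lambda>t. (*v) (complexify (Q t))"
    "\<lambda>t. (*v) (complexify (R t))"
    by (rule neumann_problem_on[OF T_pos])
  obtain b' y y' where W: "W12 T b b'" "W12 T y y'"
    and ae: "AE t in lborel. t \<in> {0..T} \<longrightarrow> y t = complexify (P t) *v b' t + complexify (Q t) *v b t"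
      "AE t in lborel. t \<in> {0..T} \<longrightarrow> fun_scale (complex_of_real \<mu>) b t
        = - y' t + complexify (transpose (Q t)) *v b' t + complexify (R t) *v b t"
    and bc: "b 0 = b T" "y 0 = y T"
    using assms unfolding eigenspace_def periodic_operator_def by blast
  obtain S1 where S1: "negligible S1" "\<And>t. t \<notin> S1 \<Longrightarrow>
      t \<in> {0..T} \<longrightarrow> y t = complexify (P t) *v b' t + complexify (Q t) *v b t"
    by (rule AE_lborel_negligible[OF ae(1)]) blast
  obtain S2 where S2: "negligible S2" "\<And>t. t \<notin> S2 \<Longrightarrow> t \<in> {0..T} \<longrightarrow> fun_scale (complex_of_real \<mu>) b t
        = - y' t + complexify (transpose (Q t)) *v b' t + complexify (R t) *v b t"
    by (rule AE_lborel_negligible[OF ae(2)]) blast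
  have cb: "continuous_on {0..T} b" and cy: "continuous_on {0..T} y"
    using W by (simp_all add: W12_continuous)
  have cV: "continuous_on {0..T} (\<lambda>t. y t - complexify (Q t) *v b t)"
    by (intro continuous_intros full.continuous_apply cb cy)
  obtain h where h: "continuous_on {0..T} h"
    "\<And>t. t \<in> {0..T} \<Longrightarrow> complexify (P t) *v h t = y t - complexify (Q t) *v b t"
    by (rule full.P_solve[OF cV]) blast
  have b'h: "b' t = h t" if "t \<in> {0..T}" "t \<notin> S1" for t
    by (rule P_inj[of t]) (use S1(2)[OF that(2)] that(1) h(2) in simp)
  have y'h: "y' t = complexify (Q t) *v h t + complexify (R t) *v b t - \<mu> *\<^sub>R b t"
    if "t \<in> {0..T}" "t \<notin> S1 \<union> S2" for t
    using S2(2)[of t] that b'h[of t] by (simp add: fun_scale_def scale_of_real Q_sym algebra_simps)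
  show ?thesis
  proof (rule that)
    show "(b has_vector_derivative h t) (at t within {0..T})" if "t \<in> {0..T}" for t
      by (rule W12_has_vector_derivative[OF W(1) h(1) S1(1) b'h that])
    show "(y has_vector_derivative complexify (Q t) *v h t + complexify (R t) *v b t - \<mu> *\<^sub>R b t)
        (at t within {0..T})" if "t \<in> {0..T}" for t
      by (rule W12_has_vector_derivative[OF W(2) _ negligible_Un[OF S1(1) S2(1)] y'h that])
        (intro continuous_intros full.continuous_apply cb h(1))
    show "y t = complexify (P t) *v h t + complexify (Q t) *v b t" if "t \<in> {0..T}" for t
      using h(2)[OF that] by simp
  qed (use h(1) bc in auto)
qed

text \<open>Under the reflection of t to T - t, \<open>P\<close> and \<open>R\<close> are invariant
  and \<open>Q\<close> changes sign, so symmetrizing \<open>b\<close> preserves the equation. The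
  momentum becomes \<open>y t - y (T - t)\<close>, which vanishes at T/2, and at 0 by
  periodicity.\<close>

lemma eigenspace_even_part:
  assumes "b \<in> eigenspace T P Q R \<mu>"
  obtains e where "\<And>t. t \<in> {0..T / 2} \<Longrightarrow> pos e t = b t + b (T - t)" "neu.eigen \<mu> e"
proof -
  obtain h y where b: "\<And>t. t \<in> {0..T} \<Longrightarrow> (b has_vector_derivative h t) (at t within {0..T})"
    and y: "\<And>t. t \<in> {0..T} \<Longrightarrow> (y has_vector_derivative
      complexify (Q t) *v h t + complexify (R t) *v b t - \<mu> *\<^sub>R b t) (at t within {0..T})"
    and yeq: "\<And>t. t \<in> {0..T} \<Longrightarrow> y t = complexify (P t) *v h t + complexify (Q t) *v b t"
    and ch: "continuous_on {0..T} h" and bc: "b 0 = b T" "y 0 = y T"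
    by (rule eigenspace_regular[OF assms]) blast
  have sub: "{0..T / 2} \<subseteq> {0..T}" "(\<lambda>t. T - t) ` {0..T / 2} \<subseteq> {0..T}" using T_pos by auto
  have ch2: "continuous_on {0..T / 2} (\<lambda>t. h t - h (T - t))"
    using sub by (intro continuous_intros continuous_on_subset[OF ch] continuous_on_compose2[OF ch])
  obtain e where e: "fst e = b 0 + b T" "\<And>t. t \<in> {0..T / 2} \<Longrightarrow> vel e t = h t - h (T - t)"
    by (rule curve_exists[OF ch2, of "b 0 + b T"]) blast
  have pe: "pos e t = b t + b (T - t)" if t: "t \<in> {0..T / 2}" for t
  proof (rule pos_eqI[of "T / 2" "\<lambda>t. b t + b (T - t)" "\<lambda>t. h t - h (T - t)"])
    fix s assume s: "s \<in> {0..T / 2}"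
    have d2: "(b has_vector_derivative h s) (at s within {0..T / 2})"
      using s sub by (intro has_vector_derivative_within_subset[OF b]) auto
    have "((\<lambda>t. b (T - t)) has_vector_derivative - h (T - s)) (at s within {0..T / 2})"
      using s by (intro has_vector_derivative_reflect[OF b sub(2)]) auto
    from has_vector_derivative_add[OF d2 this]
    show "((\<lambda>t. b t + b (T - t)) has_vector_derivative h s - h (T - s)) (at s within {0..T / 2})"
      by (simp only: add_uminus_conv_diff)
  qed (use e t in auto)
  have me: "neu.mom e t = y t - y (T - t)" if t: "t \<in> {0..T / 2}" for t
  proof -
    have "t \<in> {0..T}" "T - t \<in> {0..T}" using t by auto
    then show ?thesis
      by (simp add: neu.mom_def pe[OF t] e(2)[OF t] yeq coeffs_reflect complexify_uminus uminus_mult_vec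
          matrix_vector_mult_diff_distrib matrix_vector_right_distrib)
  qed
  have fe: "neu.frc e t - \<mu> *\<^sub>R pos e t
      = (complexify (Q t) *v h t + complexify (R t) *v b t - \<mu> *\<^sub>R b t)
        + (complexify (Q (T - t)) *v h (T - t) + complexify (R (T - t)) *v b (T - t) - \<mu> *\<^sub>R b (T - t))"
    if t: "t \<in> {0..T / 2}" for t
    by (simp add: neu.frc_def pe[OF t] e(2)[OF t] coeffs_reflect complexify_uminus uminus_mult_vec
        matrix_vector_mult_diff_distrib matrix_vector_right_distrib scaleR_add_right)
  have "neu.eigen \<mu> e"
    unfolding neu.eigen_def
  proof (intro conjI ballI)
    show "neu.mom e (T / 2) = 0" using T_pos by (subst me) auto
    fix t assume t: "t \<in> {0..T / 2}"
    have "((\<lambda>s. neu.frc e s - \<mu> *\<^sub>R pos e s) has_integral (y t - y (T - t)) - (y 0 - y (T - 0))) {0..t}"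
    proof (rule fundamental_theorem_of_calculus)
      fix s assume s: "s \<in> {0..t}"
      then have s': "s \<in> {0..T / 2}" "s \<in> {0..T}" "T - s \<in> {0..T}" using t by auto
      have d2: "(y has_vector_derivative
          complexify (Q s) *v h s + complexify (R s) *v b s - \<mu> *\<^sub>R b s) (at s within {0..t})"
        using t by (intro has_vector_derivative_within_subset[OF y[OF s'(2)]]) auto
      have "((\<lambda>t. y (T - t)) has_vector_derivative - (complexify (Q (T - s)) *v h (T - s)
          + complexify (R (T - s)) *v b (T - s) - \<mu> *\<^sub>R b (T - s))) (at s within {0..t})"
        using t by (intro has_vector_derivative_reflect[OF y[OF s'(3)]]) auto
      from has_vector_derivative_diff[OF d2 this]
      show "((\<lambda>t. y t - y (T - t)) has_vector_derivative neu.frc e s - \<mu> *\<^sub>R pos e s) (at s within {0..t})"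
        by (simp only: fe[OF s'(1)] diff_minus_eq_add)
    qed (use t in auto)
    then show "neu.mom e t = integral {0..t} (\<lambda>s. neu.frc e s - \<mu> *\<^sub>R pos e s)"
      using me[OF t] bc by (simp add: integral_unique)
  qed
  then show ?thesis using that pe by blast
qed

text \<open>The position is continued evenly about T/2 and the momentum oddly. The Neumann
  conditions let the momentum glue at T/2 and give it the value 0 at both 0 and T.\<close>

lemma eigen_even_extension:
  assumes "neu.eigen m g"
  obtains b where "b \<in> eigenspace T P Q R m"
    "\<And>t. t \<in> {0..T / 2} \<Longrightarrow> b t = pos g t" "\<And>t. t \<in> {0..T / 2} \<Longrightarrow> b (T - t) = pos g t"
proof -
  \<comment> \<open>The momentum written as the position of a curve, so that
    \<open>W12_reflect\<close> applies to it too.\<close>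
  define W where "W = neu.prim m g"
  have mom: "neu.mom g t = pos W t" if "t \<in> {0..T / 2}" for t
    using assms that by (simp add: neu.eigen_def W_def neu.pos_prim)
  have vW: "vel W t = neu.frc g t - m *\<^sub>R pos g t" if "t \<in> {0..T / 2}" for t
    unfolding W_def by (rule neu.prim(2)[OF that])
  have Wa: "pos W (T / 2) = 0" using mom[of "T / 2"] assms T_pos by (simp add: neu.eigen_def)
  define b where "b t = (if t \<in> {0..T} then if t \<le> T / 2 then pos g t else pos g (T - t) else 0)" for t
  define b' where "b' t = (if t \<le> T / 2 then vel g t else - vel g (T - t))" for t
  define y where "y t = (if t \<le> T / 2 then pos W t else (- 1) *\<^sub>R pos W (T - t))" for t
  define y' where "y' t = (if t \<le> T / 2 then vel W t else - ((- 1) *\<^sub>R vel W (T - t)))" for t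
  have "W12 T (\<lambda>t. if t \<le> T / 2 then pos g t else pos g (T - t)) b'"
    using W12_reflect[OF T_pos, of g 1] unfolding b'_def[abs_def] scaleR_one by blast
  then have "W12 T b b'" using T_pos by (simp add: W12_def b_def)
  moreover have "W12 T y y'"
    unfolding y_def[abs_def] y'_def[abs_def] by (rule W12_reflect[OF T_pos]) (simp add: Wa)
  moreover have eqs: "y t = complexify (P t) *v b' t + complexify (Q t) *v b t"
    "fun_scale (complex_of_real m) b t
      = - y' t + complexify (transpose (Q t)) *v b' t + complexify (R t) *v b t" if t: "t \<in> {0..T}" for t
  proof -
    have "y t = complexify (P t) *v b' t + complexify (Q t) *v b t \<and>
      fun_scale (complex_of_real m) b t
      = - y' t + complexify (transpose (Q t)) *v b' t + complexify (R t) *v b t"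
    proof (cases "t \<le> T / 2")
      case True
      then have "t \<in> {0..T / 2}" using t by simp
      then show ?thesis
        using mom[of t] vW[of t] True t
        by (simp add: y_def y'_def b_def b'_def neu.mom_def neu.frc_def fun_scale_def scale_of_real Q_sym)
    next
      case False
      define s where "s = T - t"
      have s: "s \<in> {0..T / 2}" using False t by (simp add: s_def)
      have "P t = P s" "Q t = - Q s" "R t = R s" using coeffs_reflect[of t] by (simp_all add: s_def)
      then show ?thesis
        using mom[OF s, symmetric] vW[OF s] False t
        by (simp add: y_def y'_def b_def b'_def neu.mom_def neu.frc_def fun_scale_def scale_of_real Q_sym
            s_def[symmetric] complexify_uminus uminus_mult_vec transpose_uminus mult_uminus_vec)
    qed
    then show "y t = complexify (P t) *v b' t + complexify (Q t) *v b t"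
      "fun_scale (complex_of_real m) b t
      = - y' t + complexify (transpose (Q t)) *v b' t + complexify (R t) *v b t" by blast+
  qed
  moreover have "b 0 = b T" "y 0 = y T"
    using T_pos by (simp_all add: b_def y_def W_def neu.prim)
  ultimately have "b \<in> eigenspace T P Q R m"
    unfolding eigenspace_def periodic_operator_def mem_Collect_eq
    by (intro conjI exI[of _ b'] exI[of _ y] exI[of _ y'] AE_I2 impI eqs) (auto simp: b_def)
  moreover have "b t = pos g t" "b (T - t) = pos g t" if "t \<in> {0..T / 2}" for t
  proof -
    show "b t = pos g t" using that by (simp add: b_def)
    show "b (T - t) = pos g t"
    proof (cases "t = T / 2")
      case False
      then show ?thesis using that by (auto simp: b_def)
    next
      case True
      then have e: "T - t = t" by simp
      show ?thesis unfolding e by (rule \<open>b t = pos g t\<close>)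
    qed
  qed
  ultimately show ?thesis using that by blast
qed

end

section \<open>The Morse index bound\<close>

text \<open>A finite supremum in \<open>enat\<close> forces the set to be finite, so it is a
  maximum. This turns the index into a concrete finite set of eigenvalues and each multiplicity into
  a concrete basis.\<close>

lemma Sup_enat_attained:
  assumes "Sup A = enat k" "A \<noteq> {}"
  shows "enat k \<in> A"
proof -
  have "finite A" using assms by (auto simp: Sup_enat_def split: if_splits)
  moreover from this have "Sup A = Max A" using assms(2) by (simp add: Sup_enat_def)
  ultimately show ?thesis using Max_in[of A] assms by simp
qed

lemma cfun_dim_ge:
  assumes "finite B" "B \<subseteq> V" "cfun.independent B"
  shows "enat (card B) \<le> cfun_dim V"
  unfolding cfun_dim_def using assms by (intro SUP_upper) simp

lemma cfun_basis_exists: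
  assumes "cfun_dim V = enat d"
  obtains B where "finite B" "B \<subseteq> V" "card B = d" "V \<subseteq> cfun.span B"
proof -
  have "enat d \<in> (\<lambda>B. enat (card B)) ` {B. finite B \<and> B \<subseteq> V \<and> cfun.independent B}"
    using assms unfolding cfun_dim_def
    by (rule Sup_enat_attained) (auto intro!: exI[of _ "{}"] simp: cfun.independent_empty)
  then obtain B where B: "finite B" "B \<subseteq> V" "cfun.independent B" "card B = d" by auto
  have "v \<in> cfun.span B" if v: "v \<in> V" for v
  proof (rule ccontr)
    assume n: "v \<notin> cfun.span B"
    then have "v \<notin> B" using cfun.span_base by blast
    then have "enat (d + 1) \<le> cfun_dim V"
      using cfun_dim_ge[of "insert v B" V] B v n by (simp add: cfun.independent_insert)
    then show False using assms by simp
  qed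
  then show ?thesis using that B by blast
qed

lemma sum_fun_apply: "(\<Sum>b\<in>B. f b) t = (\<Sum>b\<in>B. f b t)" for f :: "'b \<Rightarrow> 'c \<Rightarrow> 'd::comm_monoid_add"
  by (induction B rule: infinite_finite_induct) (simp_all add: zero_fun_def plus_fun_def)

lemma pos_sum: "pos (\<Sum>i\<in>I. e i) t = (\<Sum>i\<in>I. pos (e i) t)"
proof (induction I rule: infinite_finite_induct)
  case (insert i I)
  then show ?case by simp
qed (simp_all add: pos_def vel_def zero_bcontfun.rep_eq)

lemma bounded_linear_scale_ii: "bounded_linear (\<lambda>v :: complex^'n::finite. \<i> *s v)"
proof -
  have "linear (\<lambda>v :: complex^'n. \<i> *s v)"
    by (simp add: linear_iff vec.scale_right_distrib vec_eq_iff)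
  then show ?thesis by (simp add: linear_conv_bounded_linear)
qed

lemma scale_eq_real_parts: "c *s v = Re c *\<^sub>R v + Im c *\<^sub>R (\<i> *s v)"
  by (simp add: vec_eq_iff complex_eq_iff)

lemma bounded_bilinear_cdot: "bounded_bilinear (cdot :: complex^'m::finite \<Rightarrow> _)"
proof -
  have "cdot (r *\<^sub>R u) w = r *\<^sub>R cdot u w" "cdot u (r *\<^sub>R w) = r *\<^sub>R cdot u w"
    for r and u w :: "complex^'m"
    using cdot_scale(1)[of "complex_of_real r" u w] cdot_scale(2)[of u "complex_of_real r" w]
    by (simp_all add: scale_of_real scaleR_conv_of_real[where 'a = complex])
  then have "bilinear (cdot :: complex^'m \<Rightarrow> _)"
    unfolding bilinear_def linear_iff by (simp add: cdot_add)
  then show ?thesis using bilinear_conv_bounded_bilinear by blast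
qed

context brake_flow
begin

text \<open>The coefficients are real, so multiplication by \<open>\<i>\<close> commutes with them.
  Real orthogonality to both \<open>e\<close> and \<open>e'\<close> amounts to one complex
  orthogonality condition.\<close>

lemma eigen_ii:
  assumes "neu.eigen \<mu> e"
  obtains e' where "neu.eigen \<mu> e'" "\<And>t. t \<in> {0..T / 2} \<Longrightarrow> pos e' t = \<i> *s pos e t"
proof -
  note bl = bounded_linear_scale_ii[where 'n = 'n]
  have c: "continuous_on {0..T / 2} (\<lambda>t. \<i> *s vel e t)"
    by (intro bounded_linear.continuous_on[OF bl] continuous_intros)
  obtain e' where e': "fst e' = \<i> *s pos e 0" "\<And>t. t \<in> {0..T / 2} \<Longrightarrow> vel e' t = \<i> *s vel e t"
    by (rule curve_exists[OF c, of "\<i> *s pos e 0"]) blast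
  have p: "pos e' t = \<i> *s pos e t" if "t \<in> {0..T / 2}" for t
    by (rule pos_eqI[of "T / 2" "\<lambda>t. \<i> *s pos e t" "\<lambda>t. \<i> *s vel e t"])
      (use e' that in \<open>auto intro!: bounded_linear.has_vector_derivative[OF bl] has_vector_derivative_pos\<close>)
  have m: "neu.mom e' t = \<i> *s neu.mom e t" "neu.frc e' t = \<i> *s neu.frc e t" if "t \<in> {0..T / 2}" for t
    by (simp_all add: neu.mom_def neu.frc_def p[OF that] e'(2)[OF that] vector_scalar_commute vec.scale_right_distrib)
  have "neu.eigen \<mu> e'"
    unfolding neu.eigen_def
  proof (intro conjI ballI)
    show "neu.mom e' (T / 2) = 0" using assms T_pos m(1)[of "T / 2"] by (simp add: neu.eigen_def)
    fix t assume t: "t \<in> {0..T / 2}"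
    have cc: "continuous_on {0..T / 2} (\<lambda>s. neu.frc e s - \<mu> *\<^sub>R pos e s)"
      by (intro continuous_intros)
    have i: "(\<lambda>s. neu.frc e s - \<mu> *\<^sub>R pos e s) integrable_on {0..t}"
      using t by (intro integrable_continuous_interval continuous_on_subset[OF cc]) auto
    have "neu.mom e' t = \<i> *s integral {0..t} (\<lambda>s. neu.frc e s - \<mu> *\<^sub>R pos e s)"
      using assms t by (simp add: m neu.eigen_def)
    also have "\<dots> = integral {0..t} (\<lambda>s. \<i> *s (neu.frc e s - \<mu> *\<^sub>R pos e s))"
      using integral_linear[OF i bl] by (simp add: o_def)
    also have "\<dots> = integral {0..t} (\<lambda>s. neu.frc e' s - \<mu> *\<^sub>R pos e' s)"
      using t by (intro integral_cong)
        (simp add: m p vec.scale_right_diff_distrib, simp add: vec_eq_iff)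
    finally show "neu.mom e' t = integral {0..t} (\<lambda>s. neu.frc e' s - \<mu> *\<^sub>R pos e' s)" .
  qed
  then show ?thesis using that p by blast
qed

lemma cdot_integral:
  fixes x y :: "real \<Rightarrow> complex^'n"
  assumes x: "continuous_on {0..T / 2} x" and y: "continuous_on {0..T / 2} y"
  shows "(\<lambda>t. cdot (x t) (y t)) integrable_on {0..T / 2}"
    "Re (integral {0..T / 2} (\<lambda>t. cdot (x t) (y t))) = integral {0..T / 2} (\<lambda>t. x t \<bullet> y t)"
    "Im (integral {0..T / 2} (\<lambda>t. cdot (x t) (y t))) = integral {0..T / 2} (\<lambda>t. x t \<bullet> (\<i> *s y t))"
proof -
  show i: "(\<lambda>t. cdot (x t) (y t)) integrable_on {0..T / 2}"
    by (intro integrable_continuous_interval bounded_bilinear.continuous_on[OF bounded_bilinear_cdot] x y)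
  show "Re (integral {0..T / 2} (\<lambda>t. cdot (x t) (y t))) = integral {0..T / 2} (\<lambda>t. x t \<bullet> y t)"
    using integral_linear[OF i bounded_linear_Re] by (simp add: o_def Re_cdot)
  have "Im z = Re (cnj \<i> * z)" for z by simp
  then have "Im (cdot u v) = u \<bullet> (\<i> *s v)" for u v :: "complex^'n"
    by (simp only: cdot_scale(2)[symmetric] Re_cdot)
  then show "Im (integral {0..T / 2} (\<lambda>t. cdot (x t) (y t))) = integral {0..T / 2} (\<lambda>t. x t \<bullet> (\<i> *s y t))"
    using integral_linear[OF i bounded_linear_Im] by (simp add: o_def)
qed

text \<open>Were the dimension above k, some nonzero \<open>v\<close> in \<open>X\<close> would give
  a solution orthogonal to the even parts of a basis of the negative eigenspaces. Minimizing
  orthogonally to them gives a further negative Neumann eigenfunction. Its even extension either has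
  a new eigenvalue, so that the index exceeds k, or lies in the span of the basis, so that it is
  orthogonal to itself.\<close>

lemma nonpositive_subspace_dim_le:
  assumes morse: "morse_index T P Q R = enat k"
    and X: "vec.subspace X" "X \<subseteq> E" and s: "s = 1 \<or> s = - 1"
    and neg: "\<And>v. v \<in> X \<Longrightarrow>
      Re (pairing (G (T / 2) *v (v + s *s flip v)) (G (T / 2) *v (v + s *s flip v))) \<le> 0"
  shows "vec.dim X \<le> k"
proof (rule ccontr)
  assume "\<not> vec.dim X \<le> k"
  then have k: "k < vec.dim X" by simp
  let ?V = "eigenspace T P Q R"
  let ?Fs = "{F. finite F \<and> F \<subseteq> negative_eigenvalues T P Q R}"
  have "enat k \<in> (\<lambda>F. \<Sum>\<mu>\<in>F. cfun_dim (?V \<mu>)) ` ?Fs"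
    using morse unfolding morse_index_def by (rule Sup_enat_attained) auto
  then obtain F where F: "finite F" "F \<subseteq> negative_eigenvalues T P Q R"
    and sumF: "(\<Sum>\<mu>\<in>F. cfun_dim (?V \<mu>)) = enat k" by auto
  have "\<exists>d. cfun_dim (?V \<mu>) = enat d" if "\<mu> \<in> F" for \<mu>
  proof -
    have "cfun_dim (?V \<mu>) \<le> enat k" unfolding sumF[symmetric] using F(1) that
      by (intro member_le_sum) auto
    then show ?thesis using enat_ile by blast
  qed
  then have "\<exists>B. finite B \<and> B \<subseteq> ?V \<mu> \<and> cfun_dim (?V \<mu>) = enat (card B) \<and> ?V \<mu> \<subseteq> cfun.span B"
    if "\<mu> \<in> F" for \<mu> using that cfun_basis_exists by metis
  then obtain B where B: "\<And>\<mu>. \<mu> \<in> F \<Longrightarrow> finite (B \<mu>)" "\<And>\<mu>. \<mu> \<in> F \<Longrightarrow> B \<mu> \<subseteq> ?V \<mu>"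
    "\<And>\<mu>. \<mu> \<in> F \<Longrightarrow> cfun_dim (?V \<mu>) = enat (card (B \<mu>))" "\<And>\<mu>. \<mu> \<in> F \<Longrightarrow> ?V \<mu> \<subseteq> cfun.span (B \<mu>)"
    by metis
  \<comment> \<open>Pairs keep the eigenvalue with each basis element, and the multiplicities add up
    to exactly k.\<close>
  define I where "I = Sigma F B"
  have I: "finite I" "card I = k"
  proof -
    show "finite I" unfolding I_def using F(1) B(1) by (intro finite_SigmaI) auto
    have "enat (\<Sum>\<mu>\<in>F. card (B \<mu>)) = enat k"
      unfolding sumF[symmetric] using B(3) by (simp add: of_nat_eq_enat[symmetric])
    then show "card I = k" unfolding I_def using F(1) B(1) by (subst card_SigmaI) auto
  qed
  have "\<exists>e. neu.eigen (fst i) e \<and> (\<forall>t\<in>{0..T / 2}. pos e t = snd i t + snd i (T - t))" if "i \<in> I" for i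
  proof -
    have "snd i \<in> ?V (fst i)" using that B(2)[of "fst i"] by (auto simp: I_def)
    from eigenspace_even_part[OF this] show ?thesis by metis
  qed
  then obtain e1 where e1: "\<And>i. i \<in> I \<Longrightarrow> neu.eigen (fst i) (e1 i)"
    "\<And>i t. i \<in> I \<Longrightarrow> t \<in> {0..T / 2} \<Longrightarrow> pos (e1 i) t = snd i t + snd i (T - t)" by metis
  have "\<exists>e. neu.eigen (fst i) e \<and> (\<forall>t\<in>{0..T / 2}. pos e t = \<i> *s pos (e1 i) t)" if "i \<in> I" for i
    using eigen_ii[OF e1(1)[OF that]] by metis
  then obtain e2 where e2: "\<And>i. i \<in> I \<Longrightarrow> neu.eigen (fst i) (e2 i)"
    "\<And>i t. i \<in> I \<Longrightarrow> t \<in> {0..T / 2} \<Longrightarrow> pos (e2 i) t = \<i> *s pos (e1 i) t" by metis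
  \<comment> \<open>An eigenfunction odd about T/2 contributes a vanishing position; this is
    harmless, as \<open>Y\<close> serves only to impose orthogonality.\<close>
  define Y where "Y = e1 ` I \<union> e2 ` I"
  have finY: "finite Y" using I(1) by (simp add: Y_def)
  have "\<forall>b\<in>Y. \<exists>m. neu.eigen m b" unfolding Y_def using e1(1) e2(1) by blast
  then obtain \<mu> where "\<And>b. b \<in> Y \<Longrightarrow> neu.eigen (\<mu> b) b" by metis
  then have weak: "neu.form b e = \<mu> b * neu.ip b e" if "b \<in> Y" for b e
    using that by (intro neu.eigen_weak) blast
  \<comment> \<open>One complex functional for each of the k indices: its real and imaginary parts
    are the products with \<open>e1 i\<close> and \<open>e2 i\<close>.\<close>
  define \<phi> where "\<phi> i v = integral {0..T / 2} (\<lambda>t. cdot (\<xi> (v + s *s flip v) t) (pos (e1 i) t))" for i v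
  have c\<xi>: "continuous_on {0..T / 2} (\<xi> w)" for w
    by (intro continuous_at_imp_continuous_on ballI has_vector_derivative_continuous[OF flow_derivative(1)])
  have \<xi>_add: "\<xi> ((u + v) + s *s flip (u + v)) t = \<xi> (u + s *s flip u) t + \<xi> (v + s *s flip v) t" for u v t
    by (simp add: matrix_vector_right_distrib vec.scale_right_distrib parts_linear)
  have \<xi>_scale: "\<xi> (c *s u + s *s flip (c *s u)) t = c *s \<xi> (u + s *s flip u) t" for u c t
    by (simp add: matrix_vector_right_distrib vec.scale_right_distrib parts_linear vector_scalar_commute
        mult.commute)
  have "\<exists>v\<in>X. v \<noteq> 0 \<and> (\<forall>i\<in>I. \<phi> i v = 0)"
  proof (rule vec_common_kernel[OF I(1) X(1)])
    show "card I < vec.dim X" using k I(2) by simp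
    show "\<phi> i (u + v) = \<phi> i u + \<phi> i v" for i u v
      unfolding \<phi>_def \<xi>_add cdot_add
      by (intro integral_add cdot_integral c\<xi> continuous_intros)
    show "\<phi> i (c *s u) = c * \<phi> i u" for i c u
      unfolding \<phi>_def \<xi>_scale cdot_scale by simp
  qed
  then obtain v where v: "v \<in> X" "v \<noteq> 0" "\<And>i. i \<in> I \<Longrightarrow> \<phi> i v = 0" by blast
  have vE: "v \<in> E" using v(1) X(2) by blast
  obtain e where e: "\<And>t. t \<in> {0..T / 2} \<Longrightarrow> pos e t = \<xi> (v + s *s flip v) t" "\<not> neu.eigen 0 e"
    "2 * neu.form e e = Re (pairing (G (T / 2) *v (v + s *s flip v)) (G (T / 2) *v (v + s *s flip v)))"
    by (rule flow_curve_form[OF vE v(2) s]) blast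
  have "e \<in> neu.orth Y"
  proof -
    have "neu.ip e (e1 i) = 0 \<and> neu.ip e (e2 i) = 0" if i: "i \<in> I" for i
    proof -
      have "neu.ip e (e1 i) = Re (\<phi> i v)"
        unfolding \<phi>_def cdot_integral(2)[OF c\<xi> continuous_pos] neu.ip_def
        by (intro integral_cong) (simp add: e(1))
      moreover have "neu.ip e (e2 i) = Im (\<phi> i v)"
        unfolding \<phi>_def cdot_integral(3)[OF c\<xi> continuous_pos] neu.ip_def
        by (intro integral_cong) (simp add: e(1) e2(2)[OF i])
      ultimately show ?thesis using v(3)[OF i] by simp
    qed
    then show ?thesis by (auto simp: neu.orth_def Y_def)
  qed
  moreover have "neu.form e e \<le> 0" using neg[OF v(1)] e(3) by simp
  ultimately obtain m g where g: "m < 0" "g \<in> neu.orth Y" "neu.ip g g = 1" "neu.eigen m g"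
    using neu.negative_eigenfunction_exists[OF finY weak _ _ e(2)] by blast
  obtain b where b: "b \<in> ?V m" "\<And>t. t \<in> {0..T / 2} \<Longrightarrow> b t = pos g t"
    "\<And>t. t \<in> {0..T / 2} \<Longrightarrow> b (T - t) = pos g t"
    by (rule eigen_even_extension[OF g(4)]) blast
  show False
  proof (cases "m \<in> F")
    case True
    have "b \<in> cfun.span (B m)" using B(4)[OF True] b(1) by blast
    then obtain c where c: "b = (\<Sum>u\<in>B m. fun_scale (c u) u)"
      unfolding cfun.span_finite[OF B(1)[OF True]] by blast
    have bt: "b t = (\<Sum>u\<in>B m. c u *s u t)" for t
      by (subst c) (simp add: sum_fun_apply fun_scale_def)
    have i: "(m, u) \<in> I" if "u \<in> B m" for u using that True by (simp add: I_def)
    \<comment> \<open>Since \<open>b\<close> is even about T/2, symmetrizing its expansion in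
      \<open>B m\<close> expresses twice \<open>g\<close> through curves of \<open>Y\<close>, to all
      of which \<open>g\<close> is orthogonal.\<close>
    have "2 *\<^sub>R pos g t = (\<Sum>u\<in>B m. Re (c u) *\<^sub>R pos (e1 (m, u)) t + Im (c u) *\<^sub>R pos (e2 (m, u)) t)"
      if t: "t \<in> {0..T / 2}" for t
    proof -
      have "2 *\<^sub>R pos g t = b t + b (T - t)" using b(2,3)[OF t] by (simp add: scaleR_2)
      also have "\<dots> = (\<Sum>u\<in>B m. c u *s (u t + u (T - t)))"
        by (simp add: bt sum.distrib vec.scale_right_distrib)
      also have "\<dots> = (\<Sum>u\<in>B m. Re (c u) *\<^sub>R pos (e1 (m, u)) t + Im (c u) *\<^sub>R pos (e2 (m, u)) t)"
        using e1(2)[OF i t] e2(2)[OF i t] by (intro sum.cong refl) (simp add: scale_eq_real_parts[of "c _"] scaleR_add_right)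
      finally show ?thesis .
    qed
    moreover have lin_ip: "linear (neu.ip g)" using neu.bilinear_ip unfolding bilinear_def by blast
    ultimately have "neu.ip g (2 *\<^sub>R g) = neu.ip g (\<Sum>u\<in>B m. Re (c u) *\<^sub>R e1 (m, u) + Im (c u) *\<^sub>R e2 (m, u))"
      unfolding neu.ip_def
      by (intro integral_cong) (simp add: pos_sum)
    also have "\<dots> = (\<Sum>u\<in>B m. Re (c u) * neu.ip g (e1 (m, u)) + Im (c u) * neu.ip g (e2 (m, u)))"
      by (simp add: linear_sum[OF lin_ip] bilinear_radd[OF neu.bilinear_ip]
          bilinear_rmul[OF neu.bilinear_ip])
    also have "\<dots> = 0"
      using g(2) i by (intro sum.neutral) (auto simp: neu.orth_def Y_def)
    finally show False using g(3) by (simp add: bilinear_rmul[OF neu.bilinear_ip])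
  next
    case False
    have bnz: "b \<noteq> (\<lambda>t. 0)"
    proof
      assume "b = (\<lambda>t. 0)"
      then have "neu.ip g g = integral {0..T / 2} (\<lambda>t. 0)"
        unfolding neu.ip_def using b(2) by (intro integral_cong) (metis inner_zero_left)
      then show False using g(3) by simp
    qed
    \<comment> \<open>The sum over \<open>F\<close> is already the whole index k, so adding the new
      eigenvalue \<open>m\<close> would raise it to at least k + 1.\<close>
    have "enat (card {b}) \<le> cfun_dim (?V m)"
      using b(1) bnz by (intro cfun_dim_ge)
        (auto simp: cfun.independent_insert cfun.independent_empty cfun.span_empty zero_fun_def)
    then have "enat (1 + k) \<le> cfun_dim (?V m) + enat k"
      unfolding plus_enat_simps(1)[symmetric] by (intro add_right_mono) (simp add: one_enat_def)
    also have "\<dots> = (\<Sum>\<mu>\<in>insert m F. cfun_dim (?V \<mu>))"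
      using F(1) False sumF by simp
    also have "\<dots> \<le> morse_index T P Q R"
      unfolding morse_index_def using F b(1) bnz g(1)
      by (intro SUP_upper) (auto simp: negative_eigenvalues_def)
    finally show False using morse by simp
  qed
qed

text \<open>\<open>h\<close> is the boundary form for s = 1. \<open>X1\<close> is handled directly;
  on \<open>X2\<close>, \<open>boundary_form_opposite\<close> reverses the sign on passing to s =
  -1, so each part has dimension at most k.\<close>

theorem E_dim_le:
  assumes "morse_index T P Q R = enat k"
  shows "vec.dim E \<le> 2 * k"
proof -
  define h where "h u v = pairing (G (T / 2) *v (u + 1 *s flip u)) (G (T / 2) *v (v + 1 *s flip v))" for u v
  have "\<exists>X1 X2. vec.subspace X1 \<and> vec.subspace X2 \<and> X1 \<subseteq> E \<and> X2 \<subseteq> E \<and>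
    vec.dim E \<le> vec.dim X1 + vec.dim X2 \<and>
    (\<forall>v\<in>X1. Re (h v v) \<le> 0) \<and> (\<forall>v\<in>X2. 0 \<le> Re (h v v))"
  proof (rule hermitian_splitting[OF subspace_E, of h])
    show "h (u + v) w = h u w + h v w" for u v w
      unfolding h_def pairing_add(1)[symmetric]
      by (simp add: matrix_vector_right_distrib add_ac)
    show "h (c *s u) w = c * h u w" for c u w
      unfolding h_def pairing_scale(1)[symmetric]
      by (simp add: matrix_vector_right_distrib vector_scalar_commute vec.scale_right_distrib)
    show "h v u = cnj (h u v)" for u v
      unfolding h_def by (rule pairing_cnj)
  qed
  then obtain X1 X2 where X: "vec.subspace X1" "vec.subspace X2" "X1 \<subseteq> E" "X2 \<subseteq> E"
    "vec.dim E \<le> vec.dim X1 + vec.dim X2"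
    "\<And>v. v \<in> X1 \<Longrightarrow> Re (h v v) \<le> 0" "\<And>v. v \<in> X2 \<Longrightarrow> 0 \<le> Re (h v v)" by blast
  have "vec.dim X1 \<le> k"
    using nonpositive_subspace_dim_le[OF assms X(1,3), of 1] X(6) by (simp add: h_def)
  moreover have "vec.dim X2 \<le> k"
  proof (rule nonpositive_subspace_dim_le[OF assms X(2,4), of "- 1"])
    fix v assume v: "v \<in> X2"
    let ?p = "G (T / 2) *v v" and ?q = "G (T / 2) *v flip v"
    have "pairing (?p + ?q) (?p + ?q) = h v v"
      by (simp add: h_def matrix_vector_right_distrib)
    moreover have "?p - ?q = G (T / 2) *v (v + (- 1) *s flip v)"
      by (simp add: matrix_vector_mult_diff_distrib)
    moreover have "pairing (?p + ?q) (?p + ?q) + pairing (?p - ?q) (?p - ?q) = 0"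
      using boundary_form_opposite v X(4) by blast
    ultimately have "h v v + pairing (G (T / 2) *v (v + (- 1) *s flip v)) (G (T / 2) *v (v + (- 1) *s flip v)) = 0"
      by simp
    then have "Re (h v v) + Re (pairing (G (T / 2) *v (v + (- 1) *s flip v)) (G (T / 2) *v (v + (- 1) *s flip v))) = 0"
      by (metis plus_complex.sel(1) zero_complex.sel(1))
    then show "Re (pairing (G (T / 2) *v (v + (- 1) *s flip v)) (G (T / 2) *v (v + (- 1) *s flip v))) \<le> 0"
      using X(7)[OF v] by linarith
  qed simp
  ultimately show ?thesis using X(5) by simp
qed

end

theorem theorem1p9:
  fixes T :: real
    and L :: "real \<times> (real^'n::finite) \<times> (real^'n) \<Rightarrow> real"
    and x :: "real \<Rightarrow> real^'n"
    and P Q R :: "real \<Rightarrow> real^'n^'n"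
    and \<gamma> :: "real \<Rightarrow> real^('n + 'n)^('n + 'n)"
    and k :: nat
  assumes "T > 0"
    and "periodic_convex_lagrangian T L"
    and "brake_orbit T L x"
    and "P = coeff_P L x" and "Q = coeff_Q L x" and "R = coeff_R L x"
    and "fundamental_solution P Q R \<gamma>"
    and "morse_index T P Q R = enat k"
  shows "vec.dim (vec.span
           (\<Union>z \<in> mat_spectrum (complexify (\<gamma> T)) \<inter> {z. Im z > 0}.
              mat_kernel (complexify (\<gamma> T) - mat z))) \<le> 2 * k"
proof -
  interpret brake_flow T P Q R \<gamma>
    using assms by unfold_locales (simp_all add: brake_orbit_def)
  show ?thesis using E_dim_le[OF assms(8)] by (simp only: E_def)
qed

end
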